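(* Let $C\in\mathcal{S}=\{T,\,CS,\,CH,\,CCZ,\,CCX,\,\mathit{CSWAP}\}$ be an operator acting on specified qubits among $n$ qubits, and let $U|G\rangle$ be a state, where $G$ is a graph on the vertex set $\{1,\dots,n\}$ and $U$ is a tensor product of local Clifford operations, one on each vertex. Then one can find two states $U_1|G_1\rangle$ and $U_2|G_2\rangle$, where $G_1,G_2$ are graphs on $\{1,\dots,n\}$ and $U_1,U_2$ are tensor products of local Clifford operations, such that, for suitable complex coefficients $c_1,c_2$ (possibly zero), $$C\,U\,|G\rangle = c_1\,U_1|G_1\rangle + c_2\,U_2|G_2\rangle ,$$ in runtime $O(nd)$, where $d$ is the average degree of $G$.
   Context: All states live in $(\mathbb{C}^2)^{\otimes n}$, with qubits numbered $1,\dots,n$. For a gate $W$ the notation $W_a$, $W_{a,b}$, etc. means that $W$ is applied to the indicated qubits and the identity to all others. Single-qubit gates: $X=\begin{pmatrix}0&1\\1&0\end{pmatrix}$, $Z=\begin{pmatrix}1&0\\0&-1\end{pmatrix}$, $H=\frac{1}{\sqrt2}\begin{pmatrix}1&1\\1&-1\end{pmatrix}$, $S=\begin{pmatrix}1&0\\0&i\end{pmatrix}$, $T=\begin{pmatrix}1&0\\0&e^{i\pi/4}\end{pmatrix}$. For a gate $W$, the controlled gate is $CW=\begin{pmatrix}I&0\\0&W\end{pmatrix}$, with the control qubit written first; this can be nested. Thus $CS$, $CH$ are controlled-$S$ and controlled-$H$; $CCZ$ and $CCX$ (Toffoli) are the doubly controlled $Z$ and $X$; $\mathit{CSWAP}$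 is the controlled version of the gate $\mathit{SWAP}$ exchanging two qubits. A local Clifford operation is an element of the group $\langle H,S\rangle$ generated by $H$ and $S$ (24 of them up to global phase). For a graph $G=(V,E)$ with $V=\{1,\dots,n\}$, the graph state $|G\rangle$ is the state stabilized by the operators $g_i=X_i\prod_{j\in \mathrm{nbhd}(i)}Z_j$ for all $i\in V$ (that is, $g_i|G\rangle=|G\rangle$), where $\mathrm{nbhd}(i)$ is the set of neighbours of $i$; explicitly $|G\rangle=\prod_{(a,b)\in E}CZ_{a,b}\,|+\rangle^{\otimes n}$ with $|+\rangle=\frac{1}{\sqrt2}(|0\rangle+|1\rangle)$. A state $U|G\rangle$ is stored as the graph (as an adjacency list) together with the local Clifford operation at each vertex.
   Formalization: The runtime O(nd) is proved as O(n·max(1,d)), where d is the average degree; for d ≥ 1 this is O(nd), while for d near 0 (e.g. a graph without edges, where nd = 0) the literal bound fails since writing n local Cliffords takes order n steps. *)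

theory Defs
  imports Complex_Main "HOL-Algebra.Generated_Groups" "Jordan_Normal_Form.Matrix"
begin

section \<open>Gates\<close>

definition gate_X :: "complex mat" where
  "gate_X = mat_of_rows_list 2 [[0, 1], [1, 0]]"

definition gate_Z :: "complex mat" where
  "gate_Z = mat_of_rows_list 2 [[1, 0], [0, -1]]"

definition gate_H :: "complex mat" where
  "gate_H = complex_of_real (1 / sqrt 2) \<cdot>\<^sub>m mat_of_rows_list 2 [[1, 1], [1, -1]]"

definition gate_S :: "complex mat" where
  "gate_S = mat_of_rows_list 2 [[1, 0], [0, \<i>]]"

definition gate_T :: "complex mat" where
  "gate_T = mat_of_rows_list 2 [[1, 0], [0, exp (\<i> * complex_of_real pi / 4)]]"

definition gate_SWAP :: "complex mat" where
  "gate_SWAP = mat_of_rows_list 4 [[1, 0, 0, 0], [0, 0, 1, 0], [0, 1, 0, 0], [0, 0, 0, 1]]"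

definition controlled :: "complex mat \<Rightarrow> complex mat" where
  "controlled W = four_block_mat
     (1\<^sub>m (dim_row W)) (0\<^sub>m (dim_row W) (dim_col W))
     (0\<^sub>m (dim_row W) (dim_col W)) W"

definition gate_set :: "complex mat set" where
  "gate_set =
     {gate_T, controlled gate_S, controlled gate_H,
      controlled (controlled gate_Z), controlled (controlled gate_X), controlled gate_SWAP}"

text \<open>The subgroup of the invertible complex \<open>2 \<times> 2\<close> matrices generated by \<open>H\<close> and \<open>S\<close>.\<close>

definition local_clifford :: "complex mat set" where
  "local_clifford = generate (units_of (ring_mat TYPE(complex) 2 ())) {gate_H, gate_S}"


section \<open>Operators on \<open>n\<close> qubits\<close>

text \<open>Vectors of dimension \<open>2 ^ n\<close>, in the computational basis. Qubits are numbered from 1, and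
  qubit 1 is the most significant binary digit of the index of a basis vector, so that the index
  order is that of the tensor product.\<close>

definition qubit_val :: "nat \<Rightarrow> nat \<Rightarrow> nat \<Rightarrow> nat" where
  "qubit_val n k q = k div 2 ^ (n - q) mod 2"

definition sub_index :: "nat \<Rightarrow> nat list \<Rightarrow> nat \<Rightarrow> nat" where
  "sub_index n qs k = foldl (\<lambda>m q. 2 * m + qubit_val n k q) 0 qs"

text \<open>\<open>W\<close> applied to the (distinct) qubits \<open>qs\<close>, in this order, and the identity elsewhere.\<close>

definition on_qubits :: "nat \<Rightarrow> nat list \<Rightarrow> complex mat \<Rightarrow> complex mat" where
  "on_qubits n qs W = mat (2 ^ n) (2 ^ n) (\<lambda>(i, j).
     if \<forall>q\<in>{1..n} - set qs. qubit_val n i q = qubit_val n j q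
     then W $$ (sub_index n qs i, sub_index n qs j) else 0)"

text \<open>The tensor product \<open>u 1 \<otimes> \<dots> \<otimes> u n\<close>, for \<open>2 \<times> 2\<close> matrices and for vectors of dimension 2.\<close>

definition tensor_op :: "nat \<Rightarrow> (nat \<Rightarrow> complex mat) \<Rightarrow> complex mat" where
  "tensor_op n u = mat (2 ^ n) (2 ^ n)
     (\<lambda>(i, j). \<Prod>q=1..n. u q $$ (qubit_val n i q, qubit_val n j q))"

definition tensor_vec :: "nat \<Rightarrow> (nat \<Rightarrow> complex vec) \<Rightarrow> complex vec" where
  "tensor_vec n f = vec (2 ^ n) (\<lambda>k. \<Prod>q=1..n. f q $ qubit_val n k q)"


section \<open>Graph states\<close>

definition simple_graph :: "nat \<Rightarrow> nat set set \<Rightarrow> bool" where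
  "simple_graph n E \<longleftrightarrow> E \<subseteq> {{a, b} | a b. a \<in> {1..n} \<and> b \<in> {1..n} \<and> a \<noteq> b}"

definition nbhd :: "nat set set \<Rightarrow> nat \<Rightarrow> nat set" where
  "nbhd E v = {w. {v, w} \<in> E}"

definition average_degree :: "nat \<Rightarrow> nat set set \<Rightarrow> real" where
  "average_degree n E = (\<Sum>v=1..n. real (card (nbhd E v))) / real n"

definition ket_plus :: "complex vec" where
  "ket_plus = complex_of_real (1 / sqrt 2) \<cdot>\<^sub>v vec_of_list [1, 1]"

text \<open>The factors \<open>CZ\<close> commute; the list enumerates every edge once.\<close>

definition graph_state :: "nat \<Rightarrow> nat set set \<Rightarrow> complex vec" where
  "graph_state n E =
     foldr (\<lambda>(a, b) \<psi>. on_qubits n [a, b] (controlled gate_Z) *\<^sub>v \<psi>)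
       [(a, b). a \<leftarrow> [1..<Suc n], b \<leftarrow> [Suc a..<Suc n], {a, b} \<in> E]
       (tensor_vec n (\<lambda>_. ket_plus))"


section \<open>Machine model\<close>

text \<open>A random access machine on natural numbers with indirect addressing. Registers and arrays
  are named by numbers; a program mentions only finitely many of them. Every instruction and every
  evaluation of a guard costs one time unit. The only arithmetic is increment and decrement, so that
  within time \<open>t\<close> no number exceeds the numbers in the input and the program by more than \<open>t\<close>: unit
  cost is not distorted by computations on huge numbers.\<close>

record memory =
  reg :: "nat \<Rightarrow> nat"
  arr :: "nat \<Rightarrow> nat \<Rightarrow> nat"

datatype program =
    Skip
  | Const nat nat
  | Copy nat nat
  | Incr nat
  | Decr nat
  | Load nat nat nat
  | Store nat nat nat
  | Seq program program
  | If_less nat nat program program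
  | While_less nat nat program

text \<open>\<open>exec p s t s'\<close>: started in memory \<open>s\<close>, the program \<open>p\<close> halts after exactly \<open>t\<close> steps in
  memory \<open>s'\<close>.\<close>

inductive exec :: "program \<Rightarrow> memory \<Rightarrow> nat \<Rightarrow> memory \<Rightarrow> bool" where
  Skip: "exec Skip s 1 s"
| Const: "exec (Const x k) s 1 (s\<lparr>reg := (reg s)(x := k)\<rparr>)"
| Copy: "exec (Copy x y) s 1 (s\<lparr>reg := (reg s)(x := reg s y)\<rparr>)"
| Incr: "exec (Incr x) s 1 (s\<lparr>reg := (reg s)(x := reg s x + 1)\<rparr>)"
| Decr: "exec (Decr x) s 1 (s\<lparr>reg := (reg s)(x := reg s x - 1)\<rparr>)"
| Load: "exec (Load x a y) s 1 (s\<lparr>reg := (reg s)(x := arr s a (reg s y))\<rparr>)"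
| Store: "exec (Store a x y) s 1
    (s\<lparr>arr := (arr s)(a := (arr s a)(reg s x := reg s y))\<rparr>)"
| Seq: "exec p s t s' \<Longrightarrow> exec q s' t' s'' \<Longrightarrow> exec (Seq p q) s (t + t') s''"
| If_true: "reg s x < reg s y \<Longrightarrow> exec p s t s' \<Longrightarrow> exec (If_less x y p q) s (1 + t) s'"
| If_false: "\<not> reg s x < reg s y \<Longrightarrow> exec q s t s' \<Longrightarrow> exec (If_less x y p q) s (1 + t) s'"
| While_true: "reg s x < reg s y \<Longrightarrow> exec p s t s' \<Longrightarrow> exec (While_less x y p) s' t' s'' \<Longrightarrow>
    exec (While_less x y p) s (1 + t + t') s''"
| While_false: "\<not> reg s x < reg s y \<Longrightarrow> exec (While_less x y p) s 1 s"


section \<open>Storage of states\<close>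

text \<open>A numbering of the finitely many local Clifford operations: every number below \<open>N\<close> denotes
  one of them, and each of them has a number.\<close>

definition clifford_numbering :: "nat \<Rightarrow> (nat \<Rightarrow> complex mat) \<Rightarrow> bool" where
  "clifford_numbering N cl \<longleftrightarrow> cl ` {..<N} = local_clifford"

text \<open>Such a numbering exists: multiplication by an element of the group maps a finite set \<open>F\<close> of
  matrices to itself, and \<open>F\<close> contains the identity.\<close>

abbreviation mat2 :: "complex \<Rightarrow> complex \<Rightarrow> complex \<Rightarrow> complex \<Rightarrow> complex mat" where
  "mat2 a b c d \<equiv> mat_of_rows_list 2 [[a, b], [c, d]]"

lemma mat2_mult:
  "mat2 a b c d * mat2 a' b' c' d' =
   mat2 (a * a' + b * c') (a * b' + b * d') (c * a' + d * c') (c * b' + d * d')"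
  by (rule eq_matI)
     (auto simp: mat_of_rows_list_def scalar_prod_def numeral_2_eq_2 less_Suc_eq)

lemma clifford_numbering_exists: "\<exists>N cl. clifford_numbering N cl"
proof -
  define r :: complex where "r = complex_of_real (1 / sqrt 2)"
  have rr: "r * r = 1 / 2" by (simp add: r_def flip: of_real_mult)
  define W where "W = {z :: complex. z ^ 8 = 1}"
  define I where "I = {1, -1, \<i>, -\<i>}"
  define \<D> where "\<D> = (\<lambda>(w, k). mat2 w 0 0 (w * k)) ` (W \<times> I)"
  define \<A> where "\<A> = (\<lambda>(w, k). mat2 0 (w * k) w 0) ` (W \<times> I)"
  define \<H> where "\<H> = (\<lambda>(w, k, l). mat2 (r * w) (r * (w * l)) (r * (w * k)) (- (r * (w * k * l)))) ` (W \<times> I \<times> I)"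
  define F where "F = \<D> \<union> \<A> \<union> \<H>"
  have finW: "finite W"
    unfolding W_def by (rule finite_roots_unity) simp
  have finF: "finite F"
    using finW by (simp add: F_def \<D>_def \<A>_def \<H>_def I_def)
  have DI: "mat2 w 0 0 x \<in> F" if "w \<in> W" "k \<in> I" "x = w * k" for w k x
    using that unfolding F_def \<D>_def by force
  have AI: "mat2 0 x w 0 \<in> F" if "w \<in> W" "k \<in> I" "x = w * k" for w k x
    using that unfolding F_def \<A>_def by force
  have HI: "mat2 a b c d \<in> F" if "w \<in> W" "k \<in> I" "l \<in> I"
    "a = r * w" "b = r * (w * l)" "c = r * (w * k)" "d = - (r * (w * k * l))" for w k l a b c d
    using that unfolding F_def \<H>_def by force
  have I1: "1 \<in> I" "-1 \<in> I" "\<i> \<in> I" "-\<i> \<in> I" by (auto simp: I_def)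
  have Ii: "\<i> * k \<in> I" "-\<i> * k \<in> I" if "k \<in> I" for k using that by (auto simp: I_def)
  have i8: "\<i> ^ 8 = 1" by (simp add: eval_nat_numeral)
  have Wi: "\<i> * w \<in> W" if "w \<in> W" for w using that by (simp add: W_def power_mult_distrib i8)
  have r2: "r\<^sup>2 = 1 / 2" using rr by (simp add: power2_eq_square)
  have r8: "r ^ 8 = 1 / 16"
  proof -
    have "r ^ 8 = (r\<^sup>2) ^ 4" by (simp flip: power_mult)
    also have "\<dots> = 1 / 16" unfolding r2 by (simp add: eval_nat_numeral)
    finally show ?thesis .
  qed
  have e8: "(1 + \<i>) ^ 8 = 16" "(1 - \<i>) ^ 8 = 16"
    by (simp_all add: eval_nat_numeral algebra_simps)
  have Wr: "r * (1 + \<i>) * w \<in> W" "r * (1 - \<i>) * w \<in> W" if "w \<in> W" for w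
    using that by (simp_all add: W_def power_mult_distrib r8 e8)
  have gS: "gate_S = mat2 1 0 0 \<i>" by (simp add: gate_S_def)
  have gH: "gate_H = mat2 r r r (-r)"
    unfolding gate_H_def r_def
    by (rule eq_matI) (auto simp: mat_of_rows_list_def numeral_2_eq_2 less_Suc_eq)
  have S: "gate_S * M \<in> F" if MF: "M \<in> F" for M
  proof -
    consider (D) w k where "w \<in> W" "k \<in> I" "M = mat2 w 0 0 (w * k)"
      | (A) w k where "w \<in> W" "k \<in> I" "M = mat2 0 (w * k) w 0"
      | (H) w k l where "w \<in> W" "k \<in> I" "l \<in> I"
          "M = mat2 (r * w) (r * (w * l)) (r * (w * k)) (- (r * (w * k * l)))"
      using MF unfolding F_def \<D>_def \<A>_def \<H>_def by auto
    then show ?thesis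
    proof cases
      case D
      then show ?thesis unfolding gS D mat2_mult
        by (simp, intro DI[OF D(1) Ii(1)[OF D(2)]]) simp
    next
      case A
      show ?thesis unfolding gS A mat2_mult
        by (simp, intro AI[OF Wi[OF A(1)] Ii(2)[OF A(2)]]) (simp add: algebra_simps)
    next
      case H
      show ?thesis unfolding gS H mat2_mult
        by (simp, intro HI[OF H(1) Ii(1)[OF H(2)] H(3)]) (simp_all add: algebra_simps)
    qed
  qed
  have Hc: "gate_H * M \<in> F" if MF: "M \<in> F" for M
  proof -
    consider (D) w k where "w \<in> W" "k \<in> I" "M = mat2 w 0 0 (w * k)"
      | (A) w k where "w \<in> W" "k \<in> I" "M = mat2 0 (w * k) w 0"
      | (H) w k l where "w \<in> W" "k \<in> I" "l \<in> I"
          "M = mat2 (r * w) (r * (w * l)) (r * (w * k)) (- (r * (w * k * l)))"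
      using MF unfolding F_def \<D>_def \<A>_def \<H>_def by auto
    then show ?thesis
    proof cases
      case D
      then show ?thesis unfolding gH D mat2_mult
        by (simp, intro HI[OF D(1) I1(1) D(2)]) simp_all
    next
      case A
      show ?thesis unfolding gH A mat2_mult
        by (simp, intro HI[OF A(1) I1(2) A(2)]) simp_all
    next
      case H
      have *: "r * (r * x) = x / 2" for x using rr by (metis mult.assoc mult.left_neutral times_divide_eq_left)
      consider "k = 1" | "k = -1" | "k = \<i>" | "k = -\<i>" using H(2) by (auto simp: I_def)
      then show ?thesis
      proof cases
        case 1
        show ?thesis unfolding gH H 1 mat2_mult
          by (simp add: *, intro DI[OF H(1) H(3)]) simp
      next
        case 2
        show ?thesis unfolding gH H 2 mat2_mult
          by (simp add: *, intro AI[OF H(1) H(3)]) simp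
      next
        case 3
        show ?thesis unfolding gH H 3 mat2_mult
          by (rule HI[OF Wr(1)[OF H(1)] I1(4) Ii(2)[OF H(3)]]) (simp_all add: * algebra_simps)
      next
        case 4
        show ?thesis unfolding gH H 4 mat2_mult
          by (rule HI[OF Wr(2)[OF H(1)] I1(3) Ii(1)[OF H(3)]]) (simp_all add: * algebra_simps)
      qed
    qed
  qed
  let ?R = "ring_mat TYPE(complex) 2 ()"
  let ?G = "units_of ?R"
  interpret R: ring ?R by (rule ring_mat)
  interpret G: group ?G by (rule R.units_group)
  have carr: "M \<in> carrier_mat 2 2" if "M \<in> F" for M
    using that unfolding F_def \<D>_def \<A>_def \<H>_def by (auto simp: mat_of_rows_list_def)
  have Gc: "A \<in> carrier_mat 2 2" if "A \<in> carrier ?G" for A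
    using that by (auto simp: units_of_def Units_def ring_mat_simps)
  have Gm: "A \<otimes>\<^bsub>?G\<^esub> B = A * B" for A B by (simp add: units_of_def ring_mat_simps)
  have G1: "\<one>\<^bsub>?G\<^esub> = 1\<^sub>m 2" by (simp add: units_of_def ring_mat_simps)
  have HHi: "gate_H * gate_H = 1\<^sub>m 2" 
    unfolding gH mat2_mult by (rule eq_matI) (auto simp: rr mat_of_rows_list_def numeral_2_eq_2 less_Suc_eq)
  have SSi: "gate_S * mat2 1 0 0 (-\<i>) = 1\<^sub>m 2" "mat2 1 0 0 (-\<i>) * gate_S = 1\<^sub>m 2"
    unfolding gS mat2_mult by (rule eq_matI; auto simp: rr mat_of_rows_list_def numeral_2_eq_2 less_Suc_eq)+
  have c2: "mat2 a b c d \<in> carrier_mat 2 2" for a b c d by (auto simp: mat_of_rows_list_def)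
  have gens: "{gate_H, gate_S} \<subseteq> carrier ?G"
  proof -
    have "gate_H \<in> carrier_mat 2 2" "gate_S \<in> carrier_mat 2 2" using c2 gH gS by metis+
    then show ?thesis using HHi SSi c2 unfolding units_of_def Units_def ring_mat_simps by auto
  qed
  have stable: "A \<in> carrier ?G \<and> (\<forall>M\<in>F. A * M \<in> F)" if "A \<in> local_clifford" for A
    using that unfolding local_clifford_def
  proof (induction rule: generate.induct)
    case one
    show ?case using carr G.one_closed unfolding G1 by (metis left_mult_one_mat)
  next
    case (incl h)
    then show ?case using gens S Hc by blast
  next
    case (inv h)
    then have h: "h \<in> carrier ?G" "\<forall>M\<in>F. h * M \<in> F" using gens S Hc by blast+
    let ?i = "inv\<^bsub>?G\<^esub> h"
    have i: "?i \<in> carrier ?G" using h by simp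
    have ih: "?i * (h * M) = M" if "M \<in> carrier_mat 2 2" for M
    proof -
      have "?i * (h * M) = ?i * h * M"
        using assoc_mult_mat[OF Gc[OF i] Gc[OF h(1)] that] by simp
      also have "?i * h = 1\<^sub>m 2" using G.l_inv[OF h(1)] by (simp add: Gm G1)
      finally show ?thesis using that by simp
    qed
    have "inj_on ((*) h) F" by (rule inj_on_inverseI[of _ "(*) ?i"]) (use ih carr in auto)
    then have "(*) h ` F = F" using h(2) finF by (intro endo_inj_surj) auto
    then have "?i * M \<in> F" if "M \<in> F" for M
      using that ih carr by (metis imageE)
    with i show ?case by blast
  next
    case (eng a b)
    then have "a * b \<in> carrier ?G" using G.m_closed[of a b] by (simp add: Gm)
    moreover have "a * b * M \<in> F" if "M \<in> F" for M
      using eng that by (simp add: assoc_mult_mat[OF Gc Gc carr])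
    ultimately show ?case by (simp add: Gm)
  qed
  have "local_clifford \<subseteq> F"
  proof
    fix A assume A: "A \<in> local_clifford"
    have "1\<^sub>m 2 = mat2 1 0 0 1"
      by (rule eq_matI) (auto simp: mat_of_rows_list_def numeral_2_eq_2 less_Suc_eq)
    then have "1\<^sub>m 2 \<in> F" using DI[OF _ I1(1), of 1 1] by (simp add: W_def)
    then show "A \<in> F" using stable[OF A] Gc by (metis right_mult_one_mat)
  qed
  then have "finite local_clifford" using finF finite_subset by blast
  then obtain cl :: "nat \<Rightarrow> complex mat" and N where "local_clifford = cl ` {i. i < N}"
    using finite_imp_nat_seg_image_inj_on by metis
  then show ?thesis unfolding clifford_numbering_def lessThan_def by metis
qed

text \<open>Slot \<open>j\<close> consists of the arrays \<open>3 * j\<close>, \<open>3 * j + 1\<close>, \<open>3 * j + 2\<close>. The second one holds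
  the neighbour lists of the vertices \<open>1, \<dots>, n\<close>, one after the other and each in arbitrary
  order without repetitions; the list of \<open>v\<close> is found from position \<open>off v\<close> up to, but not
  including, position \<open>off (v + 1)\<close>. The third one holds the numbers of the local Clifford
  operations.\<close>

definition stores_state ::
  "nat \<Rightarrow> (nat \<Rightarrow> complex mat) \<Rightarrow> nat \<Rightarrow> memory \<Rightarrow> nat \<Rightarrow> nat set set \<Rightarrow> (nat \<Rightarrow> complex mat) \<Rightarrow> bool"
  where
  "stores_state N cl j s n E u \<longleftrightarrow>
     (let off = arr s (3 * j); adj = arr s (3 * j + 1); num = arr s (3 * j + 2) in
        off 1 = 0 \<and>
        (\<forall>v\<in>{1..n}. off v \<le> off (v + 1) \<and>
           bij_betw adj {off v..<off (v + 1)} (nbhd E v) \<and>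
           num v < N \<and> cl (num v) = u v))"

text \<open>The input: \<open>n\<close> in register 0, the qubits acted on in the following registers, the state in
  slot 0. The rest of the memory is arbitrary.\<close>

definition input_memory ::
  "nat \<Rightarrow> (nat \<Rightarrow> complex mat) \<Rightarrow> memory \<Rightarrow> nat \<Rightarrow> nat list \<Rightarrow> nat set set \<Rightarrow> (nat \<Rightarrow> complex mat) \<Rightarrow> bool"
  where
  "input_memory N cl s n qs E u \<longleftrightarrow>
     reg s 0 = n \<and> (\<forall>i<length qs. reg s (i + 1) = qs ! i) \<and> stores_state N cl 0 s n E u"

end

theory Submission
  imports Defs
begin

text \<open>Every gate of the set except the controlled Hadamard gate is of the form
  \<open>I + c (1 - P\<^sub>3) (1 - P\<^sub>2) (1 - P\<^sub>1)\<close> with Pauli operators \<open>P\<^sub>i\<close> on at most two qubits (for the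
  controlled swap: \<open>Z\<^sub>a\<close>, \<open>Z\<^sub>b Z\<^sub>c\<close> and \<open>X\<^sub>b X\<^sub>c\<close>), where missing factors are replaced by \<open>1 + 1\<close>;
  and \<open>CH = (1 + Z\<^sub>a) / 2 + H\<^sub>b (1 - Z\<^sub>a) / 2\<close>. So it suffices to apply factors \<open>1 \<plusminus> P\<close> to
  \<open>U |G\<rangle>\<close>. Moving \<open>P\<close> through \<open>U\<close>, and using that \<open>X\<^sub>q |G\<rangle>\<close> is the product of \<open>Z\<close> on the neighbours of
  \<open>q\<close> applied to \<open>|G\<rangle>\<close>, one is left with \<open>(1 + \<i>\<^sup>k Z\<^sub>B) |G\<rangle>\<close> for a set \<open>B\<close> of vertices.

  Let \<open>w \<in> B\<close> have minimal degree and let \<open>M\<close> be its closed neighbourhood. A Hadamard gate split off at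
  \<open>w\<close> leaves a graph state, up to local Clifford operations, in which the pairs between \<open>B\<close> and \<open>M\<close>
  are toggled, and for odd \<open>k\<close> also those inside \<open>M\<close>. If \<open>k\<close> is odd and \<open>|B| \<le> |M|\<close>, then it is
  cheaper to toggle the pairs inside \<open>B\<close>. As \<open>w\<close> has minimal degree, \<open>|B| |M|\<close> is at most the sum of
  \<open>deg x + 1\<close> over \<open>x \<in> B\<close>, so that only \<open>O(n + n d)\<close> pairs are toggled. The new neighbour lists are
  produced vertex by vertex, each as a symmetric difference of the old list and of \<open>M\<close> and \<open>B\<close>, with
  the help of an array of parities.\<close>

text \<open>Up to a common factor, \<open>\<i>^k Z_B |G>\<close> has the amplitude
  \<open>\<i>^k (-1)^(|B \<inter> X| + e(X))\<close> at the set \<open>X\<close> of qubits with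
  value 1, where \<open>e(X)\<close> counts the edges inside \<open>X\<close>. Its sum with
  \<open>|G>\<close> has to be of such a form again, up to local Clifford operations. Two facts make
  this possible. A Hadamard gate at \<open>w\<close> combines the amplitudes at two sets that differ
  only in \<open>w\<close>. As \<open>w\<close> lies in \<open>M\<close>, exactly one of them meets
  \<open>M\<close> in an odd number of elements, so that a phase depending on this parity places one
  summand on each of the two sets; the stabilizer of \<open>w\<close> relates the two amplitudes.
  Moreover, \<open>\<i>^s (-1)^(s (s - 1) / 2)\<close> depends only on the parity of
  \<open>s\<close>. So a phase factor \<open>\<i>\<close> that depends on a parity is made of phase
  gates and a complete graph, which is the origin of the toggled pairs inside \<open>M\<close> or
  \<open>B\<close> for odd \<open>k\<close>.

  Since the factors are applied in succession, the bound has to survive iteration: one factor turns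
  a degree sum of at most \<open>d\<close> into one of at most \<open>4 d + 3 n\<close>.\<close>

definition bits :: "nat \<Rightarrow> nat \<Rightarrow> nat set" where
  "bits n k = {q \<in> {1..n}. qubit_val n k q = 1}"

lemma bits_le: "bits n k \<subseteq> {1..n}"
  by (auto simp: bits_def)

lemma qubit_val_bits: "q \<in> {1..n} \<Longrightarrow> qubit_val n k q = of_bool (q \<in> bits n k)"
  by (auto simp: bits_def qubit_val_def)

text \<open>Qubit \<open>n - m\<close> is the binary digit of weight \<open>2 ^ m\<close>, and a
  number below \<open>2 ^ n\<close> is determined by its lowest \<open>n\<close> digits.
  Surjectivity then follows by counting.\<close>

lemma bij_bits: "bij_betw (bits n) {..<2 ^ n} (Pow {1..n})"
proof -
  have inj: "inj_on (bits n) {..<2 ^ n}"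
  proof (rule inj_onI)
    fix k l assume kl: "k \<in> {..<2 ^ n}" "l \<in> {..<2 ^ n}" and eq: "bits n k = bits n l"
    have "bit k m = bit l m" for m
    proof (cases "m < n")
      case True
      then have "qubit_val n k (n - m) = qubit_val n l (n - m)"
        using eq by (subst (1 2) qubit_val_bits) auto
      then show ?thesis
        using True by (auto simp: qubit_val_def bit_iff_odd odd_iff_mod_2_eq_one)
    next
      case False
      then have "(2 :: nat) ^ n \<le> 2 ^ m" by (intro power_increasing) auto
      then have "k < 2 ^ m" "l < 2 ^ m" using kl by (auto intro: less_le_trans)
      then show ?thesis by (simp add: bit_iff_odd)
    qed
    then show "k = l" by (rule bit_eqI)
  qed
  moreover have "bits n ` {..<2 ^ n} = Pow {1..n}"
  proof (rule card_subset_eq)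
    show "bits n ` {..<2 ^ n} \<subseteq> Pow {1..n}" using bits_le by auto
    show "card (bits n ` {..<2 ^ n}) = card (Pow {1..n})"
      using inj by (simp add: card_image card_Pow)
  qed simp
  ultimately show ?thesis by (simp add: bij_betw_def)
qed

text \<open>Amplitudes are indexed by the set of qubits with value 1. Pauli operators,
  \<open>CZ\<close> gates and graph states become sign functions and symmetric differences of sets,
  and the arithmetic of indices is left behind.\<close>

definition state :: "nat \<Rightarrow> (nat set \<Rightarrow> complex) \<Rightarrow> complex vec" where
  "state n \<psi> = vec (2 ^ n) (\<lambda>k. \<psi> (bits n k))"

lemma state_cong:
  assumes "\<And>X. X \<subseteq> {1..n} \<Longrightarrow> \<psi> X = \<phi> X"
  shows "state n \<psi> = state n \<phi>"
  unfolding state_def using assms[OF bits_le] by simp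

lemma state_add: "state n \<psi> + state n \<phi> = state n (\<lambda>X. \<psi> X + \<phi> X)"
  by (auto simp: state_def)

lemma state_smult: "c \<cdot>\<^sub>v state n \<psi> = state n (\<lambda>X. c * \<psi> X)"
  by (auto simp: state_def)

lemma mult_mat_state:
  "mat (2 ^ n) (2 ^ n) (\<lambda>(i, j). f (bits n i) (bits n j)) *\<^sub>v state n \<psi>
     = state n (\<lambda>X. \<Sum>Y\<in>Pow {1..n}. f X Y * \<psi> Y)"
proof -
  have "(\<Sum>j = 0..<2 ^ n. f X (bits n j) * \<psi> (bits n j)) = (\<Sum>Y\<in>Pow {1..n}. f X Y * \<psi> Y)" for X
    using sum.reindex_bij_betw[OF bij_bits, of "\<lambda>Y. f X Y * \<psi> Y"]
    by (simp add: atLeast0LessThan)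
  then show ?thesis
    by (auto simp: state_def scalar_prod_def)
qed

section \<open>Entries of \<open>2 \<times> 2\<close> matrices and local operators acting on
  amplitudes\<close>

definition entry :: "complex mat \<Rightarrow> bool \<Rightarrow> bool \<Rightarrow> complex" where
  "entry A x y = A $$ (of_bool x, of_bool y)"

lemma entry_mat2: "entry (mat2 a b c d) x y = (if x then if y then d else c else if y then b else a)"
  by (simp add: entry_def mat_of_rows_list_def)

lemma entry_one: "entry (1\<^sub>m 2) x y = of_bool (x = y)"
  by (simp add: entry_def)

lemma mat2_carrier [simp]: "mat2 a b c d \<in> carrier_mat 2 2"
  by (auto simp: mat_of_rows_list_def)

lemma mat_eq_entry:
  assumes "A \<in> carrier_mat 2 2" "B \<in> carrier_mat 2 2" "\<And>x y. entry A x y = entry B x y"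
  shows "A = B"
proof (rule eq_matI)
  fix i j assume "i < dim_row B" "j < dim_col B"
  then have "i < 2" "j < 2" using assms by auto
  then have "i = of_bool (i = 1)" "j = of_bool (j = 1)" by auto
  then show "A $$ (i, j) = B $$ (i, j)" using assms(3)[of "i = 1" "j = 1"] by (simp add: entry_def)
qed (use assms in auto)

lemma mat2_collapse: "A \<in> carrier_mat 2 2 \<Longrightarrow>
  A = mat2 (A $$ (0, 0)) (A $$ (0, 1)) (A $$ (1, 0)) (A $$ (1, 1))"
  by (rule mat_eq_entry, assumption, simp, unfold entry_mat2) (auto simp: entry_def)

lemma entry_mult:
  assumes "A \<in> carrier_mat 2 2" "B \<in> carrier_mat 2 2"
  shows "entry (A * B) x y = entry A x True * entry B True y + entry A x False * entry B False y"
proof -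
  obtain a b c d where A: "A = mat2 a b c d" using mat2_collapse[OF assms(1)] by blast
  obtain a' b' c' d' where B: "B = mat2 a' b' c' d'" using mat2_collapse[OF assms(2)] by blast
  show ?thesis by (simp add: A B mat2_mult entry_mat2)
qed

definition tensor_amp :: "nat \<Rightarrow> (nat \<Rightarrow> complex mat) \<Rightarrow> (nat set \<Rightarrow> complex) \<Rightarrow> nat set \<Rightarrow> complex" where
  "tensor_amp n u \<psi> X = (\<Sum>Y\<in>Pow {1..n}. (\<Prod>q = 1..n. entry (u q) (q \<in> X) (q \<in> Y)) * \<psi> Y)"

lemma tensor_op_state: "tensor_op n u *\<^sub>v state n \<psi> = state n (tensor_amp n u \<psi>)"
proof -
  have "tensor_op n u = mat (2 ^ n) (2 ^ n)
    (\<lambda>(i, j). \<Prod>q = 1..n. entry (u q) (q \<in> bits n i) (q \<in> bits n j))"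
    unfolding tensor_op_def entry_def
    by (intro cong_mat refl) (auto intro!: prod.cong simp: qubit_val_bits)
  then show ?thesis
    unfolding tensor_amp_def
    using mult_mat_state[of n "\<lambda>X Y. \<Prod>q = 1..n. entry (u q) (q \<in> X) (q \<in> Y)"] by simp
qed

text \<open>The mixed-product rule for tensor products. Expanding the product over the qubits of the
  two-term sums in \<open>entry_mult\<close> gives one summand for each set \<open>Y\<close> of
  qubits whose intermediate value is 1.\<close>

lemma tensor_amp_mult:
  assumes "\<And>q. q \<in> {1..n} \<Longrightarrow> u q \<in> carrier_mat 2 2" "\<And>q. q \<in> {1..n} \<Longrightarrow> v q \<in> carrier_mat 2 2"
  shows "tensor_amp n u (tensor_amp n v \<psi>) X = tensor_amp n (\<lambda>q. u q * v q) \<psi> X"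
proof -
  have "(\<Sum>Y\<in>Pow {1..n}. (\<Prod>q = 1..n. entry (u q) (q \<in> X) (q \<in> Y)) *
          (\<Prod>q = 1..n. entry (v q) (q \<in> Y) (q \<in> Z)))
      = (\<Prod>q = 1..n. entry (u q * v q) (q \<in> X) (q \<in> Z))" for Z
  proof -
    let ?f = "\<lambda>y q. entry (u q) (q \<in> X) y * entry (v q) y (q \<in> Z)"
    have "(\<Prod>q = 1..n. entry (u q * v q) (q \<in> X) (q \<in> Z)) = (\<Prod>q = 1..n. ?f True q + ?f False q)"
      by (intro prod.cong refl) (simp add: entry_mult assms)
    also have "\<dots> = (\<Sum>Y\<in>Pow {1..n}. prod (?f True) Y * prod (?f False) ({1..n} - Y))"
      by (rule prod_add) simp
    also have "\<dots> = (\<Sum>Y\<in>Pow {1..n}. \<Prod>q = 1..n. ?f (q \<in> Y) q)"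
    proof (intro sum.cong refl)
      fix Y assume Y: "Y \<in> Pow {1..n}"
      have "(\<Prod>q = 1..n. ?f (q \<in> Y) q) = (\<Prod>q\<in>Y. ?f (q \<in> Y) q) * (\<Prod>q\<in>{1..n} - Y. ?f (q \<in> Y) q)"
        using Y prod.subset_diff[of Y "{1..n}" "\<lambda>q. ?f (q \<in> Y) q"] by (simp add: mult.commute)
      then show "prod (?f True) Y * prod (?f False) ({1..n} - Y) = (\<Prod>q = 1..n. ?f (q \<in> Y) q)"
        by simp
    qed
    finally show ?thesis by (simp add: prod.distrib)
  qed
  note * = this
  have "tensor_amp n u (tensor_amp n v \<psi>) X = (\<Sum>Y\<in>Pow {1..n}. \<Sum>Z\<in>Pow {1..n}.
      (\<Prod>q = 1..n. entry (u q) (q \<in> X) (q \<in> Y)) * (\<Prod>q = 1..n. entry (v q) (q \<in> Y) (q \<in> Z)) * \<psi> Z)"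
    by (simp add: tensor_amp_def sum_distrib_left mult.assoc)
  also have "\<dots> = (\<Sum>Z\<in>Pow {1..n}. \<Sum>Y\<in>Pow {1..n}.
      (\<Prod>q = 1..n. entry (u q) (q \<in> X) (q \<in> Y)) * (\<Prod>q = 1..n. entry (v q) (q \<in> Y) (q \<in> Z)) * \<psi> Z)"
    by (rule sum.swap)
  also have "\<dots> = tensor_amp n (\<lambda>q. u q * v q) \<psi> X"
    by (simp add: tensor_amp_def * del: One_nat_def flip: sum_distrib_right)
  finally show ?thesis .
qed

lemma tensor_amp_cong:
  assumes "\<And>q. q \<in> {1..n} \<Longrightarrow> u q = v q" "\<And>Y. Y \<subseteq> {1..n} \<Longrightarrow> \<psi> Y = \<phi> Y"
  shows "tensor_amp n u \<psi> X = tensor_amp n v \<phi> X"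
  unfolding tensor_amp_def using assms by (intro sum.cong refl) (auto intro!: prod.cong arg_cong2[where f = "(*)"])

lemma tensor_amp_smult: "tensor_amp n u (\<lambda>X. c * \<psi> X) X = c * tensor_amp n u \<psi> X"
  by (simp add: tensor_amp_def sum_distrib_left algebra_simps)

lemma tensor_amp_add: "tensor_amp n u (\<lambda>X. \<psi> X + \<phi> X) X = tensor_amp n u \<psi> X + tensor_amp n u \<phi> X"
  by (simp add: tensor_amp_def sum.distrib algebra_simps)

definition on_qubit :: "complex mat \<Rightarrow> nat \<Rightarrow> nat \<Rightarrow> complex mat" where
  "on_qubit A q = (\<lambda>p. if p = q then A else 1\<^sub>m 2)"

lemma tensor_amp_diag:
  assumes "X \<subseteq> {1..n}" and "\<And>q x y. q \<in> {1..n} \<Longrightarrow> x \<noteq> y \<Longrightarrow> entry (d q) x y = 0"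
  shows "tensor_amp n d \<psi> X = (\<Prod>q = 1..n. entry (d q) (q \<in> X) (q \<in> X)) * \<psi> X"
proof -
  have "(\<Prod>q = 1..n. entry (d q) (q \<in> X) (q \<in> Y)) = 0" if "Y \<in> Pow {1..n} - {X}" for Y
  proof -
    have "X \<noteq> Y" "Y \<subseteq> {1..n}" using that by auto
    then obtain q where q: "(q \<in> X) \<noteq> (q \<in> Y)" by blast
    moreover have "q \<in> {1..n}" using q assms(1) \<open>Y \<subseteq> {1..n}\<close> by blast
    ultimately show ?thesis using assms(2) by (intro prod_zero bexI[of _ q]) simp_all
  qed
  then have "tensor_amp n d \<psi> X = (\<Sum>Y\<in>{X}. (\<Prod>q = 1..n. entry (d q) (q \<in> X) (q \<in> Y)) * \<psi> Y)"
    unfolding tensor_amp_def using assms(1) by (intro sum.mono_neutral_right) auto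
  then show ?thesis by simp
qed

text \<open>An identity factor at \<open>p\<close> forces \<open>X\<close> and \<open>Y\<close> to
  agree at \<open>p\<close>. Only the two sets that agree with \<open>X\<close> outside
  \<open>q\<close> contribute.\<close>

lemma tensor_amp_on_qubit:
  assumes "X \<subseteq> {1..n}" "q \<in> {1..n}"
  shows "tensor_amp n (on_qubit A q) \<psi> X =
    entry A (q \<in> X) False * \<psi> (X - {q}) + entry A (q \<in> X) True * \<psi> (insert q X)"
proof -
  let ?p = "\<lambda>Y. \<Prod>p = 1..n. entry (on_qubit A q p) (p \<in> X) (p \<in> Y)"
  have zero: "?p Y = 0" if "Y \<in> Pow {1..n} - {X - {q}, insert q X}" for Y
  proof -
    have Y: "Y \<subseteq> {1..n}" "Y \<noteq> X - {q}" "Y \<noteq> insert q X" using that by auto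
    have "Y - {q} \<noteq> X - {q}"
    proof
      assume "Y - {q} = X - {q}"
      then have "Y = X - {q} \<or> Y = insert q X" by (cases "q \<in> Y") auto
      then show False using Y by simp
    qed
    then obtain p where p: "p \<noteq> q" "(p \<in> X) \<noteq> (p \<in> Y)" by blast
    moreover have "p \<in> {1..n}" using p assms(1) Y(1) by blast
    ultimately show ?thesis by (intro prod_zero bexI[of _ p]) (simp_all add: on_qubit_def entry_one)
  qed
  have val: "?p Y = entry A (q \<in> X) (q \<in> Y)" if "Y \<in> {X - {q}, insert q X}" for Y
  proof -
    have "?p Y = (\<Prod>p\<in>{q}. entry (on_qubit A q p) (p \<in> X) (p \<in> Y))"
      using assms that by (intro prod.mono_neutral_right) (auto simp: on_qubit_def entry_one)
    then show ?thesis by (simp add: on_qubit_def)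
  qed
  have "X - {q} \<noteq> insert q X" by auto
  have "tensor_amp n (on_qubit A q) \<psi> X = (\<Sum>Y\<in>{X - {q}, insert q X}. ?p Y * \<psi> Y)"
    unfolding tensor_amp_def using assms zero by (intro sum.mono_neutral_right) auto
  also have "\<dots> = (\<Sum>Y\<in>{X - {q}, insert q X}. entry A (q \<in> X) (q \<in> Y) * \<psi> Y)"
    using val by (intro sum.cong) auto
  finally show ?thesis
    using \<open>X - {q} \<noteq> insert q X\<close> by simp
qed

section \<open>Pauli operators and local Clifford operations\<close>

text \<open>\<open>\<i>\<^sup>t Z\<^sup>b X\<^sup>a\<close>\<close>
definition pauli :: "nat \<Rightarrow> bool \<Rightarrow> bool \<Rightarrow> complex mat" where
  "pauli t b a = (if a then mat2 0 (\<i> ^ t) ((if b then -1 else 1) * \<i> ^ t) 0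
     else mat2 (\<i> ^ t) 0 0 ((if b then -1 else 1) * \<i> ^ t))"

lemma pauli_carrier [simp]: "pauli t b a \<in> carrier_mat 2 2"
  by (simp add: pauli_def)

lemma entry_pauli: "entry (pauli t b a) x y =
   (if (x \<noteq> y) = a then \<i> ^ t * (if b \<and> x then -1 else 1) else 0)"
  by (auto simp: pauli_def entry_mat2)

lemma gate_H_mat2: "gate_H = mat2 (of_real (1 / sqrt 2)) (of_real (1 / sqrt 2)) (of_real (1 / sqrt 2)) (- of_real (1 / sqrt 2))"
  unfolding gate_H_def by (rule mat_eq_entry) (auto simp: entry_mat2 entry_def mat_of_rows_list_def)

lemma gate_S_mat2: "gate_S = mat2 1 0 0 \<i>"
  by (simp add: gate_S_def)

lemma gate_H_square: "gate_H * gate_H = 1\<^sub>m 2"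
proof -
  have "complex_of_real (1 / sqrt 2) * complex_of_real (1 / sqrt 2) = 1 / 2"
    by (simp flip: of_real_mult)
  then show ?thesis
    unfolding gate_H_mat2 mat2_mult by (intro mat_eq_entry) (auto simp: entry_mat2 entry_one)
qed

lemma gate_S_inverse:
  "gate_S * mat2 1 0 0 (- \<i>) = 1\<^sub>m 2" "mat2 1 0 0 (- \<i>) * gate_S = 1\<^sub>m 2"
  unfolding gate_S_mat2 mat2_mult by (auto intro!: mat_eq_entry simp: entry_mat2 entry_one)

section \<open>The group generated by \<open>H\<close> and \<open>S\<close>, and how Pauli operators
  pass through it\<close>

abbreviation mat2_units :: "complex mat monoid" where
  "mat2_units \<equiv> units_of (ring_mat TYPE(complex) 2 ())"

lemma mat2_units_group: "group mat2_units"
  by (rule monoid.units_group) (rule ring.is_monoid[OF ring_mat])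

lemma mat2_units_carrier: "A \<in> carrier mat2_units \<Longrightarrow> A \<in> carrier_mat 2 2"
  by (auto simp: units_of_def Units_def ring_mat_simps)

lemma mat2_units_mult: "A \<otimes>\<^bsub>mat2_units\<^esub> B = A * B"
  by (simp add: units_of_def ring_mat_simps)

lemma mat2_units_one: "\<one>\<^bsub>mat2_units\<^esub> = 1\<^sub>m 2"
  by (simp add: units_of_def ring_mat_simps)

lemma mat2_unitsI:
  assumes "A \<in> carrier_mat 2 2" "B \<in> carrier_mat 2 2" "A * B = 1\<^sub>m 2" "B * A = 1\<^sub>m 2"
  shows "A \<in> carrier mat2_units" "inv\<^bsub>mat2_units\<^esub> A = B"
proof -
  interpret group mat2_units by (rule mat2_units_group)
  show A: "A \<in> carrier mat2_units"
    using assms by (auto simp: units_of_def Units_def ring_mat_simps)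
  have "B \<in> carrier mat2_units"
    using assms by (auto simp: units_of_def Units_def ring_mat_simps)
  then show "inv\<^bsub>mat2_units\<^esub> A = B"
    using A assms by (intro inv_equality) (auto simp: mat2_units_mult mat2_units_one)
qed

lemma clifford_gens_carrier: "{gate_H, gate_S} \<subseteq> carrier mat2_units"
  using mat2_unitsI(1)[OF _ _ gate_H_square gate_H_square]
    mat2_unitsI(1)[OF _ _ gate_S_inverse(1) gate_S_inverse(2)]
  by (simp add: gate_H_mat2 gate_S_mat2)

lemma local_clifford_carrier: "u \<in> local_clifford \<Longrightarrow> u \<in> carrier_mat 2 2"
  using group.generate_in_carrier[OF mat2_units_group clifford_gens_carrier] mat2_units_carrier
  unfolding local_clifford_def by blast

lemma one_local_clifford: "1\<^sub>m 2 \<in> local_clifford"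
  unfolding local_clifford_def using generate.one[of mat2_units] by (simp add: mat2_units_one)

lemma H_local_clifford: "gate_H \<in> local_clifford"
  and S_local_clifford: "gate_S \<in> local_clifford"
  unfolding local_clifford_def by (auto intro: generate.incl)

lemma mult_local_clifford: "u \<in> local_clifford \<Longrightarrow> v \<in> local_clifford \<Longrightarrow> u * v \<in> local_clifford"
  unfolding local_clifford_def using generate.eng[of u mat2_units _ v] by (simp add: mat2_units_mult)

lemma pow_local_clifford:
  assumes "u \<in> local_clifford"
  shows "u ^\<^sub>m k \<in> local_clifford"
proof -
  have "dim_row u = 2" using local_clifford_carrier[OF assms] by simp
  then show ?thesis
    using assms by (induction k) (auto simp: one_local_clifford mult_local_clifford)
qed

text \<open>Says that \<open>u\<close> normalises the Pauli group, in the direction needed to push a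
  Pauli operator through \<open>u\<close> to the right. The bound on \<open>t'\<close> makes the
  possible results a finite set, so that a program can contain one branch for each.\<close>

definition passes_paulis :: "complex mat \<Rightarrow> bool" where
  "passes_paulis u \<longleftrightarrow> (\<forall>t b a. \<exists>t' b' a'. t' < 4 \<and> pauli t b a * u = u * pauli t' b' a')"

lemma i_power_mod_4: "\<i> ^ (t mod 4) = \<i> ^ t"
proof -
  have "\<i> ^ t = \<i> ^ (4 * (t div 4) + t mod 4)" by simp
  also have "\<dots> = (\<i> ^ 4) ^ (t div 4) * \<i> ^ (t mod 4)" by (simp only: power_add power_mult)
  also have "\<i> ^ 4 = 1" by (simp add: eval_nat_numeral)
  finally show ?thesis by simp
qed

lemma pauli_mod_4: "pauli (t mod 4) b a = pauli t b a"
  by (simp add: pauli_def i_power_mod_4)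

lemma passes_paulisI:
  assumes "\<And>t b a. \<exists>t' b' a'. pauli t b a * u = u * pauli t' b' a'"
  shows "passes_paulis u"
  unfolding passes_paulis_def
proof (intro allI)
  fix t b a
  from assms obtain t' b' a' where "pauli t b a * u = u * pauli t' b' a'" by blast
  then show "\<exists>t' b' a'. t' < 4 \<and> pauli t b a * u = u * pauli t' b' a'"
    by (intro exI[of _ "t' mod 4"]) (auto simp: pauli_mod_4)
qed

lemma passes_paulis_mult:
  assumes "passes_paulis u" "passes_paulis v" "u \<in> carrier_mat 2 2" "v \<in> carrier_mat 2 2"
  shows "passes_paulis (u * v)"
proof (rule passes_paulisI)
  fix t b a
  from assms(1) obtain t' b' a' where 1: "pauli t b a * u = u * pauli t' b' a'"
    unfolding passes_paulis_def by blast
  from assms(2) obtain t'' b'' a'' where 2: "pauli t' b' a' * v = v * pauli t'' b'' a''"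
    unfolding passes_paulis_def by blast
  have "pauli t b a * (u * v) = pauli t b a * u * v"
    by (rule assoc_mult_mat[symmetric, OF pauli_carrier assms(3,4)])
  also have "\<dots> = u * (pauli t' b' a' * v)"
    unfolding 1 by (rule assoc_mult_mat[OF assms(3) pauli_carrier assms(4)])
  also have "\<dots> = u * v * pauli t'' b'' a''"
    unfolding 2 by (rule assoc_mult_mat[symmetric, OF assms(3,4) pauli_carrier])
  finally show "\<exists>t' b' a'. pauli t b a * (u * v) = u * v * pauli t' b' a'" by blast
qed

text \<open>\<open>H\<close> exchanges \<open>X\<close> and \<open>Z\<close>. Restoring the order
  \<open>Z\<close> before \<open>X\<close> costs a sign if both are present, hence the exponent
  2.\<close>

lemma passes_paulis_H: "passes_paulis gate_H"
proof (rule passes_paulisI)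
  fix t b a
  have "pauli t b a * gate_H = gate_H * pauli (t + (if a \<and> b then 2 else 0)) a b"
    by (cases a; cases b) (simp_all add: pauli_def gate_H_mat2 mat2_mult)
  then show "\<exists>t' b' a'. pauli t b a * gate_H = gate_H * pauli t' b' a'" by blast
qed

text \<open>\<open>X S = S (\<i> Z X)\<close>, while \<open>Z\<close> commutes with
  \<open>S\<close>.\<close>

lemma passes_paulis_S: "passes_paulis gate_S"
proof (rule passes_paulisI)
  fix t b a
  have "pauli t b a * gate_S = gate_S * pauli (t + (if a then 1 else 0)) (b \<noteq> a) a"
    by (cases a; cases b) (simp_all add: pauli_def gate_S_mat2 mat2_mult mult.commute)
  then show "\<exists>t' b' a'. pauli t b a * gate_S = gate_S * pauli t' b' a'" by blast
qed

lemma passes_paulis_S_inv: "passes_paulis (mat2 1 0 0 (- \<i>))"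
proof (rule passes_paulisI)
  fix t b a
  have "pauli t b a * mat2 1 0 0 (- \<i>) = mat2 1 0 0 (- \<i>) * pauli (t + (if a then 3 else 0)) (b \<noteq> a) a"
    by (cases a; cases b) (simp_all add: pauli_def mat2_mult power_add power3_eq_cube mult.commute)
  then show "\<exists>t' b' a'. pauli t b a * mat2 1 0 0 (- \<i>) = mat2 1 0 0 (- \<i>) * pauli t' b' a'" by blast
qed

lemma local_clifford_passes_paulis:
  assumes "u \<in> local_clifford"
  shows "passes_paulis u"
  using assms unfolding local_clifford_def
proof (induction rule: generate.induct)
  case one
  show ?case unfolding mat2_units_one by (rule passes_paulisI) (metis left_mult_one_mat right_mult_one_mat pauli_carrier)
next
  case (incl h)
  then show ?case using passes_paulis_H passes_paulis_S by blast
next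
  \<comment> \<open>Inverses of generators are themselves base cases of the generated group.
    \<open>H\<close> is an involution, and for the inverse of \<open>S\<close> the phase is 3 in
    place of 1.\<close>
  case (inv h)
  moreover have "inv\<^bsub>mat2_units\<^esub> gate_H = gate_H"
    by (rule mat2_unitsI) (simp_all add: gate_H_square, simp_all add: gate_H_mat2)
  moreover have "inv\<^bsub>mat2_units\<^esub> gate_S = mat2 1 0 0 (- \<i>)"
    by (rule mat2_unitsI) (simp_all add: gate_S_inverse, simp_all add: gate_S_mat2)
  ultimately show ?case using passes_paulis_H passes_paulis_S_inv by auto
next
  case (eng a b)
  then show ?case using local_clifford_carrier
    by (simp add: mat2_units_mult passes_paulis_mult local_clifford_def)
qed

section \<open>Graph states\<close>

abbreviation sdiff :: "'a set \<Rightarrow> 'a set \<Rightarrow> 'a set" (infixl "\<triangle>" 65) where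
  "A \<triangle> B \<equiv> (A - B) \<union> (B - A)"

text \<open>The eigenvalue of the product of \<open>Z\<close> over \<open>B\<close> at the basis
  vector \<open>X\<close>.\<close>

definition parity_sign :: "nat set \<Rightarrow> nat set \<Rightarrow> complex" where
  "parity_sign B X = (-1) ^ card (B \<inter> X)"

text \<open>The eigenvalue of the product of the \<open>CZ\<close> gates of \<open>E\<close> at the
  basis vector \<open>X\<close>, so the amplitude of the graph state without its
  normalisation.\<close>

definition graph_sign :: "nat set set \<Rightarrow> nat set \<Rightarrow> complex" where
  "graph_sign E X = (-1) ^ card {e \<in> E. e \<subseteq> X}"

lemma minus_one_card_sdiff:
  assumes "finite A" "finite B"
  shows "(-1 :: complex) ^ card (A \<triangle> B) = (-1) ^ card A * (-1) ^ card B"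
proof -
  have A: "card A = card (A - B) + card (A \<inter> B)"
    using card_Int_Diff[OF assms(1), of B] by simp
  have B: "card B = card (B - A) + card (A \<inter> B)"
    using card_Int_Diff[OF assms(2), of A] by (simp add: Int_commute)
  have "card (A \<triangle> B) = card (A - B) + card (B - A)"
    using assms by (intro card_Un_disjoint) auto
  then show ?thesis by (simp add: A B power_add)
qed

lemma insert_sdiff: "x \<notin> A \<Longrightarrow> insert x A = {x} \<triangle> A"
  by auto

lemma finite_sdiff: "finite A \<Longrightarrow> finite B \<Longrightarrow> finite (A \<triangle> B)"
  by simp

lemma parity_sign_sdiff_left:
  assumes "finite X"
  shows "parity_sign (A \<triangle> B) X = parity_sign A X * parity_sign B X"
proof -
  have "(A \<triangle> B) \<inter> X = (A \<inter> X) \<triangle> (B \<inter> X)" by blast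
  from this show ?thesis unfolding parity_sign_def
    by (elim ssubst, intro minus_one_card_sdiff) (use assms in auto)
qed

lemma parity_sign_sdiff_right:
  assumes "finite X" "finite Y"
  shows "parity_sign B (X \<triangle> Y) = parity_sign B X * parity_sign B Y"
proof -
  have "B \<inter> (X \<triangle> Y) = (B \<inter> X) \<triangle> (B \<inter> Y)" by blast
  from this show ?thesis unfolding parity_sign_def
    by (elim ssubst, intro minus_one_card_sdiff) (use assms in auto)
qed

lemma parity_sign_empty [simp]: "parity_sign {} X = 1" "parity_sign B {} = 1"
  by (simp_all add: parity_sign_def)

lemma parity_sign_singleton:
  "parity_sign {q} X = (if q \<in> X then -1 else 1)" "parity_sign B {q} = (if q \<in> B then -1 else 1)"
  by (simp_all add: parity_sign_def Int_insert_left Int_insert_right)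

lemma simple_graph_finite: "simple_graph n E \<Longrightarrow> finite E"
  unfolding simple_graph_def
  by (rule finite_subset[of _ "Pow {1..n}"]) auto

lemma nbhd_le: "simple_graph n E \<Longrightarrow> nbhd E v \<subseteq> {1..n}"
  unfolding simple_graph_def nbhd_def by (fastforce simp: doubleton_eq_iff)

lemma nbhd_irrefl: "simple_graph n E \<Longrightarrow> v \<notin> nbhd E v"
  unfolding simple_graph_def nbhd_def by (fastforce simp: doubleton_eq_iff)

lemma nbhd_sdiff: "nbhd (E \<triangle> F) v = nbhd E v \<triangle> nbhd F v"
  by (auto simp: nbhd_def)

lemma graph_sign_sdiff:
  assumes "finite E" "finite F"
  shows "graph_sign (E \<triangle> F) X = graph_sign E X * graph_sign F X"
proof -
  have "{e \<in> E \<triangle> F. e \<subseteq> X} = {e \<in> E. e \<subseteq> X} \<triangle> {e \<in> F. e \<subseteq> X}" by blast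
  from this show ?thesis unfolding graph_sign_def
    by (elim ssubst, intro minus_one_card_sdiff) (use assms in auto)
qed

text \<open>The additional edges inside \<open>insert q X\<close> are those from \<open>q\<close> to
  its neighbours in \<open>X\<close>.\<close>

lemma graph_sign_insert:
  assumes E: "simple_graph n E" and "q \<notin> X"
  shows "graph_sign E (insert q X) = graph_sign E X * parity_sign (nbhd E q) X"
proof -
  have e: "\<exists>a b. e = {a, b} \<and> a \<noteq> b" if "e \<in> E" for e using E that unfolding simple_graph_def by blast
  have "{e \<in> E. e \<subseteq> insert q X} = {e \<in> E. e \<subseteq> X} \<union> (\<lambda>w. {q, w}) ` (nbhd E q \<inter> X)"
  proof -
    have "e \<in> (\<lambda>w. {q, w}) ` (nbhd E q \<inter> X)" if "e \<in> E" "e \<subseteq> insert q X" "\<not> e \<subseteq> X" for e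
    proof -
      from e[OF that(1)] obtain a b where ab: "e = {a, b}" "a \<noteq> b" by blast
      then have "a = q \<or> b = q" using that by blast
      then obtain w where "e = {q, w}" "w \<noteq> q" using ab by (metis insert_commute)
      then show ?thesis using that by (auto simp: nbhd_def)
    qed
    then show ?thesis by (auto simp: nbhd_def)
  qed
  moreover have "card \<dots> = card {e \<in> E. e \<subseteq> X} + card ((\<lambda>w. {q, w}) ` (nbhd E q \<inter> X))"
    using assms(2) simple_graph_finite[OF E] nbhd_le[OF E]
    by (intro card_Un_disjoint) (auto intro: finite_subset)
  moreover have "card ((\<lambda>w. {q, w}) ` (nbhd E q \<inter> X)) = card (nbhd E q \<inter> X)"
    by (intro card_image inj_onI) (auto simp: doubleton_eq_iff)
  ultimately show ?thesis
    by (simp add: graph_sign_def parity_sign_def power_add)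
qed

text \<open>The stabilizer relation in terms of amplitudes: flipping \<open>q\<close> acts on the
  graph state as \<open>Z\<close> on all neighbours of \<open>q\<close>. It has the same form for
  \<open>q\<close> inside and outside \<open>X\<close> because \<open>q\<close> is not its own
  neighbour.\<close>

lemma graph_sign_flip:
  assumes E: "simple_graph n E" and "finite X"
  shows "graph_sign E (X \<triangle> {q}) = graph_sign E X * parity_sign (nbhd E q) X"
proof (cases "q \<in> X")
  case False
  then have "X \<triangle> {q} = insert q X" by auto
  then show ?thesis using graph_sign_insert[OF E False] by simp
next
  case True
  then have X: "X = insert q (X - {q})" "X \<triangle> {q} = X - {q}" by auto
  have "nbhd E q \<inter> X = nbhd E q \<inter> (X - {q})" using nbhd_irrefl[OF E] by blast
  then have p: "parity_sign (nbhd E q) X = parity_sign (nbhd E q) (X - {q})"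
    by (simp add: parity_sign_def)
  have "graph_sign E X = graph_sign E (X - {q}) * parity_sign (nbhd E q) X"
    by (subst X(1), subst graph_sign_insert[OF E]) (auto simp: p)
  then show ?thesis unfolding X(2) by (simp add: parity_sign_def)
qed

lemma graph_sign_empty: "simple_graph n E \<Longrightarrow> graph_sign E {} = 1"
proof -
  assume "simple_graph n E"
  then have "{e \<in> E. e \<subseteq> {}} = {}" unfolding simple_graph_def by blast
  then show ?thesis by (simp only: graph_sign_def) simp
qed

section \<open>The sets of pairs that are toggled, and their signs\<close>

definition graph_of :: "nat \<Rightarrow> (nat \<Rightarrow> nat \<Rightarrow> bool) \<Rightarrow> nat set set" where
  "graph_of n R = {{a, b} | a b. a \<in> {1..n} \<and> b \<in> {1..n} \<and> a \<noteq> b \<and> R a b}"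

lemma simple_graph_of: "simple_graph n (graph_of n R)"
  unfolding simple_graph_def graph_of_def by auto

lemma nbhd_graph_of:
  assumes "\<And>a b. R a b \<longleftrightarrow> R b a"
  shows "nbhd (graph_of n R) v = (if v \<in> {1..n} then {w \<in> {1..n}. w \<noteq> v \<and> R v w} else {})"
proof -
  have "R a b" if "R b a" for a b using assms that by blast
  then show ?thesis by (auto simp: nbhd_def graph_of_def doubleton_eq_iff)
qed

lemma simple_graph_sdiff: "simple_graph n E \<Longrightarrow> simple_graph n F \<Longrightarrow> simple_graph n (E \<triangle> F)"
  unfolding simple_graph_def by blast

definition complete_on :: "nat \<Rightarrow> nat set \<Rightarrow> nat set set" where
  "complete_on n B = graph_of n (\<lambda>a b. a \<in> B \<and> b \<in> B)"

text \<open>A pair with both ends in \<open>B \<inter> M\<close> is reached in both orientations and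
  thus toggled twice. The inequality of the two conditions leaves it alone.\<close>

definition cross :: "nat \<Rightarrow> nat set \<Rightarrow> nat set \<Rightarrow> nat set set" where
  "cross n B M = graph_of n (\<lambda>a b. (a \<in> B \<and> b \<in> M) \<noteq> (b \<in> B \<and> a \<in> M))"

lemma nbhd_complete_on: "B \<subseteq> {1..n} \<Longrightarrow> nbhd (complete_on n B) v = (if v \<in> B then B - {v} else {})"
  unfolding complete_on_def by (subst nbhd_graph_of) auto

lemma nbhd_cross: "B \<subseteq> {1..n} \<Longrightarrow> M \<subseteq> {1..n} \<Longrightarrow>
  nbhd (cross n B M) v = ((if v \<in> B then M else {}) \<triangle> (if v \<in> M then B else {})) - {v}"
  unfolding cross_def by (subst nbhd_graph_of) auto

text \<open>With \<open>s\<close> the size of \<open>B \<inter> X\<close>, the complete graph has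
  \<open>s (s - 1) / 2\<close> edges inside \<open>X\<close>, and
  \<open>\<i>^s (-1)^(s (s - 1) / 2)\<close> is 1 for even and \<open>\<i>\<close> for odd
  \<open>s\<close>. This turns a product of phase gates into a function of the parity of
  \<open>s\<close>.\<close>

lemma graph_sign_complete_on:
  assumes "B \<subseteq> {1..n}" "finite X"
  shows "\<i> ^ card (B \<inter> X) * graph_sign (complete_on n B) X = (if even (card (B \<inter> X)) then 1 else \<i>)"
  using assms(2)
proof (induction X rule: finite_induct)
  case empty
  then show ?case using graph_sign_empty[OF simple_graph_of] by (simp add: complete_on_def)
next
  case (insert q X)
  have g: "graph_sign (complete_on n B) (insert q X)
      = graph_sign (complete_on n B) X * parity_sign (nbhd (complete_on n B) q) X"
    by (rule graph_sign_insert[of n]) (use insert in \<open>auto simp: complete_on_def simple_graph_of\<close>)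
  show ?case
  proof (cases "q \<in> B")
    case True
    have "(B - {q}) \<inter> X = B \<inter> X" using insert.hyps by auto
    then have p: "card ((B - {q}) \<inter> X) = card (B \<inter> X)" by simp
    have "card (B \<inter> insert q X) = Suc (card (B \<inter> X))"
      using insert.hyps True by (simp add: Int_insert_right)
    note c = this
    have g': "graph_sign (complete_on n B) (insert q X) = graph_sign (complete_on n B) X * (-1) ^ card (B \<inter> X)"
      using True unfolding g nbhd_complete_on[OF assms(1)] parity_sign_def by (simp add: p)
    have "\<i> ^ card (B \<inter> insert q X) * graph_sign (complete_on n B) (insert q X)
        = \<i> * (-1) ^ card (B \<inter> X) * (\<i> ^ card (B \<inter> X) * graph_sign (complete_on n B) X)"
      unfolding g' c by simp
    also have "\<dots> = (if even (card (B \<inter> insert q X)) then 1 else \<i>)"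
      unfolding insert.IH c by simp
    finally show ?thesis .
  next
    case False
    then show ?thesis using insert.IH unfolding g nbhd_complete_on[OF assms(1)] by simp
  qed
qed

text \<open>The product of the two cardinalities counts all \<open>(b, m)\<close> with
  \<open>b \<in> B \<inter> X\<close> and \<open>m \<in> M \<inter> X\<close>. Pairs inside
  \<open>B \<inter> M\<close> occur twice and cancel; the diagonal cases \<open>b = m\<close> are no
  edges and are removed by the second factor.\<close>

lemma graph_sign_cross:
  assumes "B \<subseteq> {1..n}" "M \<subseteq> {1..n}" "finite X"
  shows "graph_sign (cross n B M) X =
    (-1) ^ (card (B \<inter> X) * card (M \<inter> X)) * (-1) ^ card (B \<inter> M \<inter> X)"
  using assms(3)
proof (induction X rule: finite_induct)
  case empty
  then show ?case using graph_sign_empty[OF simple_graph_of] by (simp add: cross_def)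
next
  case (insert q X)
  have g: "graph_sign (cross n B M) (insert q X)
      = graph_sign (cross n B M) X * parity_sign (nbhd (cross n B M) q) X"
    by (rule graph_sign_insert[of n]) (use insert in \<open>auto simp: cross_def simple_graph_of\<close>)
  have "nbhd (cross n B M) q \<inter> X = ((if q \<in> B then M else {}) \<triangle> (if q \<in> M then B else {})) \<inter> X"
    unfolding nbhd_cross[OF assms(1,2)] using insert.hyps by blast
  then have p: "parity_sign (nbhd (cross n B M) q) X =
      (if q \<in> B then parity_sign M X else 1) * (if q \<in> M then parity_sign B X else 1)"
  proof -
    assume "nbhd (cross n B M) q \<inter> X = ((if q \<in> B then M else {}) \<triangle> (if q \<in> M then B else {})) \<inter> X"
    then have "parity_sign (nbhd (cross n B M) q) X =
        parity_sign ((if q \<in> B then M else {}) \<triangle> (if q \<in> M then B else {})) X"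
      unfolding parity_sign_def by (rule arg_cong)
    then show ?thesis unfolding parity_sign_sdiff_left[OF insert.hyps(1)] by auto
  qed
  have c: "card (Y \<inter> insert q X) = (if q \<in> Y then 1 else 0) + card (Y \<inter> X)" for Y
    using insert.hyps by (simp add: Int_insert_right)
  show ?case unfolding g insert.IH p c unfolding parity_sign_def
    by (cases "q \<in> B"; cases "q \<in> M") (simp_all add: power_add algebra_simps)
qed

lemma graph_sign_single_edge:
  "a \<noteq> b \<Longrightarrow> (if a \<in> X \<and> b \<in> X then -1 else 1) = graph_sign {{a, b}} X"
proof -
  have "{e \<in> {{a, b}}. e \<subseteq> X} = (if a \<in> X \<and> b \<in> X then {{a, b}} else {})" by auto
  then show ?thesis by (simp only: graph_sign_def) simp
qed

subsection \<open>Gates on several qubits\<close>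

fun sub_bits :: "nat list \<Rightarrow> nat set \<Rightarrow> nat" where
  "sub_bits [] X = 0"
| "sub_bits (q # qs) X = of_bool (q \<in> X) * 2 ^ length qs + sub_bits qs X"

lemma sub_index_bits:
  assumes "set qs \<subseteq> {1..n}"
  shows "sub_index n qs k = sub_bits qs (bits n k)"
proof -
  have "foldl (\<lambda>m q. 2 * m + qubit_val n k q) m qs = m * 2 ^ length qs + sub_bits qs (bits n k)" for m
    using assms
    by (induction qs arbitrary: m) (auto simp: qubit_val_bits algebra_simps simp del: One_nat_def)
  from this[of 0] show ?thesis by (simp add: sub_index_def)
qed

lemma sub_bits_less: "sub_bits qs X < 2 ^ length qs"
  by (induction qs) auto

lemma sub_bits_cong: "X \<inter> set qs = Y \<inter> set qs \<Longrightarrow> sub_bits qs X = sub_bits qs Y"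
proof (induction qs)
  case (Cons q qs)
  then have "X \<inter> set qs = Y \<inter> set qs" "q \<in> X \<longleftrightarrow> q \<in> Y" by auto
  with Cons.IH show ?case by simp
qed simp

lemma sub_bits_eqD: "sub_bits qs X = sub_bits qs Y \<Longrightarrow> X \<inter> set qs = Y \<inter> set qs"
proof (induction qs)
  case (Cons q qs)
  have "q \<in> X \<longleftrightarrow> q \<in> Y"
    using Cons.prems sub_bits_less[of qs X] sub_bits_less[of qs Y]
    by (cases "q \<in> X"; cases "q \<in> Y") auto
  with Cons show ?case by auto
qed simp

text \<open>\<open>Z\<close> runs over the values of the qubits acted on, while the part of
  \<open>X\<close> outside \<open>qs\<close> is kept.\<close>

definition gate_amp :: "nat list \<Rightarrow> complex mat \<Rightarrow> (nat set \<Rightarrow> complex) \<Rightarrow> nat set \<Rightarrow> complex" where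
  "gate_amp qs W \<psi> X =
     (\<Sum>Z\<in>Pow (set qs). W $$ (sub_bits qs X, sub_bits qs Z) * \<psi> (X - set qs \<union> Z))"

lemma on_qubits_state:
  assumes qs: "set qs \<subseteq> {1..n}"
  shows "on_qubits n qs W *\<^sub>v state n \<psi> = state n (gate_amp qs W \<psi>)"
proof -
  have "(\<forall>q\<in>{1..n} - set qs. qubit_val n i q = qubit_val n j q) \<longleftrightarrow>
      bits n i - set qs = bits n j - set qs" for i j
  proof -
    have "(\<forall>q\<in>{1..n} - set qs. qubit_val n i q = qubit_val n j q) \<longleftrightarrow>
        (\<forall>q\<in>{1..n} - set qs. q \<in> bits n i \<longleftrightarrow> q \<in> bits n j)"
      by (intro ball_cong refl) (simp add: qubit_val_bits del: One_nat_def)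
    also have "\<dots> \<longleftrightarrow> bits n i - set qs = bits n j - set qs"
      using bits_le[of n i] bits_le[of n j] by blast
    finally show ?thesis .
  qed
  then have "on_qubits n qs W = mat (2 ^ n) (2 ^ n) (\<lambda>(i, j).
      if bits n i - set qs = bits n j - set qs
      then W $$ (sub_bits qs (bits n i), sub_bits qs (bits n j)) else 0)"
    unfolding on_qubits_def by (simp only: sub_index_bits[OF qs])
  then have "on_qubits n qs W *\<^sub>v state n \<psi> = state n (\<lambda>X. \<Sum>Y\<in>Pow {1..n}.
      (if X - set qs = Y - set qs then W $$ (sub_bits qs X, sub_bits qs Y) else 0) * \<psi> Y)"
    using mult_mat_state[of n "\<lambda>X Y. if X - set qs = Y - set qs
      then W $$ (sub_bits qs X, sub_bits qs Y) else 0"] by simp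
  also have "\<dots> = state n (gate_amp qs W \<psi>)"
  proof (rule state_cong)
    fix X assume X: "X \<subseteq> {1..n}"
    let ?h = "\<lambda>Z. X - set qs \<union> Z"
    have "(\<Sum>Y\<in>Pow {1..n}. (if X - set qs = Y - set qs then W $$ (sub_bits qs X, sub_bits qs Y) else 0) * \<psi> Y)
      = (\<Sum>Y\<in>?h ` Pow (set qs). W $$ (sub_bits qs X, sub_bits qs Y) * \<psi> Y)"
    proof (rule sum.mono_neutral_cong_right)
      show "\<forall>Y\<in>Pow {1..n} - ?h ` Pow (set qs).
        (if X - set qs = Y - set qs then W $$ (sub_bits qs X, sub_bits qs Y) else 0) * \<psi> Y = 0"
      proof
        fix Y assume Y: "Y \<in> Pow {1..n} - ?h ` Pow (set qs)"
        have "X - set qs \<noteq> Y - set qs"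
        proof
          assume "X - set qs = Y - set qs"
          then have "Y = ?h (Y \<inter> set qs)" by blast
          then show False using Y by blast
        qed
        then show "(if X - set qs = Y - set qs then W $$ (sub_bits qs X, sub_bits qs Y) else 0) * \<psi> Y = 0"
          by simp
      qed
    next
      fix Y assume "Y \<in> ?h ` Pow (set qs)"
      then have "X - set qs = Y - set qs" by blast
      then show "(if X - set qs = Y - set qs then W $$ (sub_bits qs X, sub_bits qs Y) else 0) * \<psi> Y =
         W $$ (sub_bits qs X, sub_bits qs Y) * \<psi> Y" by simp
    qed (use X qs in auto)
    also have "\<dots> = (\<Sum>Z\<in>Pow (set qs). W $$ (sub_bits qs X, sub_bits qs (?h Z)) * \<psi> (?h Z))"
      by (rule sum.reindex_cong[of ?h]) (auto simp: inj_on_def)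
    also have "\<dots> = gate_amp qs W \<psi> X"
      unfolding gate_amp_def
    proof (intro sum.cong refl)
      fix Z assume "Z \<in> Pow (set qs)"
      then have "sub_bits qs (?h Z) = sub_bits qs Z" by (intro sub_bits_cong) auto
      then show "W $$ (sub_bits qs X, sub_bits qs (?h Z)) * \<psi> (?h Z) =
        W $$ (sub_bits qs X, sub_bits qs Z) * \<psi> (?h Z)" by simp
    qed
    finally show "(\<Sum>Y\<in>Pow {1..n}. (if X - set qs = Y - set qs
      then W $$ (sub_bits qs X, sub_bits qs Y) else 0) * \<psi> Y) = gate_amp qs W \<psi> X" .
  qed
  finally show ?thesis .
qed

lemma sum_Pow_insert:
  assumes "finite A" "a \<notin> A"
  shows "(\<Sum>Z\<in>Pow (insert a A). f Z) = (\<Sum>Z\<in>Pow A. f Z) + (\<Sum>Z\<in>Pow A. f (insert a Z) :: complex)"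
proof -
  have "(\<Sum>Z\<in>Pow (insert a A). f Z) = (\<Sum>Z\<in>Pow A. f Z) + (\<Sum>Z\<in>insert a ` Pow A. f Z)"
    unfolding Pow_insert using assms by (intro sum.union_disjoint) auto
  also have "(\<Sum>Z\<in>insert a ` Pow A. f Z) = (\<Sum>Z\<in>Pow A. f (insert a Z))"
    using assms(2) by (intro sum.reindex_cong[of "insert a"]) (auto intro!: inj_onI)
  finally show ?thesis .
qed

lemma controlled_index:
  assumes "W \<in> carrier_mat m m" "i < m" "j < m"
  shows "controlled W $$ (i, j) = of_bool (i = j)" "controlled W $$ (i, m + j) = 0"
    "controlled W $$ (m + i, j) = 0" "controlled W $$ (m + i, m + j) = W $$ (i, j)"
  using assms by (auto simp: controlled_def)

lemma controlled_carrier: "W \<in> carrier_mat m m \<Longrightarrow> controlled W \<in> carrier_mat (2 * m) (2 * m)"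
  by (auto simp: controlled_def)

text \<open>Splitting the sum by whether \<open>Z\<close> contains the control separates the four
  blocks of the matrix. If the control is not in \<open>X\<close>, the identity block leaves only
  \<open>Z = X \<inter> set qs\<close>.\<close>

lemma gate_amp_controlled:
  assumes "distinct (a # qs)" "W \<in> carrier_mat (2 ^ length qs) (2 ^ length qs)"
  shows "gate_amp (a # qs) (controlled W) \<psi> X = (if a \<in> X then gate_amp qs W \<psi> X else \<psi> X)"
proof -
  have notin: "a \<notin> Z" if "Z \<in> Pow (set qs)" for Z using assms(1) that by auto
  have less: "sub_bits qs Z < 2 ^ length qs" for Z by (rule sub_bits_less)
  have ins: "sub_bits qs (insert a Z) = sub_bits qs Z" for Z
    using assms(1) by (intro sub_bits_cong) auto
  have split: "gate_amp (a # qs) (controlled W) \<psi> X =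
    (\<Sum>Z\<in>Pow (set qs). controlled W $$ (of_bool (a \<in> X) * 2 ^ length qs + sub_bits qs X, sub_bits qs Z)
        * \<psi> (X - insert a (set qs) \<union> Z)) +
    (\<Sum>Z\<in>Pow (set qs). controlled W $$ (of_bool (a \<in> X) * 2 ^ length qs + sub_bits qs X, 2 ^ length qs + sub_bits qs Z)
        * \<psi> (X - insert a (set qs) \<union> insert a Z))"
    unfolding gate_amp_def list.set
    by (subst sum_Pow_insert) (use assms(1) notin ins in auto)
  show ?thesis
  proof (cases "a \<in> X")
    case True
    have X: "X - insert a (set qs) \<union> insert a Z = X - set qs \<union> Z" for Z
      using True assms(1) by auto
    have e1: "controlled W $$ (of_bool (a \<in> X) * 2 ^ length qs + sub_bits qs X, sub_bits qs Z) = 0" for Z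
      using controlled_index(3)[OF assms(2) less less] by (simp only: True of_bool_eq(2) mult_1)
    have e2: "controlled W $$ (of_bool (a \<in> X) * 2 ^ length qs + sub_bits qs X, 2 ^ length qs + sub_bits qs Z)
        = W $$ (sub_bits qs X, sub_bits qs Z)" for Z
      using controlled_index(4)[OF assms(2) less less] by (simp only: True of_bool_eq(2) mult_1)
    have "(\<Sum>Z\<in>Pow (set qs). controlled W $$ (of_bool (a \<in> X) * 2 ^ length qs + sub_bits qs X, sub_bits qs Z)
        * \<psi> (X - insert a (set qs) \<union> Z)) = 0"
      by (intro sum.neutral ballI) (simp only: e1 mult_zero_left)
    moreover have "(\<Sum>Z\<in>Pow (set qs). controlled W $$ (of_bool (a \<in> X) * 2 ^ length qs + sub_bits qs X,
        2 ^ length qs + sub_bits qs Z) * \<psi> (X - insert a (set qs) \<union> insert a Z)) = gate_amp qs W \<psi> X"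
      unfolding gate_amp_def by (intro sum.cong refl arg_cong2[where f = "(*)"] e2 arg_cong[where f = \<psi>] X)
    ultimately show ?thesis
      by (intro trans[OF split]) (simp only: True if_True add_0)
  next
    case False
    have "(\<Sum>Z\<in>Pow (set qs). of_bool (sub_bits qs X = sub_bits qs Z) * \<psi> (X - insert a (set qs) \<union> Z))
      = (\<Sum>Z\<in>{X \<inter> set qs}. \<psi> (X - insert a (set qs) \<union> Z))"
    proof (rule sum.mono_neutral_cong_right)
      show "\<forall>Z\<in>Pow (set qs) - {X \<inter> set qs}.
        of_bool (sub_bits qs X = sub_bits qs Z) * \<psi> (X - insert a (set qs) \<union> Z) = 0"
      proof
        fix Z assume "Z \<in> Pow (set qs) - {X \<inter> set qs}"
        then have "X \<inter> set qs \<noteq> Z \<inter> set qs" by blast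
        then have "sub_bits qs X \<noteq> sub_bits qs Z" using sub_bits_eqD by blast
        then show "of_bool (sub_bits qs X = sub_bits qs Z) * \<psi> (X - insert a (set qs) \<union> Z) = 0" by simp
      qed
      show "of_bool (sub_bits qs X = sub_bits qs Z) * \<psi> (X - insert a (set qs) \<union> Z) =
        \<psi> (X - insert a (set qs) \<union> Z)" if "Z \<in> {X \<inter> set qs}" for Z
      proof -
        have "sub_bits qs X = sub_bits qs Z" using that by (intro sub_bits_cong) auto
        then show ?thesis by simp
      qed
    qed auto
    also have "\<dots> = \<psi> X"
    proof -
      have "X - insert a (set qs) \<union> X \<inter> set qs = X" using False by auto
      then show ?thesis by (simp only: sum.insert finite.emptyI empty_iff not_False_eq_True sum.empty add_0_right)
    qed
    finally have sum: "(\<Sum>Z\<in>Pow (set qs). of_bool (sub_bits qs X = sub_bits qs Z)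
        * \<psi> (X - insert a (set qs) \<union> Z)) = \<psi> X" .
    have e1: "controlled W $$ (of_bool (a \<in> X) * 2 ^ length qs + sub_bits qs X, sub_bits qs Z)
        = of_bool (sub_bits qs X = sub_bits qs Z)" for Z
      using controlled_index(1)[OF assms(2) less less] by (simp only: False of_bool_eq(1) mult_zero_left add_0)
    have e2: "controlled W $$ (of_bool (a \<in> X) * 2 ^ length qs + sub_bits qs X, 2 ^ length qs + sub_bits qs Z)
        = 0" for Z
      using controlled_index(2)[OF assms(2) less less] by (simp only: False of_bool_eq(1) mult_zero_left add_0)
    show ?thesis
      unfolding split e1 e2 sum by (simp only: False if_False mult_zero_left sum.neutral_const add_0_right)
  qed
qed

lemma gate_amp_single:
  "gate_amp [q] W \<psi> X = entry W (q \<in> X) False * \<psi> (X - {q}) + entry W (q \<in> X) True * \<psi> (insert q X)"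
proof -
  have "Pow (set [q]) = {{}, {q}}" by auto
  then show ?thesis by (simp add: gate_amp_def entry_def)
qed

lemma gate_X_carrier [simp]: "gate_X \<in> carrier_mat 2 2"
  and gate_Z_carrier [simp]: "gate_Z \<in> carrier_mat 2 2"
  and gate_H_carrier [simp]: "gate_H \<in> carrier_mat 2 2"
  and gate_S_carrier [simp]: "gate_S \<in> carrier_mat 2 2"
  by (simp_all add: gate_X_def gate_Z_def gate_S_def gate_H_mat2)

lemma gate_amp_CZ:
  assumes "a \<noteq> b"
  shows "gate_amp [a, b] (controlled gate_Z) \<psi> X = graph_sign {{a, b}} X * \<psi> X"
proof -
  have "gate_amp [a, b] (controlled gate_Z) \<psi> X = (if a \<in> X then gate_amp [b] gate_Z \<psi> X else \<psi> X)"
    using assms by (intro gate_amp_controlled) simp_all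
  also have "\<dots> = (if a \<in> X \<and> b \<in> X then -1 else 1) * \<psi> X"
    by (cases "b \<in> X") (simp_all add: gate_amp_single gate_Z_def entry_mat2 insert_absorb)
  finally show ?thesis unfolding graph_sign_single_edge[OF assms] .
qed

text \<open>Each \<open>CZ\<close> gate multiplies by the sign of its edge. As no edge occurs twice
  in the list, the signs multiply to that of the whole graph.\<close>

lemma graph_state_state:
  assumes E: "simple_graph n E"
  shows "graph_state n E = state n (\<lambda>X. complex_of_real (1 / sqrt 2) ^ n * graph_sign E X)"
proof -
  define L where "L = [(a, b). a \<leftarrow> [1..<Suc n], b \<leftarrow> [Suc a..<Suc n], {a, b} \<in> E]"
  let ?r = "complex_of_real (1 / sqrt 2) ^ n"
  have setL: "set L = {(a, b). a \<in> {1..n} \<and> b \<in> {1..n} \<and> a < b \<and> {a, b} \<in> E}"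
    unfolding L_def by (auto simp: less_Suc_eq_le)
  have "distinct L"
  proof -
    have "distinct (concat (map (\<lambda>b. if {a, b} \<in> E then [(a, b)] else []) bs))" if "distinct bs" for a bs
      using that by (induction bs) auto
    then have "distinct (concat (map (\<lambda>a. concat (map (\<lambda>b. if {a, b} \<in> E then [(a, b)] else [])
        [Suc a..<Suc n])) as))" if "distinct as" for as
      using that by (induction as) auto
    then show ?thesis unfolding L_def by simp
  qed
  have base: "tensor_vec n (\<lambda>_. ket_plus) = state n (\<lambda>X. ?r)"
  proof -
    have "ket_plus $ (k mod 2) = complex_of_real (1 / sqrt 2)" for k
      by (cases "k mod 2 = 0") (auto simp: ket_plus_def vec_of_list_index)
    then show ?thesis by (simp add: tensor_vec_def state_def qubit_val_def)
  qed
  have "foldr (\<lambda>(a, b) \<psi>. on_qubits n [a, b] (controlled gate_Z) *\<^sub>v \<psi>) M (state n (\<lambda>X. ?r))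
      = state n (\<lambda>X. ?r * graph_sign ((\<lambda>(a, b). {a, b}) ` set M) X)"
    if "set M \<subseteq> set L" "distinct M" for M
    using that
  proof (induction M)
    case Nil
    then show ?case by (simp add: graph_sign_def)
  next
    case (Cons p M)
    obtain a b where p: "p = (a, b)" by fastforce
    have ab: "a \<in> {1..n}" "b \<in> {1..n}" "a < b" "a \<noteq> b" using Cons.prems p setL by auto
    \<comment> \<open>The list is duplicate-free as a list of ordered pairs; the order
      \<open>a < b\<close> makes it duplicate-free as a list of edges.\<close>
    have new: "{a, b} \<notin> (\<lambda>(a, b). {a, b}) ` set M"
    proof
      assume "{a, b} \<in> (\<lambda>(a, b). {a, b}) ` set M"
      then obtain e where e: "e \<in> set M" "{a, b} = (case e of (a, b) \<Rightarrow> {a, b})" by (rule imageE)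
      obtain a' b' where "e = (a', b')" by (cases e)
      then have ab': "(a', b') \<in> set M" "{a, b} = {a', b'}" using e by simp_all
      then have "(a', b') \<in> set L" using Cons.prems(1) by (simp add: subset_iff)
      then have "a' < b'" unfolding setL by simp
      then have "a = a' \<and> b = b'" using ab'(2) ab(3) by (metis doubleton_eq_iff not_less_iff_gr_or_eq)
      then show False using ab'(1) Cons.prems(2) unfolding p by simp
    qed
    have "graph_sign {{a, b}} X * graph_sign ((\<lambda>(a, b). {a, b}) ` set M) X =
      graph_sign ((\<lambda>(a, b). {a, b}) ` set (p # M)) X" for X
    proof -
      have "(\<lambda>(a, b). {a, b}) ` set (p # M) = insert {a, b} ((\<lambda>(a, b). {a, b}) ` set M)"
        by (simp add: p)
      also have "\<dots> = {{a, b}} \<triangle> ((\<lambda>(a, b). {a, b}) ` set M)"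
        by (rule insert_sdiff[OF new])
      finally show ?thesis by (elim ssubst, intro graph_sign_sdiff[symmetric]) simp_all
    qed
    note sign = this
    let ?G = "\<lambda>X. ?r * graph_sign ((\<lambda>(a, b). {a, b}) ` set M) X"
    have "foldr (\<lambda>(a, b) \<psi>. on_qubits n [a, b] (controlled gate_Z) *\<^sub>v \<psi>) (p # M) (state n (\<lambda>X. ?r))
        = on_qubits n [a, b] (controlled gate_Z) *\<^sub>v state n ?G"
      using Cons by (simp add: p)
    also have "\<dots> = state n (gate_amp [a, b] (controlled gate_Z) ?G)"
      using ab by (intro on_qubits_state) simp
    also have "\<dots> = state n (\<lambda>X. ?r * graph_sign ((\<lambda>(a, b). {a, b}) ` set (p # M)) X)"
      unfolding gate_amp_CZ[OF ab(4)] sign[symmetric] by (simp only: mult.left_commute)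
    finally show ?case .
  qed
  from this[of L] have "graph_state n E = state n (\<lambda>X. ?r * graph_sign ((\<lambda>(a, b). {a, b}) ` set L) X)"
    using \<open>distinct L\<close> unfolding graph_state_def base L_def[symmetric] by simp
  also have "(\<lambda>(a, b). {a, b}) ` set L = E"
  proof
    show "E \<subseteq> (\<lambda>(a, b). {a, b}) ` set L"
    proof
      fix e assume e: "e \<in> E"
      then obtain a b where ab: "e = {a, b}" "a \<in> {1..n}" "b \<in> {1..n}" "a \<noteq> b"
        using E unfolding simple_graph_def by blast
      define c d where "c = min a b" and "d = max a b"
      have cd: "e = {c, d}" "c \<in> {1..n}" "d \<in> {1..n}" "c < d"
        using ab by (auto simp: c_def d_def min_def max_def)
      then have "(c, d) \<in> set L" using e unfolding setL by simp
      then show "e \<in> (\<lambda>(a, b). {a, b}) ` set L" by (rule image_eqI[rotated]) (simp add: cd(1))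
    qed
  qed (auto simp: setL)
  finally show ?thesis .
qed

section \<open>Pauli projections of graph states\<close>

definition pauli_amp :: "bool \<times> nat \<Rightarrow> (nat set \<Rightarrow> complex) \<Rightarrow> nat set \<Rightarrow> complex" where
  "pauli_amp p \<psi> X = (case p of (x, q) \<Rightarrow>
     if x then \<psi> (X \<triangle> {q}) else (if q \<in> X then -1 else 1) * \<psi> X)"

text \<open>The factors are kept unnormalised: \<open>\<sigma> = 2\<close> gives
  \<open>1 - P\<close> and \<open>\<sigma> = 0\<close> gives \<open>1 + P\<close>, so that the empty
  list with \<open>\<sigma> = 0\<close> doubles the vector. The flag of a list element selects
  \<open>X\<close> (\<open>True\<close>) or \<open>Z\<close> (\<open>False\<close>).\<close>

definition stage :: "nat \<Rightarrow> (bool \<times> nat) list \<Rightarrow> (nat set \<Rightarrow> complex) \<Rightarrow> nat set \<Rightarrow> complex" where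
  "stage \<sigma> ps \<psi> X = \<psi> X + \<i> ^ \<sigma> * fold pauli_amp ps \<psi> X"

text \<open>Note that \<open>pauli 0 (\<not> x) x\<close> is \<open>X\<close> or \<open>Z\<close>.
  The choice depends on the matrix \<open>u\<close> only, so its values form a finite table that is
  written into the program.\<close>

definition conj_pauli :: "bool \<Rightarrow> complex mat \<Rightarrow> nat \<times> bool \<times> bool" where
  "conj_pauli x u = (SOME (t, b, a). t < 4 \<and> pauli 0 (\<not> x) x * u = u * pauli t b a)"

lemma conj_pauli:
  assumes "u \<in> local_clifford" "conj_pauli x u = (t, b, a)"
  shows "t < 4" "pauli 0 (\<not> x) x * u = u * pauli t b a"
proof -
  have "\<exists>p. case p of (t, b, a) \<Rightarrow> t < 4 \<and> pauli 0 (\<not> x) x * u = u * pauli t b a"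
    using local_clifford_passes_paulis[OF assms(1)] unfolding passes_paulis_def by simp
  from someI_ex[OF this] have "case conj_pauli x u of (t, b, a) \<Rightarrow>
      t < 4 \<and> pauli 0 (\<not> x) x * u = u * pauli t b a"
    unfolding conj_pauli_def .
  then show "t < 4" "pauli 0 (\<not> x) x * u = u * pauli t b a" using assms(2) by auto
qed

text \<open>Moves a Pauli operator through the local Clifford operations \<open>u\<close> and turns
  \<open>\<i>\<^sup>k Z\<^sub>B |G\<rangle>\<close> into another vector of this form, because \<open>X\<^sub>q |G\<rangle>\<close> is the product of \<open>Z\<close> on
  the neighbours of \<open>q\<close>.\<close>
definition track ::
  "(nat \<Rightarrow> nat set) \<Rightarrow> (nat \<Rightarrow> complex mat) \<Rightarrow> bool \<times> nat \<Rightarrow> nat \<times> nat set \<Rightarrow> nat \<times> nat set" where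
  "track N u p kB = (case p of (x, q) \<Rightarrow> case kB of (k, B) \<Rightarrow> case conj_pauli x (u q) of (t, b, a) \<Rightarrow>
     ((k + t + (if a \<and> q \<in> B then 2 else 0)) mod 4,
      (B \<triangle> (if a then N q else {})) \<triangle> (if b then {q} else {})))"

definition signed_amp :: "nat set set \<Rightarrow> nat \<times> nat set \<Rightarrow> nat set \<Rightarrow> complex" where
  "signed_amp E kB X = \<i> ^ fst kB * parity_sign (snd kB) X * graph_sign E X"

lemma pauli_amp_tensor:
  assumes "X \<subseteq> {1..n}" "q \<in> {1..n}"
  shows "tensor_amp n (on_qubit (pauli t b a) q) \<psi> X =
    \<i> ^ t * (if b \<and> q \<in> X then -1 else 1) * \<psi> (if a then X \<triangle> {q} else X)"
proof (cases "q \<in> X")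
  case True
  then have "insert q X = X" "X \<triangle> {q} = X - {q}" by auto
  with True show ?thesis using tensor_amp_on_qubit[OF assms] by (simp add: entry_pauli)
next
  case False
  then have "X - {q} = X" "X \<triangle> {q} = insert q X" by auto
  with False show ?thesis using tensor_amp_on_qubit[OF assms] by (simp add: entry_pauli)
qed

lemma pauli_amp_track:
  assumes E: "simple_graph n E" and X: "X \<subseteq> {1..n}" and q: "q \<in> {1..n}"
    and u: "\<And>v. v \<in> {1..n} \<Longrightarrow> u v \<in> local_clifford"
  shows "pauli_amp (x, q) (tensor_amp n u (signed_amp E (k, B))) X
    = tensor_amp n u (signed_amp E (track (nbhd E) u (x, q) (k, B))) X"
proof -
  obtain t b a where c: "conj_pauli x (u q) = (t, b, a)" by (metis prod_cases3)
  have pq: "pauli 0 (\<not> x) x * u q = u q * pauli t b a"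
    using conj_pauli(2)[OF u[OF q] c] .
  have car: "u v \<in> carrier_mat 2 2" if "v \<in> {1..n}" for v
    using local_clifford_carrier[OF u[OF that]] .
  have onc: "on_qubit (pauli t b a) q v \<in> carrier_mat 2 2" for t b a v
    by (simp add: on_qubit_def)
  have "pauli_amp (x, q) (tensor_amp n u (signed_amp E (k, B))) X
    = tensor_amp n (on_qubit (pauli 0 (\<not> x) x) q) (tensor_amp n u (signed_amp E (k, B))) X"
    using X q by (simp add: pauli_amp_tensor pauli_amp_def)
  also have "\<dots> = tensor_amp n (\<lambda>v. on_qubit (pauli 0 (\<not> x) x) q v * u v) (signed_amp E (k, B)) X"
    by (rule tensor_amp_mult) (use car onc in auto)
  also have "\<dots> = tensor_amp n (\<lambda>v. u v * on_qubit (pauli t b a) q v) (signed_amp E (k, B)) X"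
  proof (rule tensor_amp_cong)
    fix v assume "v \<in> {1..n}"
    from left_mult_one_mat[OF car[OF this]] right_mult_one_mat[OF car[OF this]]
    show "on_qubit (pauli 0 (\<not> x) x) q v * u v = u v * on_qubit (pauli t b a) q v"
      using pq by (simp add: on_qubit_def)
  qed simp
  also have "\<dots> = tensor_amp n u (tensor_amp n (on_qubit (pauli t b a) q) (signed_amp E (k, B))) X"
    by (rule tensor_amp_mult[symmetric]) (use car onc in auto)
  also have "\<dots> = tensor_amp n u (signed_amp E (track (nbhd E) u (x, q) (k, B))) X"
  proof (rule tensor_amp_cong[OF refl])
    fix Y assume Y: "Y \<subseteq> {1..n}"
    then have fY: "finite Y" by (auto intro: finite_subset)
    \<comment> \<open>The sign for \<open>q \<in> B\<close> is the anticommutation of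
      \<open>X\<close> at \<open>q\<close> with the product of \<open>Z\<close> over
      \<open>B\<close>; the parity of the neighbourhood comes from the graph state absorbing the
      \<open>X\<close>.\<close>
    have flip: "signed_amp E (k, B) (Y \<triangle> {q}) =
        \<i> ^ k * (if q \<in> B then -1 else 1) * (parity_sign B Y * parity_sign (nbhd E q) Y) * graph_sign E Y"
      using parity_sign_sdiff_right[OF fY, of "{q}" B]
      by (simp only: signed_amp_def graph_sign_flip[OF E fY] fst_conv snd_conv parity_sign_singleton)
        (simp add: algebra_simps)
    have tr: "signed_amp E (track (nbhd E) u (x, q) (k, B)) Y =
        \<i> ^ k * \<i> ^ t * (if a \<and> q \<in> B then -1 else 1) *
        (parity_sign B Y * (if a then parity_sign (nbhd E q) Y else 1) * (if b \<and> q \<in> Y then -1 else 1))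
        * graph_sign E Y"
    proof -
      have "parity_sign ((B \<triangle> (if a then nbhd E q else {})) \<triangle> (if b then {q} else {})) Y =
        parity_sign B Y * (if a then parity_sign (nbhd E q) Y else 1) * (if b \<and> q \<in> Y then -1 else 1)"
        unfolding parity_sign_sdiff_left[OF fY] by (auto simp: parity_sign_singleton)
      then show ?thesis
        by (simp only: signed_amp_def track_def c prod.case fst_conv snd_conv i_power_mod_4 power_add)
          auto
    qed
    show "tensor_amp n (on_qubit (pauli t b a) q) (signed_amp E (k, B)) Y =
      signed_amp E (track (nbhd E) u (x, q) (k, B)) Y"
      unfolding pauli_amp_tensor[OF Y q] tr
    proof (cases a)
      case True
      then show "\<i> ^ t * (if b \<and> q \<in> Y then - 1 else 1) *
        signed_amp E (k, B) (if a then Y \<triangle> {q} else Y) =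
        \<i> ^ k * \<i> ^ t * (if a \<and> q \<in> B then - 1 else 1) *
        (parity_sign B Y * (if a then parity_sign (nbhd E q) Y else 1) *
         (if b \<and> q \<in> Y then - 1 else 1)) * graph_sign E Y"
        by (simp only: if_True flip) (simp add: algebra_simps)
    next
      case False
      then show "\<i> ^ t * (if b \<and> q \<in> Y then - 1 else 1) *
        signed_amp E (k, B) (if a then Y \<triangle> {q} else Y) =
        \<i> ^ k * \<i> ^ t * (if a \<and> q \<in> B then - 1 else 1) *
        (parity_sign B Y * (if a then parity_sign (nbhd E q) Y else 1) *
         (if b \<and> q \<in> Y then - 1 else 1)) * graph_sign E Y"
        by (simp add: signed_amp_def)
    qed
  qed
  finally show ?thesis .
qed

lemma pauli_amp_cong:
  assumes "\<And>X. X \<subseteq> {1..n} \<Longrightarrow> \<psi> X = \<phi> X" "snd p \<in> {1..n}" "X \<subseteq> {1..n}"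
  shows "pauli_amp p \<psi> X = pauli_amp p \<phi> X"
proof -
  have "X \<triangle> {snd p} \<subseteq> {1..n}" using assms(2,3) by blast
  then show ?thesis using assms by (auto simp: pauli_amp_def split: prod.split)
qed

lemma fold_pauli_amp_cong:
  assumes "\<And>X. X \<subseteq> {1..n} \<Longrightarrow> \<psi> X = \<phi> X" "\<And>p. p \<in> set ps \<Longrightarrow> snd p \<in> {1..n}" "X \<subseteq> {1..n}"
  shows "fold pauli_amp ps \<psi> X = fold pauli_amp ps \<phi> X"
  using assms
proof (induction ps arbitrary: \<psi> \<phi> X)
  case (Cons p ps)
  show ?case
    unfolding fold_simps
  proof (rule Cons.IH)
    show "pauli_amp p \<psi> X = pauli_amp p \<phi> X" if "X \<subseteq> {1..n}" for X
      using Cons.prems(1) Cons.prems(2)[of p] that by (intro pauli_amp_cong) auto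
  qed (use Cons.prems in auto)
qed simp

lemma stage_cong:
  assumes "\<And>X. X \<subseteq> {1..n} \<Longrightarrow> \<psi> X = \<phi> X" "\<And>p. p \<in> set ps \<Longrightarrow> snd p \<in> {1..n}" "X \<subseteq> {1..n}"
  shows "stage \<sigma> ps \<psi> X = stage \<sigma> ps \<phi> X"
  unfolding stage_def using fold_pauli_amp_cong[OF assms] assms(1,3) by simp

lemma fold_pauli_amp_track:
  assumes E: "simple_graph n E" and X: "X \<subseteq> {1..n}"
    and u: "\<And>v. v \<in> {1..n} \<Longrightarrow> u v \<in> local_clifford"
    and ps: "\<And>p. p \<in> set ps \<Longrightarrow> snd p \<in> {1..n}"
  shows "fold pauli_amp ps (tensor_amp n u (signed_amp E kB)) X
    = tensor_amp n u (signed_amp E (fold (track (nbhd E) u) ps kB)) X"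
  using ps
proof (induction ps arbitrary: kB)
  case (Cons p ps)
  obtain x q k B where p: "p = (x, q)" "kB = (k, B)" by (cases p; cases kB)
  have "q \<in> {1..n}" using Cons.prems[of p] p by simp
  have "fold pauli_amp (p # ps) (tensor_amp n u (signed_amp E kB)) X
      = fold pauli_amp ps (pauli_amp p (tensor_amp n u (signed_amp E kB))) X" by simp
  also have "\<dots> = fold pauli_amp ps (tensor_amp n u (signed_amp E (track (nbhd E) u p kB))) X"
    using Cons.prems X \<open>q \<in> {1..n}\<close> unfolding p
    by (intro fold_pauli_amp_cong[of n] pauli_amp_track[OF E _ _ u]) auto
  also have "\<dots> = tensor_amp n u (signed_amp E (fold (track (nbhd E) u) (p # ps) kB)) X"
    using Cons by simp
  finally show ?case .
qed simp

lemma pauli_amp_smult: "pauli_amp p (\<lambda>X. c * \<psi> X) = (\<lambda>X. c * pauli_amp p \<psi> X)"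
  by (auto simp: pauli_amp_def split: prod.split)

lemma fold_pauli_amp_smult: "fold pauli_amp ps (\<lambda>X. c * \<psi> X) = (\<lambda>X. c * fold pauli_amp ps \<psi> X)"
  by (induction ps arbitrary: \<psi>) (simp_all add: pauli_amp_smult)

lemma stage_smult: "stage \<sigma> ps (\<lambda>X. c * \<psi> X) X = c * stage \<sigma> ps \<psi> X"
  by (simp add: stage_def fold_pauli_amp_smult algebra_simps)

lemma track_le:
  assumes "snd p \<in> {1..n}" "\<And>v. N v \<subseteq> {1..n}" "snd kB \<subseteq> {1..n}"
  shows "snd (track N u p kB) \<subseteq> {1..n}" "fst (track N u p kB) < 4"
  using assms by (auto simp: track_def split: prod.splits if_splits)

lemma fold_track_le:
  assumes "\<And>p. p \<in> set ps \<Longrightarrow> snd p \<in> {1..n}" "\<And>v. N v \<subseteq> {1..n}" "snd kB \<subseteq> {1..n}" "fst kB < 4"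
  shows "snd (fold (track N u) ps kB) \<subseteq> {1..n} \<and> fst (fold (track N u) ps kB) < 4"
  using assms
proof (induction ps arbitrary: kB)
  case (Cons p ps)
  then show ?case using track_le[of p n N kB u] by simp
qed simp

subsection \<open>Reduction to graph states\<close>

text \<open>The vector \<open>(1 + \<i>\<^sup>k Z\<^sub>B) |G\<rangle>\<close> is a graph state up to local Clifford operations. If \<open>pivot\<close>
  does not hold, then \<open>B\<close> is empty or \<open>k\<close> is odd, and all pairs in \<open>B\<close> are toggled. If it holds,
  then a Hadamard gate is split off at a vertex \<open>w \<in> B\<close>, and the pairs between \<open>B\<close> and the closed
  neighbourhood of \<open>w\<close> are toggled, as well as, for odd \<open>k\<close>, those within the latter. The number
  \<open>m\<close> is 2 for \<open>w\<close> itself and 1 for its neighbours; \<open>b\<close> is membership in \<open>B\<close>.\<close>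

definition correction :: "bool \<Rightarrow> nat \<Rightarrow> bool \<Rightarrow> nat \<Rightarrow> complex mat" where
  "correction pivot k b m =
    (if pivot then
       if m = 2 then gate_H * gate_S ^\<^sub>m k
       else if m = 1 then gate_S ^\<^sub>m (k + (if b then 2 else 0)) else 1\<^sub>m 2
     else if b then gate_S ^\<^sub>m (3 * k) else 1\<^sub>m 2)"

text \<open>The closed neighbourhood is added to a vertex of \<open>B\<close> by the pairs between
  \<open>B\<close> and \<open>M\<close>, and for odd \<open>k\<close> to a vertex of
  \<open>M\<close> by the complete graph on \<open>M\<close>. For a vertex in both sets these two
  additions cancel.\<close>

definition add_closed_nbhd :: "bool \<Rightarrow> nat \<Rightarrow> bool \<Rightarrow> nat \<Rightarrow> bool" where
  "add_closed_nbhd pivot k b m \<longleftrightarrow> pivot \<and> (b \<noteq> (odd k \<and> 0 < m))"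

definition add_support :: "bool \<Rightarrow> bool \<Rightarrow> nat \<Rightarrow> bool" where
  "add_support pivot b m \<longleftrightarrow> (if pivot then 0 < m else b)"

definition mark :: "bool \<Rightarrow> nat set set \<Rightarrow> nat \<Rightarrow> nat \<Rightarrow> nat" where
  "mark pivot E w v = (if pivot then if v = w then 2 else if v \<in> nbhd E w then 1 else 0 else 0)"

text \<open>Removing \<open>v\<close> at the end takes care of the loops that arise whenever
  \<open>v\<close> lies in a set added to its own neighbourhood.\<close>

definition new_nbhd :: "bool \<Rightarrow> nat \<Rightarrow> nat set set \<Rightarrow> nat set \<Rightarrow> nat \<Rightarrow> nat \<Rightarrow> nat set" where
  "new_nbhd pivot k E B w v =
    ((nbhd E v \<triangle> (if add_closed_nbhd pivot k (v \<in> B) (mark pivot E w v) then insert w (nbhd E w) else {}))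
      \<triangle> (if add_support pivot (v \<in> B) (mark pivot E w v) then B else {})) - {v}"

lemma pow_mat_carrier2: "A \<in> carrier_mat 2 2 \<Longrightarrow> A ^\<^sub>m j \<in> carrier_mat 2 2"
  by (rule pow_carrier_mat)

lemma correction_local_clifford: "correction pivot k b m \<in> local_clifford"
  by (simp add: correction_def mult_local_clifford H_local_clifford S_local_clifford
      one_local_clifford pow_local_clifford)

lemma entry_gate_S: "entry gate_S x y = of_bool (x = y) * (if x then \<i> else 1)"
  by (simp add: gate_S_mat2 entry_mat2)

lemma entry_gate_S_pow: "entry (gate_S ^\<^sub>m j) x y = of_bool (x = y) * (if x then \<i> ^ j else 1)"
proof (induction j arbitrary: x y)
  case 0
  have "dim_row gate_S = 2" using gate_S_carrier by (simp only: carrier_matD)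
  then show ?case by (simp add: entry_one)
next
  case (Suc j)
  have "entry (gate_S ^\<^sub>m Suc j) x y = entry (gate_S ^\<^sub>m j) x True * entry gate_S True y
      + entry (gate_S ^\<^sub>m j) x False * entry gate_S False y"
    unfolding pow_mat.simps by (rule entry_mult[OF pow_mat_carrier2 gate_S_carrier]) simp
  then show ?case unfolding Suc by (simp add: entry_gate_S)
qed

lemma prod_if_power:
  assumes "A \<subseteq> {1..n :: nat}"
  shows "(\<Prod>q = 1..n. if q \<in> A then c else 1 :: complex) = c ^ card A"
proof -
  have "(\<Prod>q = 1..n. if q \<in> A then c else 1) = (\<Prod>q\<in>A. c)"
    using assms by (intro prod.mono_neutral_cong_right) auto
  then show ?thesis by simp
qed

text \<open>For odd \<open>k\<close>, \<open>S ^ (3 k)\<close> on \<open>B\<close> together with the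
  complete graph on \<open>B\<close> yields 1 or \<open>- \<i>^k\<close> according to the parity of
  \<open>B \<inter> X\<close>, and \<open>(1 + \<i>^k) (- \<i>^k) = 1 - \<i>^k\<close>. For empty
  \<open>B\<close> both sides are a scalar multiple of the graph state.\<close>

lemma complete_reduction:
  assumes E: "simple_graph n E" and B: "B \<subseteq> {1..n}" and X: "X \<subseteq> {1..n}"
    and k: "B = {} \<or> odd k" "k < 4"
  shows "(1 + \<i> ^ k * parity_sign B X) * graph_sign E X = (1 + \<i> ^ k) *
    tensor_amp n (\<lambda>v. correction False k (v \<in> B) 0) (graph_sign (E \<triangle> complete_on n B)) X"
proof -
  let ?s = "card (B \<inter> X)" and ?g = "graph_sign (complete_on n B) X"
  have fX: "finite X" using X by (auto intro: finite_subset)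
  have g: "\<i> ^ ?s * ?g = (if even ?s then 1 else \<i>)"
    by (rule graph_sign_complete_on[OF B fX])
  have "tensor_amp n (\<lambda>v. correction False k (v \<in> B) 0) (graph_sign (E \<triangle> complete_on n B)) X
    = (\<Prod>q = 1..n. entry (correction False k (q \<in> B) 0) (q \<in> X) (q \<in> X)) * graph_sign (E \<triangle> complete_on n B) X"
    by (rule tensor_amp_diag[OF X]) (auto simp: correction_def entry_gate_S_pow entry_one)
  also have "(\<Prod>q = 1..n. entry (correction False k (q \<in> B) 0) (q \<in> X) (q \<in> X))
    = (\<Prod>q = 1..n. if q \<in> B \<inter> X then \<i> ^ (3 * k) else 1)"
    by (intro prod.cong refl) (auto simp: correction_def entry_gate_S_pow entry_one)
  also have "\<dots> = (\<i> ^ (3 * k)) ^ ?s"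
    by (rule prod_if_power) (use B in auto)
  also have "graph_sign (E \<triangle> complete_on n B) X = graph_sign E X * ?g"
    by (intro graph_sign_sdiff simple_graph_finite[OF E] simple_graph_finite[of n])
      (simp add: complete_on_def simple_graph_of)
  finally have t: "tensor_amp n (\<lambda>v. correction False k (v \<in> B) 0) (graph_sign (E \<triangle> complete_on n B)) X
    = (\<i> ^ (3 * k)) ^ ?s * (graph_sign E X * ?g)" .
  have "1 + \<i> ^ k * (-1) ^ ?s = (1 + \<i> ^ k) * ((\<i> ^ (3 * k)) ^ ?s * ?g)"
  proof (cases "B = {}")
    case True
    then show ?thesis using g by simp
  next
    case False
    then have "odd k" using k(1) by simp
    then have "k = 1 \<or> k = 3" using k(2) by presburger
    then show ?thesis
    proof
      assume k: "k = 1"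
      have "(\<i> ^ (3 * k)) ^ ?s = (- \<i>) ^ ?s" by (simp add: k eval_nat_numeral)
      also have "\<dots> = (-1) ^ ?s * \<i> ^ ?s" by (simp flip: power_mult_distrib)
      finally have "(\<i> ^ (3 * k)) ^ ?s * ?g = (-1) ^ ?s * (if even ?s then 1 else \<i>)"
        using g by (simp only: mult.assoc)
      then show ?thesis unfolding k by (cases "even ?s") (simp_all add: algebra_simps)
    next
      assume k: "k = 3"
      have "(\<i> ^ (3 * k)) ^ ?s * ?g = (if even ?s then 1 else \<i>)"
        using g by (simp add: k eval_nat_numeral)
      then show ?thesis unfolding k
        by (cases "even ?s") (simp_all add: algebra_simps power3_eq_cube)
    qed
  qed
  then show ?thesis unfolding t by (simp add: parity_sign_def)
qed

text \<open>The amplitude \<open>\<phi> Y\<close> of the new state before the Hadamard gate is, up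
  to the sign of \<open>w \<in> Y\<close>, that of the old graph times a factor: 1 if
  \<open>M \<inter> Y\<close> is even, and \<open>\<i>^k\<close> times the sign of \<open>B\<close>
  if it is odd, because the sign of the cross pairs has exponent
  \<open>|B \<inter> Y| |M \<inter> Y|\<close>. Of two sets differing in \<open>w\<close> one is
  even and one is odd, so the Hadamard gate adds exactly one term of each kind.\<close>

lemma pivot_reduction:
  assumes E: "simple_graph n E" and B: "B \<subseteq> {1..n}" and X: "X \<subseteq> {1..n}" and w: "w \<in> B" and k: "k < 4"
  defines "M \<equiv> insert w (nbhd E w)"
  shows "(1 + \<i> ^ k * parity_sign B X) * graph_sign E X = complex_of_real (sqrt 2) *
    tensor_amp n (\<lambda>v. correction True k (v \<in> B) (mark True E w v))
      (graph_sign ((E \<triangle> cross n B M) \<triangle> (if odd k then complete_on n M else {}))) X"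
proof -
  let ?E = "(E \<triangle> cross n B M) \<triangle> (if odd k then complete_on n M else {})"
  \<comment> \<open>The exponent 2 is a \<open>Z\<close> on \<open>B \<inter> M\<close> without
    \<open>w\<close>. It cancels the diagonal sign in \<open>graph_sign_cross\<close> everywhere but
    at \<open>w\<close>, where the sign is wanted: it compensates the one that \<open>Z\<close> over
    \<open>B\<close> acquires when \<open>w\<close> is flipped.\<close>
  define D where "D v = (if v \<in> M then gate_S ^\<^sub>m (k + (if v \<in> B \<and> v \<noteq> w then 2 else 0)) else 1\<^sub>m 2)" for v
  define \<phi> where "\<phi> = tensor_amp n D (graph_sign ?E)"
  have wn: "w \<in> {1..n}" using w B by auto
  have M: "M \<subseteq> {1..n}" using wn nbhd_le[OF E] unfolding M_def by auto
  have wN: "w \<notin> nbhd E w" by (rule nbhd_irrefl[OF E])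
  have Dc: "D v \<in> carrier_mat 2 2" for v by (simp add: D_def pow_mat_carrier2)
  have \<phi>: "\<phi> Y = graph_sign E Y * (-1) ^ (card (B \<inter> Y) * card (M \<inter> Y)) *
      (if w \<in> Y then -1 else 1) * (if even (card (M \<inter> Y)) then 1 else \<i> ^ k)"
    if Y: "Y \<subseteq> {1..n}" for Y
  proof -
    let ?s = "card (M \<inter> Y)"
    have fY: "finite Y" using Y by (auto intro: finite_subset)
    have "\<phi> Y = (\<Prod>q = 1..n. entry (D q) (q \<in> Y) (q \<in> Y)) * graph_sign ?E Y"
      unfolding \<phi>_def by (rule tensor_amp_diag[OF Y]) (auto simp: D_def entry_gate_S_pow entry_one)
    also have "(\<Prod>q = 1..n. entry (D q) (q \<in> Y) (q \<in> Y))
      = (\<Prod>q = 1..n. (if q \<in> M \<inter> Y then \<i> ^ k else 1) * (if q \<in> (B \<inter> M \<inter> Y) - {w} then -1 else 1))"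
      by (intro prod.cong refl) (auto simp: D_def entry_gate_S_pow entry_one power_add simp del: pow_mat.simps)
    also have "\<dots> = (\<i> ^ k) ^ ?s * (-1) ^ card ((B \<inter> M \<inter> Y) - {w})"
      unfolding prod.distrib using M by (intro arg_cong2[where f = "(*)"] prod_if_power) auto
    also have "graph_sign ?E Y = graph_sign E Y * graph_sign (cross n B M) Y *
        (if odd k then graph_sign (complete_on n M) Y else 1)"
    proof -
      have f: "finite E" "finite (cross n B M)" "finite (complete_on n M)"
        using simple_graph_finite[OF E] simple_graph_finite[OF simple_graph_of]
        by (simp_all add: cross_def complete_on_def)
      have e: "graph_sign {} Y = 1" by (simp add: graph_sign_def)
      show ?thesis
        using graph_sign_sdiff[OF f(1,2)] graph_sign_sdiff[OF finite_sdiff[OF f(1,2)] f(3)]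
          graph_sign_sdiff[OF finite_sdiff[OF f(1,2)] finite.emptyI] e
        by (cases "odd k") (simp_all only: if_True if_False mult_1_right not_True_eq_False not_False_eq_True)
    qed
    also have "graph_sign (cross n B M) Y =
      (-1) ^ (card (B \<inter> Y) * ?s) * (-1) ^ card (B \<inter> M \<inter> Y)"
      by (rule graph_sign_cross[OF B M fY])
    finally have 1: "\<phi> Y = (\<i> ^ k) ^ ?s * (-1) ^ card ((B \<inter> M \<inter> Y) - {w}) * (graph_sign E Y *
      ((-1) ^ (card (B \<inter> Y) * ?s) * (-1) ^ card (B \<inter> M \<inter> Y)) *
      (if odd k then graph_sign (complete_on n M) Y else 1))" .
    have 2: "(-1) ^ card ((B \<inter> M \<inter> Y) - {w}) * (-1) ^ card (B \<inter> M \<inter> Y) = (if w \<in> Y then -1 else 1 :: complex)"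
    proof (cases "w \<in> Y")
      case True
      then have "w \<in> B \<inter> M \<inter> Y" using w by (simp add: M_def)
      moreover have "finite (B \<inter> M \<inter> Y)" using fY by simp
      ultimately have "card (B \<inter> M \<inter> Y) = Suc (card ((B \<inter> M \<inter> Y) - {w}))" by (metis card_Suc_Diff1)
      then show ?thesis using True by (simp flip: power_add)
    next
      case False
      then have "(B \<inter> M \<inter> Y) - {w} = B \<inter> M \<inter> Y" by auto
      then show ?thesis using False by (simp flip: power_add)
    qed
    have g: "\<i> ^ ?s * graph_sign (complete_on n M) Y = (if even ?s then 1 else \<i>)"
      by (rule graph_sign_complete_on[OF M fY])
    \<comment> \<open>For even \<open>k\<close> the power \<open>(\<i>^k)^s\<close> is already a
      function of the parity of \<open>s\<close>; for odd \<open>k\<close> the complete graph on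
      \<open>M\<close> makes it one.\<close>
    have 3: "(\<i> ^ k) ^ ?s * (if odd k then graph_sign (complete_on n M) Y else 1)
        = (if even ?s then 1 else \<i> ^ k)"
    proof -
      have "k = 0 \<or> k = 1 \<or> k = 2 \<or> k = 3" using k by auto
      moreover have "(- \<i>) ^ ?s = (-1) ^ ?s * \<i> ^ ?s" by (simp flip: power_mult_distrib)
      moreover have "\<i> ^ 3 = - \<i>" by (simp add: eval_nat_numeral)
      ultimately show ?thesis using g by (auto simp: algebra_simps split: if_splits)
    qed
    have "\<phi> Y = graph_sign E Y * (-1) ^ (card (B \<inter> Y) * ?s) *
      ((-1) ^ card ((B \<inter> M \<inter> Y) - {w}) * (-1) ^ card (B \<inter> M \<inter> Y)) *
      ((\<i> ^ k) ^ ?s * (if odd k then graph_sign (complete_on n M) Y else 1))"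
      unfolding 1 by (simp only: mult_ac)
    then show ?thesis unfolding 2 3 .
  qed
  have "tensor_amp n (\<lambda>v. correction True k (v \<in> B) (mark True E w v)) (graph_sign ?E) X
      = tensor_amp n (\<lambda>v. on_qubit gate_H w v * D v) (graph_sign ?E) X"
  proof (rule tensor_amp_cong)
    fix v
    have "1\<^sub>m 2 * D v = D v" by (rule left_mult_one_mat[OF Dc])
    then show "correction True k (v \<in> B) (mark True E w v) = on_qubit gate_H w v * D v"
      by (auto simp: correction_def mark_def on_qubit_def D_def M_def)
  qed simp
  also have "\<dots> = tensor_amp n (on_qubit gate_H w) \<phi> X"
    unfolding \<phi>_def by (rule tensor_amp_mult[symmetric]) (auto simp: on_qubit_def Dc)
  also have "\<dots> = entry gate_H (w \<in> X) False * \<phi> (X - {w}) + entry gate_H (w \<in> X) True * \<phi> (insert w X)"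
    by (rule tensor_amp_on_qubit[OF X wn])
  also have "\<dots> = complex_of_real (1 / sqrt 2) * (\<phi> (X - {w}) + (if w \<in> X then -1 else 1) * \<phi> (insert w X))"
    by (simp add: gate_H_mat2 entry_mat2 algebra_simps)
  finally have t: "complex_of_real (sqrt 2) *
     tensor_amp n (\<lambda>v. correction True k (v \<in> B) (mark True E w v)) (graph_sign ?E) X
     = \<phi> (X - {w}) + (if w \<in> X then -1 else 1) * \<phi> (insert w X)"
    by (simp flip: mult.assoc of_real_mult)
  \<comment> \<open>Everything is expressed at the set without \<open>w\<close>. The parity of its
    intersection with the neighbourhood of \<open>w\<close> decides which of \<open>Y\<close> and
    \<open>insert w Y\<close> carries the summand 1.\<close>
  define Y where "Y = X - {w}"
  have Y: "Y \<subseteq> {1..n}" "w \<notin> Y" "finite Y" "insert w X = insert w Y" "insert w Y \<subseteq> {1..n}"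
    using X wn by (auto simp: Y_def intro: finite_subset)
  define s where "s = card (nbhd E w \<inter> Y)"
  define l where "l = card (B \<inter> Y)"
  have M0: "card (M \<inter> Y) = s" using Y(2) by (simp add: M_def s_def)
  have M1: "card (M \<inter> insert w Y) = Suc s"
    using Y(2,3) by (simp add: M_def s_def Int_insert_right wN)
  have B1: "card (B \<inter> insert w Y) = Suc l"
    using Y(2,3) w by (simp add: l_def Int_insert_right)
  have G1: "graph_sign E (insert w Y) = graph_sign E Y * (-1) ^ s"
    using graph_sign_insert[OF E Y(2)] by (simp add: parity_sign_def s_def)
  have p0: "\<phi> Y = graph_sign E Y * (-1) ^ (l * s) * (if even s then 1 else \<i> ^ k)"
    unfolding \<phi>[OF Y(1)] M0 l_def[symmetric] using Y(2) by simp
  have p1: "\<phi> (insert w Y) = graph_sign E Y * (-1) ^ s * (-1) ^ (Suc l * Suc s) * (-1) *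
      (if even s then \<i> ^ k else 1)"
    unfolding \<phi>[OF Y(5)] M1 B1 G1 by simp
  show ?thesis
  proof (cases "w \<in> X")
    case False
    then have "X = Y" by (simp add: Y_def)
    then have "parity_sign B X = (-1) ^ l" "graph_sign E X = graph_sign E Y"
      by (simp_all add: parity_sign_def l_def)
    then show ?thesis unfolding t Y_def[symmetric] Y(4) p0 p1
      using False by (cases "even s"; cases "even l") (simp_all add: algebra_simps)
  next
    case True
    then have "X = insert w Y" by (auto simp: Y_def)
    then have "parity_sign B X = (-1) ^ Suc l" "graph_sign E X = graph_sign E Y * (-1) ^ s"
      using B1 G1 by (simp_all add: parity_sign_def)
    then show ?thesis unfolding t Y_def[symmetric] Y(4) p0 p1
      using True by (cases "even s"; cases "even l") (simp_all add: algebra_simps)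
  qed
qed

text \<open>The scalar is \<open>sqrt 2\<close> with a pivot and \<open>1 + \<i>^k\<close> without
  one. The latter is 0 for empty \<open>B\<close> and \<open>k = 2\<close>, the case in which the
  factor annihilates the state.\<close>

lemma graph_reduction:
  assumes E: "simple_graph n E" and B: "B \<subseteq> {1..n}" and k: "k < 4"
    and pivot: "if pivot then w \<in> B else B = {} \<or> odd k"
  obtains E' c where "simple_graph n E'" "\<And>v. v \<in> {1..n} \<Longrightarrow> nbhd E' v = new_nbhd pivot k E B w v"
    "\<And>X. X \<subseteq> {1..n} \<Longrightarrow> (1 + \<i> ^ k * parity_sign B X) * graph_sign E X =
       c * tensor_amp n (\<lambda>v. correction pivot k (v \<in> B) (mark pivot E w v)) (graph_sign E') X"
proof (cases pivot)
  case False
  have nb: "nbhd (E \<triangle> complete_on n B) v = new_nbhd pivot k E B w v" if "v \<in> {1..n}" for v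
    unfolding nbhd_sdiff nbhd_complete_on[OF B] new_nbhd_def
    using False nbhd_irrefl[OF E, of v]
    by (auto simp: add_closed_nbhd_def add_support_def)
  show thesis
  proof (rule that[OF _ nb])
    show "simple_graph n (E \<triangle> complete_on n B)"
      unfolding complete_on_def by (intro simple_graph_sdiff E simple_graph_of)
  next
    fix X assume "X \<subseteq> {1..n}"
    from complete_reduction[OF E B this _ k]
    show "(1 + \<i> ^ k * parity_sign B X) * graph_sign E X =
       (1 + \<i> ^ k) * tensor_amp n (\<lambda>v. correction pivot k (v \<in> B) (mark pivot E w v))
         (graph_sign (E \<triangle> complete_on n B)) X"
      using False pivot by (simp add: mark_def)
  qed
next
  case True
  let ?M = "insert w (nbhd E w)"
  let ?E = "(E \<triangle> cross n B ?M) \<triangle> (if odd k then complete_on n ?M else {})"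
  have w: "w \<in> B" using True pivot by simp
  have M: "?M \<subseteq> {1..n}" using w B nbhd_le[OF E] by auto
  have e: "nbhd {} v = {}" for v by (simp add: nbhd_def)
  have mk: "0 < mark pivot E w v \<longleftrightarrow> v \<in> ?M" for v
    using True by (simp add: mark_def)
  have nb: "nbhd ?E v = new_nbhd pivot k E B w v" if "v \<in> {1..n}" for v
  proof -
    have "nbhd ?E v = (nbhd E v \<triangle> (((if v \<in> B then ?M else {}) \<triangle> (if v \<in> ?M then B else {})) - {v}))
        \<triangle> (if odd k \<and> v \<in> ?M then ?M - {v} else {})"
      using nbhd_complete_on[OF M, of v] e
      unfolding nbhd_sdiff nbhd_cross[OF B M] by (cases "odd k"; cases "v \<in> ?M") simp_all
    also have "\<dots> = new_nbhd pivot k E B w v"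
      using True nbhd_irrefl[OF E, of v]
      unfolding new_nbhd_def add_closed_nbhd_def add_support_def mk
      by (cases "v \<in> B"; cases "v \<in> ?M"; cases "odd k") (simp_all only: if_True if_False simp_thms, blast+)
    finally show ?thesis .
  qed
  show thesis
  proof (rule that[OF _ nb])
    show "simple_graph n ?E"
      using simple_graph_sdiff[OF simple_graph_sdiff[OF E simple_graph_of] simple_graph_of]
        simple_graph_sdiff[OF E simple_graph_of]
      unfolding complete_on_def cross_def by (cases "odd k") simp_all
  next
    fix X assume "X \<subseteq> {1..n}"
    from pivot_reduction[OF E B this w k]
    show "(1 + \<i> ^ k * parity_sign B X) * graph_sign E X =
       complex_of_real (sqrt 2) * tensor_amp n (\<lambda>v. correction pivot k (v \<in> B) (mark pivot E w v))
         (graph_sign ?E) X"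
      using True by simp
  qed
qed

text \<open>The tracking starts with exponent \<open>\<sigma>\<close> and empty support, so the
  phase of the stage is absorbed into \<open>k\<close>. The corrections act on the graph state
  before \<open>u\<close> does and therefore multiply \<open>u\<close> from the right.\<close>

lemma stage_reduction:
  assumes E: "simple_graph n E" and u: "\<And>v. v \<in> {1..n} \<Longrightarrow> u v \<in> local_clifford"
    and ps: "\<And>p. p \<in> set ps \<Longrightarrow> snd p \<in> {1..n}" and \<sigma>: "\<sigma> < 4"
    and kB: "fold (track (nbhd E) u) ps (\<sigma>, {}) = (k, B)"
    and pivot: "if pivot then w \<in> B else B = {} \<or> odd k"
  obtains E' c where "simple_graph n E'" "\<And>v. v \<in> {1..n} \<Longrightarrow> nbhd E' v = new_nbhd pivot k E B w v"
    "\<And>X. X \<subseteq> {1..n} \<Longrightarrow> stage \<sigma> ps (tensor_amp n u (graph_sign E)) X =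
       c * tensor_amp n (\<lambda>v. u v * correction pivot k (v \<in> B) (mark pivot E w v)) (graph_sign E') X"
proof -
  have le: "B \<subseteq> {1..n}" "k < 4"
    using fold_track_le[of ps n "nbhd E" "(\<sigma>, {})" u] ps nbhd_le[OF E] \<sigma> kB by auto
  obtain E' c where E': "simple_graph n E'" "\<And>v. v \<in> {1..n} \<Longrightarrow> nbhd E' v = new_nbhd pivot k E B w v"
    and c: "\<And>X. X \<subseteq> {1..n} \<Longrightarrow> (1 + \<i> ^ k * parity_sign B X) * graph_sign E X =
       c * tensor_amp n (\<lambda>v. correction pivot k (v \<in> B) (mark pivot E w v)) (graph_sign E') X"
    using graph_reduction[OF E le pivot] by blast
  have "stage \<sigma> ps (tensor_amp n u (graph_sign E)) X =
       c * tensor_amp n (\<lambda>v. u v * correction pivot k (v \<in> B) (mark pivot E w v)) (graph_sign E') X"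
    if X: "X \<subseteq> {1..n}" for X
  proof -
    have a: "\<i> ^ \<sigma> * tensor_amp n u (graph_sign E) Y = tensor_amp n u (signed_amp E (\<sigma>, {})) Y" for Y
    proof -
      have "signed_amp E (\<sigma>, {}) = (\<lambda>Y. \<i> ^ \<sigma> * graph_sign E Y)"
        by (rule ext) (simp add: signed_amp_def)
      then show ?thesis by (simp add: tensor_amp_smult)
    qed
    have "\<i> ^ \<sigma> * fold pauli_amp ps (tensor_amp n u (graph_sign E)) X
        = fold pauli_amp ps (tensor_amp n u (signed_amp E (\<sigma>, {}))) X"
      unfolding a[symmetric] fold_pauli_amp_smult ..
    also have "\<dots> = tensor_amp n u (signed_amp E (k, B)) X"
      using fold_pauli_amp_track[OF E X, of u ps "(\<sigma>, {})"] u ps unfolding kB by blast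
    finally have "stage \<sigma> ps (tensor_amp n u (graph_sign E)) X =
        tensor_amp n u (\<lambda>Y. graph_sign E Y + signed_amp E (k, B) Y) X"
      unfolding stage_def tensor_amp_add by simp
    also have "\<dots> = tensor_amp n u (\<lambda>Y. c *
        tensor_amp n (\<lambda>v. correction pivot k (v \<in> B) (mark pivot E w v)) (graph_sign E') Y) X"
      by (rule tensor_amp_cong[OF refl]) (simp add: c[symmetric] signed_amp_def algebra_simps)
    also have "\<dots> = c * tensor_amp n (\<lambda>v. u v * correction pivot k (v \<in> B) (mark pivot E w v)) (graph_sign E') X"
      unfolding tensor_amp_smult
      using local_clifford_carrier u correction_local_clifford by (subst tensor_amp_mult) auto
    finally show ?thesis .
  qed
  with E' show thesis by (rule that)
qed

subsection \<open>Decomposition of the gates\<close>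

text \<open>Exchanging two different bits is the same as flipping both of them.\<close>

lemma gate_amp_SWAP:
  assumes "b \<noteq> c"
  shows "gate_amp [b, c] gate_SWAP \<psi> X =
    (if (b \<in> X) = (c \<in> X) then \<psi> X else \<psi> ((X \<triangle> {c}) \<triangle> {b}))"
proof -
  have P: "Pow (set [b, c]) = {{}, {b}, {c}, {b, c}}" by auto
  have d: "{b} \<noteq> {c}" "{b} \<noteq> {b, c}" "{c} \<noteq> {b, c}" using assms by auto
  have X: "X - {b, c} \<union> {b, c} = X" if "b \<in> X" "c \<in> X" using that by auto
  have X': "X - {b, c} \<union> {} = X" if "b \<notin> X" "c \<notin> X" using that by auto
  have X1: "X - {b, c} \<union> {c} = (X \<triangle> {c}) \<triangle> {b}" if "b \<in> X" "c \<notin> X" using that assms by auto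
  have X2: "X - {b, c} \<union> {b} = (X \<triangle> {c}) \<triangle> {b}" if "b \<notin> X" "c \<in> X" using that assms by auto
  have l: "set [b, c] = {b, c}" by simp
  have "gate_amp [b, c] gate_SWAP \<psi> X =
    (\<Sum>Z\<in>{{}, {b}, {c}, {b, c}}. gate_SWAP $$ (sub_bits [b, c] X, sub_bits [b, c] Z) * \<psi> (X - {b, c} \<union> Z))"
    unfolding gate_amp_def P unfolding l ..
  also have "\<dots> =
      gate_SWAP $$ (sub_bits [b, c] X, 0) * \<psi> (X - {b, c} \<union> {}) +
      (gate_SWAP $$ (sub_bits [b, c] X, 2) * \<psi> (X - {b, c} \<union> {b}) +
      (gate_SWAP $$ (sub_bits [b, c] X, 1) * \<psi> (X - {b, c} \<union> {c}) +
      gate_SWAP $$ (sub_bits [b, c] X, 3) * \<psi> (X - {b, c} \<union> {b, c})))"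
    using assms d by simp
  finally have g: "gate_amp [b, c] gate_SWAP \<psi> X =
      gate_SWAP $$ (sub_bits [b, c] X, 0) * \<psi> (X - {b, c} \<union> {}) +
      (gate_SWAP $$ (sub_bits [b, c] X, 2) * \<psi> (X - {b, c} \<union> {b}) +
      (gate_SWAP $$ (sub_bits [b, c] X, 1) * \<psi> (X - {b, c} \<union> {c}) +
      gate_SWAP $$ (sub_bits [b, c] X, 3) * \<psi> (X - {b, c} \<union> {b, c})))" .
  have S: "gate_SWAP $$ (i, j) = of_bool (i = 0 \<and> j = 0 \<or> i = 1 \<and> j = 2 \<or> i = 2 \<and> j = 1 \<or> i = 3 \<and> j = 3)"
    if "i < 4" "j < 4" for i j :: nat
    using that by (auto simp: gate_SWAP_def mat_of_rows_list_def numeral_eq_Suc less_Suc_eq)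
  consider "b \<in> X" "c \<in> X" | "b \<in> X" "c \<notin> X" | "b \<notin> X" "c \<in> X" | "b \<notin> X" "c \<notin> X" by blast
  then show ?thesis
  proof cases
    case 1
    then have "sub_bits [b, c] X = 3" by simp
    then show ?thesis unfolding g X[OF 1] using 1 by (simp add: S)
  next
    case 2
    then have "sub_bits [b, c] X = 2" by simp
    then show ?thesis unfolding g X1[OF 2] using 2 by (simp add: S)
  next
    case 3
    then have "sub_bits [b, c] X = 1" by simp
    then show ?thesis unfolding g X2[OF 3] using 3 by (simp add: S)
  next
    case 4
    then have "sub_bits [b, c] X = 0" by simp
    then show ?thesis unfolding g X'[OF 4] using 4 by (simp add: S)
  qed
qed

text \<open>A stage names a qubit by its position in \<open>qs\<close>, counted from 1. This
  position is also the number of the register that holds the qubit, so the same list serves as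
  program text.\<close>

definition valid_stage :: "nat \<Rightarrow> nat \<times> (bool \<times> nat) list \<Rightarrow> bool" where
  "valid_stage m st \<longleftrightarrow> fst st < 4 \<and> (\<forall>p\<in>set (snd st). 1 \<le> snd p \<and> snd p \<le> m)"

definition at_qubits :: "nat list \<Rightarrow> (bool \<times> nat) list \<Rightarrow> (bool \<times> nat) list" where
  "at_qubits qs = map (map_prod id (\<lambda>r. qs ! (r - 1)))"

definition run_stage :: "nat list \<Rightarrow> nat \<times> (bool \<times> nat) list \<Rightarrow> (nat set \<Rightarrow> complex) \<Rightarrow> nat set \<Rightarrow> complex" where
  "run_stage qs st = stage (fst st) (at_qubits qs (snd st))"

lemma gate_decomposition:
  assumes "C \<in> gate_set"
  obtains m st0 st1 st2 st3 g c1 c2 where "m \<in> {1..3}" "dim_row C = 2 ^ m"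
    "valid_stage m st0" "valid_stage m st1" "valid_stage m st2" "valid_stage m st3" "g \<in> local_clifford"
    "\<And>qs \<psi> X. distinct qs \<Longrightarrow> length qs = m \<Longrightarrow> gate_amp qs C \<psi> X = c1 * run_stage qs st0 \<psi> X +
      c2 * gate_amp [qs ! (m - 1)] g (run_stage qs st3 (run_stage qs st2 (run_stage qs st1 \<psi>))) X"
proof -
  note stage_simps = run_stage_def at_qubits_def stage_def pauli_amp_def gate_amp_single entry_one
  have id: "gate_amp [q] (1\<^sub>m 2) \<psi> X = \<psi> X" for q \<psi> X
    by (cases "q \<in> X") (simp_all add: gate_amp_single entry_one insert_absorb)
  have one: "valid_stage m (0, [])" "valid_stage (Suc m) (2, [(False, 1)])" "valid_stage (Suc m) (0, [(False, 1)])" for m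
    by (simp_all add: valid_stage_def)
  have c1: "controlled W \<in> carrier_mat 4 4" if "W \<in> carrier_mat 2 2" for W
    using controlled_carrier[OF that] by simp
  have c2: "dim_row (controlled W) = 4" if "W \<in> carrier_mat 2 2" for W
    using c1[OF that] by simp
  have c3: "dim_row (controlled W) = 8" if "W \<in> carrier_mat 4 4" for W
    using controlled_carrier[OF that] by simp
  have SW: "gate_SWAP \<in> carrier_mat 4 4" by (auto simp: gate_SWAP_def mat_of_rows_list_def)
  have amp2: "gate_amp [a, b] (controlled W) \<psi> X = (if a \<in> X then gate_amp [b] W \<psi> X else \<psi> X)"
    if "a \<noteq> b" "W \<in> carrier_mat 2 2" for a b W \<psi> X
    using that by (intro gate_amp_controlled) simp_all
  have amp3: "gate_amp [a, b, c] (controlled W) \<psi> X = (if a \<in> X then gate_amp [b, c] W \<psi> X else \<psi> X)"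
    if "distinct [a, b, c]" "W \<in> carrier_mat 4 4" for a b c W \<psi> X
    using that by (intro gate_amp_controlled) simp_all
  have len1: "\<exists>a. qs = [a]" if "length qs = 1" for qs :: "nat list"
    using that by (auto simp: length_Suc_conv)
  have len2: "\<exists>a b. qs = [a, b]" if "length qs = 2" for qs :: "nat list"
    using that by (auto simp: length_Suc_conv numeral_2_eq_2)
  have len3: "\<exists>a b c. qs = [a, b, c]" if "length qs = 3" for qs :: "nat list"
    using that by (auto simp: length_Suc_conv numeral_3_eq_3)
  consider (T) "C = gate_T" | (CS) "C = controlled gate_S" | (CH) "C = controlled gate_H"
    | (CCZ) "C = controlled (controlled gate_Z)" | (CCX) "C = controlled (controlled gate_X)"
    | (CSWAP) "C = controlled gate_SWAP"
    using assms unfolding gate_set_def by blast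
  then show thesis
  proof cases
    case T
    let ?e = "exp (\<i> * complex_of_real pi / 4)"
    show thesis
    \<comment> \<open>\<open>1 - Z\<close> is twice the projection onto the value 1 and the two
      empty stages contribute 4, hence the 8. The empty stage of the first summand doubles the
      vector, hence \<open>1 / 2\<close>.\<close>
    proof (rule that[of 1 "(0, [])" "(2, [(False, 1)])" "(0, [])" "(0, [])" "1\<^sub>m 2" "1 / 2" "(?e - 1) / 8"])
      show "dim_row C = 2 ^ 1" by (simp add: T gate_T_def mat_of_rows_list_def)
      fix qs :: "nat list" and \<psi> X assume "length qs = 1"
      then obtain a where qs: "qs = [a]" using len1 by blast
      show "gate_amp qs C \<psi> X = 1 / 2 * run_stage qs (0, []) \<psi> X +
        (?e - 1) / 8 * gate_amp [qs ! (1 - 1)] (1\<^sub>m 2)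
          (run_stage qs (0, []) (run_stage qs (0, []) (run_stage qs (2, [(False, 1)]) \<psi>))) X"
        unfolding id qs T
        by (cases "a \<in> X") (simp_all add: stage_simps gate_T_def entry_mat2 insert_absorb field_simps)
    qed (simp_all add: valid_stage_def one_local_clifford)
  next
    case CS
    show thesis
    \<comment> \<open>Two factors \<open>1 - Z\<close> are four times the projection onto both
      values 1, and the empty stage doubles it.\<close>
    proof (rule that[of 2 "(0, [])" "(2, [(False, 1)])" "(2, [(False, 2)])" "(0, [])" "1\<^sub>m 2" "1 / 2" "(\<i> - 1) / 8"])
      show "dim_row C = 2 ^ 2" by (simp add: CS c2)
      fix qs :: "nat list" and \<psi> X assume "distinct qs" "length qs = 2"
      then obtain a b where qs: "qs = [a, b]" "a \<noteq> b" using len2 by fastforce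
      show "gate_amp qs C \<psi> X = 1 / 2 * run_stage qs (0, []) \<psi> X +
        (\<i> - 1) / 8 * gate_amp [qs ! (2 - 1)] (1\<^sub>m 2)
          (run_stage qs (0, []) (run_stage qs (2, [(False, 2)]) (run_stage qs (2, [(False, 1)]) \<psi>))) X"
        unfolding id qs CS amp2[OF qs(2) gate_S_carrier]
        by (cases "a \<in> X"; cases "b \<in> X")
          (simp_all add: stage_simps gate_S_mat2 entry_mat2 insert_absorb field_simps)
    qed (simp_all add: valid_stage_def one_local_clifford)
  next
    case CH
    show thesis
    \<comment> \<open>Here the summands are the two values of the control: \<open>1 + Z\<close> and
      \<open>1 - Z\<close> are twice the two projections, and the empty stages of the second summand
      contribute 4. The Hadamard gate is applied afterwards as the local operation
      \<open>g\<close>.\<close>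
    proof (rule that[of 2 "(0, [(False, 1)])" "(2, [(False, 1)])" "(0, [])" "(0, [])" gate_H "1 / 2" "1 / 8"])
      show "dim_row C = 2 ^ 2" by (simp add: CH c2)
      fix qs :: "nat list" and \<psi> X assume "distinct qs" "length qs = 2"
      then obtain a b where qs: "qs = [a, b]" "a \<noteq> b" using len2 by fastforce
      show "gate_amp qs C \<psi> X = 1 / 2 * run_stage qs (0, [(False, 1)]) \<psi> X +
        1 / 8 * gate_amp [qs ! (2 - 1)] gate_H
          (run_stage qs (0, []) (run_stage qs (0, []) (run_stage qs (2, [(False, 1)]) \<psi>))) X"
        using qs(2) unfolding qs(1) CH amp2[OF qs(2) gate_H_carrier]
        by (cases "a \<in> X")
          (simp_all add: stage_simps field_simps)
    qed (simp_all add: valid_stage_def H_local_clifford)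
  next
    case CCZ
    show thesis
    \<comment> \<open>The gate subtracts twice the projection onto three values 1, and the product
      of the factors is 8 times this projection.\<close>
    proof (rule that[of 3 "(0, [])" "(2, [(False, 1)])" "(2, [(False, 2)])" "(2, [(False, 3)])" "1\<^sub>m 2" "1 / 2" "- 1 / 4"])
      show "dim_row C = 2 ^ 3" by (simp add: CCZ c3 c1)
      fix qs :: "nat list" and \<psi> X assume "distinct qs" "length qs = 3"
      then obtain a b c where qs: "qs = [a, b, c]" "distinct [a, b, c]" using len3 by blast
      then have bc: "b \<noteq> c" by simp
      show "gate_amp qs C \<psi> X = 1 / 2 * run_stage qs (0, []) \<psi> X +
        - 1 / 4 * gate_amp [qs ! (3 - 1)] (1\<^sub>m 2)
          (run_stage qs (2, [(False, 3)]) (run_stage qs (2, [(False, 2)]) (run_stage qs (2, [(False, 1)]) \<psi>))) X"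
        unfolding id qs(1) CCZ amp3[OF qs(2) c1[OF gate_Z_carrier]] amp2[OF bc gate_Z_carrier]
        by (cases "a \<in> X"; cases "b \<in> X"; cases "c \<in> X")
          (simp_all add: stage_simps gate_Z_def entry_mat2 insert_absorb)
    qed (simp_all add: valid_stage_def one_local_clifford)
  next
    case CCX
    show thesis
    \<comment> \<open>If both controls are 1, the product of the factors is
      \<open>4 (1 - X)\<close>, and \<open>1 - (1 - X) = X\<close>.\<close>
    proof (rule that[of 3 "(0, [])" "(2, [(False, 1)])" "(2, [(False, 2)])" "(2, [(True, 3)])" "1\<^sub>m 2" "1 / 2" "- 1 / 4"])
      show "dim_row C = 2 ^ 3" by (simp add: CCX c3 c1)
      fix qs :: "nat list" and \<psi> X assume "distinct qs" "length qs = 3"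
      then obtain a b c where qs: "qs = [a, b, c]" "distinct [a, b, c]" using len3 by blast
      then have bc: "b \<noteq> c" by simp
      have e: "gate_amp [c] gate_X \<psi> X = \<psi> (X \<triangle> {c})"
        by (cases "c \<in> X") (simp_all add: gate_amp_single gate_X_def entry_mat2)
      show "gate_amp qs C \<psi> X = 1 / 2 * run_stage qs (0, []) \<psi> X +
        - 1 / 4 * gate_amp [qs ! (3 - 1)] (1\<^sub>m 2)
          (run_stage qs (2, [(True, 3)]) (run_stage qs (2, [(False, 2)]) (run_stage qs (2, [(False, 1)]) \<psi>))) X"
        using qs(2)
        unfolding id qs(1) CCX amp3[OF qs(2) c1[OF gate_X_carrier]] amp2[OF bc gate_X_carrier] e
        by (cases "a \<in> X"; cases "b \<in> X") (simp_all add: stage_simps diff_divide_distrib)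
    qed (simp_all add: valid_stage_def one_local_clifford)
  next
    case CSWAP
    show thesis
    \<comment> \<open>\<open>(1 - Z_b Z_c) (1 - X_b X_c)\<close> is four times the projection onto
      the singlet, and the swap is 1 minus twice this projection. The control contributes another
      factor 2.\<close>
    proof (rule that[of 3 "(0, [])" "(2, [(False, 1)])" "(2, [(False, 2), (False, 3)])"
          "(2, [(True, 2), (True, 3)])" "1\<^sub>m 2" "1 / 2" "- 1 / 4"])
      show "dim_row C = 2 ^ 3" by (simp add: CSWAP c3 SW)
      fix qs :: "nat list" and \<psi> X assume "distinct qs" "length qs = 3"
      then obtain a b c where qs: "qs = [a, b, c]" "distinct [a, b, c]" using len3 by blast
      then have bc: "b \<noteq> c" by simp
      have e: "(X \<triangle> {c}) \<triangle> {b} = (X \<triangle> {c}) \<triangle> {b}" ..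
      show "gate_amp qs C \<psi> X = 1 / 2 * run_stage qs (0, []) \<psi> X +
        - 1 / 4 * gate_amp [qs ! (3 - 1)] (1\<^sub>m 2)
          (run_stage qs (2, [(True, 2), (True, 3)]) (run_stage qs (2, [(False, 2), (False, 3)])
            (run_stage qs (2, [(False, 1)]) \<psi>))) X"
        using qs(2) unfolding id qs(1) CSWAP amp3[OF qs(2) SW] gate_amp_SWAP[OF bc]
        by (cases "a \<in> X"; cases "b \<in> X"; cases "c \<in> X") (simp_all add: stage_simps diff_divide_distrib)
    qed (simp_all add: valid_stage_def one_local_clifford)
  qed
qed

section \<open>Reasoning about programs\<close>

inductive_simps exec_simps:
  "exec Skip s t s'" "exec (Const x k) s t s'" "exec (Copy x y) s t s'" "exec (Incr x) s t s'"
  "exec (Decr x) s t s'" "exec (Load x a y) s t s'" "exec (Store a x y) s t s'"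
  "exec (Seq p q) s t s'" "exec (If_less x y p q) s t s'"

text \<open>Total correctness with running time: a halting run exists, and the postcondition may
  speak about its exact number of steps.\<close>

definition wp :: "program \<Rightarrow> (nat \<Rightarrow> memory \<Rightarrow> bool) \<Rightarrow> memory \<Rightarrow> bool" where
  "wp p Q s \<longleftrightarrow> (\<exists>t s'. exec p s t s' \<and> Q t s')"

lemma wpI: "exec p s t s' \<Longrightarrow> Q t s' \<Longrightarrow> wp p Q s"
  by (auto simp: wp_def)

lemma wpE:
  assumes "wp p Q s"
  obtains t s' where "exec p s t s'" "Q t s'"
  using assms by (auto simp: wp_def)

lemma wp_mono: "wp p Q s \<Longrightarrow> (\<And>t s'. Q t s' \<Longrightarrow> R t s') \<Longrightarrow> wp p R s"
  by (auto simp: wp_def)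

lemma wp_SeqI: "exec p s t s' \<Longrightarrow> wp q (\<lambda>t'. Q (t + t')) s' \<Longrightarrow> wp (Seq p q) Q s"
  unfolding wp_def by (blast intro: exec.Seq)

lemma wp_simps [simp]:
  "wp Skip Q s \<longleftrightarrow> Q 1 s"
  "wp (Const x k) Q s \<longleftrightarrow> Q 1 (s\<lparr>reg := (reg s)(x := k)\<rparr>)"
  "wp (Copy x y) Q s \<longleftrightarrow> Q 1 (s\<lparr>reg := (reg s)(x := reg s y)\<rparr>)"
  "wp (Incr x) Q s \<longleftrightarrow> Q 1 (s\<lparr>reg := (reg s)(x := reg s x + 1)\<rparr>)"
  "wp (Load x a y) Q s \<longleftrightarrow> Q 1 (s\<lparr>reg := (reg s)(x := arr s a (reg s y))\<rparr>)"
  "wp (Store a x y) Q s \<longleftrightarrow> Q 1 (s\<lparr>arr := (arr s)(a := (arr s a)(reg s x := reg s y))\<rparr>)"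
  "wp (Seq p q) Q s \<longleftrightarrow> wp p (\<lambda>t s'. wp q (\<lambda>t'. Q (t + t')) s') s"
  "wp (If_less x y p q) Q s \<longleftrightarrow>
     (if reg s x < reg s y then wp p (\<lambda>t. Q (Suc t)) s else wp q (\<lambda>t. Q (Suc t)) s)"
  by (auto simp: wp_def exec_simps) blast+

text \<open>\<open>j\<close> is a ghost counter that the invariant ties to the memory; the
  equivalence for the guard fixes the number of iterations. Each iteration pays one extra step for
  its guard, and the leading 1 is the failing guard.\<close>

lemma wp_while:
  assumes "I lo s" "lo \<le> hi"
    and guard: "\<And>j s. I j s \<Longrightarrow> lo \<le> j \<Longrightarrow> j \<le> hi \<Longrightarrow> reg s x < reg s y \<longleftrightarrow> j < hi"
    and body: "\<And>j s. I j s \<Longrightarrow> lo \<le> j \<Longrightarrow> j < hi \<Longrightarrow> wp p (\<lambda>t s'. t \<le> c j \<and> I (Suc j) s') s"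
  shows "wp (While_less x y p) (\<lambda>t s'. t \<le> 1 + (\<Sum>j = lo..<hi. Suc (c j)) \<and> I hi s') s"
proof -
  have "wp (While_less x y p) (\<lambda>t s'. t \<le> 1 + (\<Sum>j = i..<hi. Suc (c j)) \<and> I hi s') s"
    if "I i s" "lo \<le> i" "i \<le> hi" for i s
    using that
  proof (induction "hi - i" arbitrary: i s)
    case 0
    then have "i = hi" by simp
    then show ?case using guard[of i s] 0 by (intro wpI[OF exec.While_false]) auto
  next
    case (Suc d)
    then have i: "i < hi" by simp
    obtain t s' where 1: "exec p s t s'" "t \<le> c i" "I (Suc i) s'"
      using body[OF Suc.prems(1,2) i] by (auto elim: wpE)
    obtain t' s'' where 2: "exec (While_less x y p) s' t' s''"
      "t' \<le> 1 + (\<Sum>j = Suc i..<hi. Suc (c j))" "I hi s''"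
    proof -
      have "d = hi - Suc i" using Suc.hyps(2) by simp
      then show thesis
        using Suc.hyps(1)[of "Suc i" s'] Suc.prems 1 i that by (auto elim: wpE)
    qed
    have "reg s x < reg s y" using guard[of i s] Suc.prems i by simp
    then show ?case
      using 1 2 i by (intro wpI[OF exec.While_true[OF _ 1(1) 2(1)]]) (auto simp: sum.atLeast_Suc_lessThan)
  qed
  from this[of lo s] assms(1,2) show ?thesis by simp
qed

lemma wp_while_const:
  assumes "I lo s" "lo \<le> hi"
    and "\<And>j s. I j s \<Longrightarrow> lo \<le> j \<Longrightarrow> j \<le> hi \<Longrightarrow> reg s x < reg s y \<longleftrightarrow> j < hi"
    and "\<And>j s. I j s \<Longrightarrow> lo \<le> j \<Longrightarrow> j < hi \<Longrightarrow> wp p (\<lambda>t s'. t \<le> c \<and> I (Suc j) s') s"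
  shows "wp (While_less x y p) (\<lambda>t s'. t \<le> 1 + Suc c * (hi - lo) \<and> I hi s') s"
  using wp_while[of I, OF assms] by (simp add: mult.commute)

definition unchanged :: "nat set \<Rightarrow> nat set \<Rightarrow> memory \<Rightarrow> memory \<Rightarrow> bool" where
  "unchanged R A s s' \<longleftrightarrow> (\<forall>r. r \<notin> R \<longrightarrow> reg s' r = reg s r) \<and> (\<forall>a. a \<notin> A \<longrightarrow> arr s' a = arr s a)"

lemma unchangedD:
  assumes "unchanged R A s s'"
  shows "r \<notin> R \<Longrightarrow> reg s' r = reg s r" "a \<notin> A \<Longrightarrow> arr s' a = arr s a"
  using assms by (auto simp: unchanged_def)

lemma unchanged_refl: "unchanged R A s s"
  by (simp add: unchanged_def)

lemma unchanged_trans: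
  "unchanged R A s s' \<Longrightarrow> unchanged R' A' s' s'' \<Longrightarrow> unchanged (R \<union> R') (A \<union> A') s s''"
  by (auto simp: unchanged_def)

text \<open>Registers 0 to 3 hold the input. The others: scratch (\<open>rS\<close>, \<open>rX\<close>, \<open>rY\<close>, \<open>rC\<close>, \<open>rG\<close>), the
  constant 1 (\<open>rOne\<close>), the exponent \<open>k\<close> (\<open>rK\<close>), the length of the list of candidates (\<open>rL\<close>), the
  current index and end of a segment (\<open>rI\<close>, \<open>rH\<close>), the cardinality of \<open>B\<close> (\<open>rB\<close>), the pivot and its
  degree (\<open>rW\<close>, \<open>rD\<close>), the current vertex with its class and the end of the loop over the vertices
  (\<open>rV\<close>, \<open>rInB\<close>, \<open>rMark\<close>, \<open>rE\<close>), whether a pivot is used (\<open>rP\<close>), the output position (\<open>rO\<close>), and a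
  qubit or an index into the list of \<open>B\<close> (\<open>rQ\<close>). The arrays hold parities, candidates, the list and the
  indicator of \<open>B\<close>, and the marks of the closed neighbourhood of the pivot; slots 3 and 4 of
  states are used for intermediate results.\<close>
abbreviation (input) "rS \<equiv> 4 :: nat"
abbreviation (input) "rOne \<equiv> 5 :: nat"
abbreviation (input) "rK \<equiv> 6 :: nat"
abbreviation (input) "rL \<equiv> 7 :: nat"
abbreviation (input) "rI \<equiv> 8 :: nat"
abbreviation (input) "rH \<equiv> 9 :: nat"
abbreviation (input) "rX \<equiv> 10 :: nat"
abbreviation (input) "rY \<equiv> 11 :: nat"
abbreviation (input) "rB \<equiv> 12 :: nat"
abbreviation (input) "rW \<equiv> 13 :: nat"
abbreviation (input) "rD \<equiv> 14 :: nat"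
abbreviation (input) "rV \<equiv> 15 :: nat"
abbreviation (input) "rInB \<equiv> 16 :: nat"
abbreviation (input) "rMark \<equiv> 17 :: nat"
abbreviation (input) "rP \<equiv> 18 :: nat"
abbreviation (input) "rO \<equiv> 19 :: nat"
abbreviation (input) "rC \<equiv> 20 :: nat"
abbreviation (input) "rG \<equiv> 21 :: nat"
abbreviation (input) "rQ \<equiv> 22 :: nat"
abbreviation (input) "rE \<equiv> 23 :: nat"

abbreviation (input) "PAR \<equiv> 15 :: nat"
abbreviation (input) "TMP \<equiv> 16 :: nat"
abbreviation (input) "BL \<equiv> 17 :: nat"
abbreviation (input) "INB \<equiv> 18 :: nat"
abbreviation (input) "MK \<equiv> 19 :: nat"

section \<open>Sequences of programs and case distinctions on small numbers\<close>

fun seqs :: "program list \<Rightarrow> program" where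
  "seqs [] = Skip"
| "seqs [p] = p"
| "seqs (p # q # ps) = Seq p (seqs (q # ps))"

text \<open>The machine compares registers only, so a case distinction loads the candidate values
  \<open>m - 1\<close>, \<open>m - 2\<close>, ... in turn. Branches are program text; a table over
  all local Clifford operations thus costs a time that depends on \<open>N\<close> but not on the
  input.\<close>

fun switch :: "nat \<Rightarrow> nat \<Rightarrow> (nat \<Rightarrow> program) \<Rightarrow> program" where
  "switch y 0 f = Skip"
| "switch y (Suc m) f = Seq (Const rS m) (If_less y rS (switch y m f) (f m))"

lemma exec_switch:
  assumes "reg s y < m" "y \<noteq> rS"
  shows "\<exists>c z. c \<le> 2 * m \<and> (\<forall>t s'. exec (f (reg s y)) (s\<lparr>reg := (reg s)(rS := z)\<rparr>) t s' \<longrightarrow>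
    exec (switch y m f) s (c + t) s')"
  using assms(1)
proof (induction m arbitrary: s)
  case (Suc m)
  let ?s = "s\<lparr>reg := (reg s)(rS := m)\<rparr>"
  show ?case
  proof (cases "reg s y < m")
    case True
    have eq: "?s\<lparr>reg := (reg ?s)(rS := z)\<rparr> = s\<lparr>reg := (reg s)(rS := z)\<rparr>" "reg ?s y = reg s y" for z
      using assms(2) by simp_all
    obtain c z where cz: "c \<le> 2 * m" "\<And>t s'. exec (f (reg s y)) (s\<lparr>reg := (reg s)(rS := z)\<rparr>) t s' \<Longrightarrow>
      exec (switch y m f) ?s (c + t) s'"
      using Suc.IH[of ?s] True unfolding eq by blast
    have "exec (switch y (Suc m) f) s (2 + c + t) s'"
      if "exec (f (reg s y)) (s\<lparr>reg := (reg s)(rS := z)\<rparr>) t s'" for t s'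
    proof -
      have "exec (switch y m f) ?s (c + t) s'" using cz(2) that assms(2) by simp
      moreover have "reg ?s y < reg ?s rS" using True assms(2) by simp
      ultimately have "exec (If_less y rS (switch y m f) (f m)) ?s (1 + (c + t)) s'"
        by (intro exec.If_true)
      then show ?thesis using exec.Seq[OF exec.Const] by fastforce
    qed
    moreover have "2 + c \<le> 2 * Suc m" using cz(1) by simp
    ultimately show ?thesis by blast
  next
    case False
    then have "reg s y = m" using Suc.prems by simp
    have "exec (switch y (Suc m) f) s (2 + t) s'"
      if "exec (f (reg s y)) (s\<lparr>reg := (reg s)(rS := m)\<rparr>) t s'" for t s'
    proof -
      have "\<not> reg ?s y < reg ?s rS" using False assms(2) by simp
      then have "exec (If_less y rS (switch y m f) (f m)) ?s (1 + t) s'"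
        using that \<open>reg s y = m\<close> by (intro exec.If_false) simp_all
      then show ?thesis using exec.Seq[OF exec.Const] by fastforce
    qed
    moreover have "2 \<le> 2 * Suc m" by simp
    ultimately show ?thesis unfolding \<open>reg s y = m\<close> by blast
  qed
qed simp

text \<open>How long the selection takes and what it leaves in \<open>rS\<close> depend on the value
  found. Branches are therefore verified for all \<open>z\<close> and for all selection costs up to
  \<open>2 * m\<close>.\<close>

lemma wp_switch:
  assumes "reg s y < m" "y \<noteq> rS"
    and "\<And>z. wp (f (reg s y)) (\<lambda>t s'. \<forall>c\<le>2 * m. Q (c + t) s') (s\<lparr>reg := (reg s)(rS := z)\<rparr>)"
  shows "wp (switch y m f) Q s"
proof -
  obtain c z where "c \<le> 2 * m" and cz: "\<And>t s'. exec (f (reg s y)) (s\<lparr>reg := (reg s)(rS := z)\<rparr>) t s' \<Longrightarrow>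
    exec (switch y m f) s (c + t) s'"
    using exec_switch[OF assms(1,2), of f] by blast
  moreover obtain t s' where "exec (f (reg s y)) (s\<lparr>reg := (reg s)(rS := z)\<rparr>) t s'"
    "\<forall>c\<le>2 * m. Q (c + t) s'"
    using assms(3)[of z] by (rule wpE)
  ultimately show ?thesis by (intro wpI[of _ _ "c + t" s']) auto
qed

subsection \<open>Sets with parity\<close>

text \<open>The set \<open>D\<close> is given by its indicator array; the first \<open>rL\<close> entries of the array \<open>TMP\<close>
  contain all its elements, but possibly other numbers and repetitions.\<close>
definition holds_set :: "nat \<Rightarrow> memory \<Rightarrow> nat set \<Rightarrow> bool" where
  "holds_set n s D \<longleftrightarrow> D \<subseteq> arr s TMP ` {..<reg s rL} \<and> arr s TMP ` {..<reg s rL} \<subseteq> {..n} \<and>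
     (\<forall>x\<le>n. arr s PAR x = of_bool (x \<in> D))"

lemma holds_set_cong:
  assumes "holds_set n s D" "unchanged R A s s'" "rL \<notin> R" "TMP \<notin> A" "PAR \<notin> A"
  shows "holds_set n s' D"
  using assms by (simp add: holds_set_def unchanged_def)

text \<open>The element is appended even if it is already listed or has just left the set. Cleaning
  up is deferred to \<open>emit\<close>, which keeps a toggle at constant time.\<close>

definition toggle :: program where
  "toggle = seqs [Load rY PAR rX, Const rS 1,
     If_less rY rS (Store PAR rX rS) (Seq (Const rS 0) (Store PAR rX rS)),
     Store TMP rL rX, Incr rL]"

lemma wp_toggle:
  assumes "holds_set n s D" "reg s rX \<le> n"
  shows "wp toggle (\<lambda>t s'. t \<le> 7 \<and> holds_set n s' (D \<triangle> {reg s rX}) \<and> reg s' rL = Suc (reg s rL) \<and>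
    unchanged {rS, rL, rY} {PAR, TMP} s s') s"
proof -
  let ?x = "reg s rX" and ?l = "reg s rL"
  have TMP: "(arr s TMP)(?l := ?x) ` {..<Suc ?l} = insert ?x (arr s TMP ` {..<?l})"
    by (auto simp: lessThan_Suc)
  have x: "arr s PAR ?x = of_bool (?x \<in> D)" using assms by (simp add: holds_set_def)
  have le: "arr s TMP j \<le> n" if "j < Suc ?l" "j \<noteq> ?l" for j
  proof -
    have "arr s TMP j \<in> arr s TMP ` {..<?l}" using that by simp
    then show ?thesis using assms(1) by (auto simp only: holds_set_def)
  qed
  show ?thesis
    using assms unfolding toggle_def
    by (auto simp: x le holds_set_def TMP unchanged_def)
qed

lemma sdiff_insert: "x \<notin> A \<Longrightarrow> (D \<triangle> A) \<triangle> {x} = D \<triangle> insert x A"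
  by blast

definition toggle_segment :: "nat \<Rightarrow> program" where
  "toggle_segment a = While_less rI rH (seqs [Load rX a rI, toggle, Incr rI])"

text \<open>A repeated entry would be toggled back. Injectivity of the segment makes the successive
  toggles a symmetric difference with its image.\<close>

lemma wp_toggle_segment:
  assumes acc: "holds_set n s D" and "reg s rI = lo" "reg s rH = hi" "lo \<le> hi"
    and inj: "inj_on (arr s a) {lo..<hi}" and le: "arr s a ` {lo..<hi} \<subseteq> {..n}"
    and a: "a \<notin> {PAR, TMP}"
  shows "wp (toggle_segment a) (\<lambda>t s'. t \<le> 1 + 10 * (hi - lo) \<and>
    holds_set n s' (D \<triangle> arr s a ` {lo..<hi}) \<and> reg s' rL = reg s rL + (hi - lo) \<and>
    unchanged {rS, rL, rI, rX, rY} {PAR, TMP} s s') s"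
proof -
  let ?I = "\<lambda>j s'. holds_set n s' (D \<triangle> arr s a ` {lo..<j}) \<and> reg s' rL = reg s rL + (j - lo) \<and>
    reg s' rI = j \<and> unchanged {rS, rL, rI, rX, rY} {PAR, TMP} s s'"
  have "wp (toggle_segment a) (\<lambda>t s'. t \<le> 1 + Suc 9 * (hi - lo) \<and> ?I hi s') s"
    unfolding toggle_segment_def
  proof (rule wp_while_const[where I = ?I and lo = lo and hi = hi])
    show "?I lo s" using assms by (simp add: unchanged_refl)
  next
    fix j s' assume "?I j s'"
    then show "reg s' rI < reg s' rH \<longleftrightarrow> j < hi" using assms(3) by (simp add: unchanged_def)
  next
    fix j s1 assume I: "?I j s1" and j: "lo \<le> j" "j < hi"
    have same: "arr s1 a = arr s a" using I a by (simp add: unchanged_def)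
    let ?s2 = "s1\<lparr>reg := (reg s1)(rX := arr s a j)\<rparr>"
    have e2: "exec (Load rX a rI) s1 1 ?s2"
      using exec.Load[of rX a rI s1] I same by simp
    have "holds_set n s1 (D \<triangle> arr s a ` {lo..<j})" using I by blast
    then have "holds_set n ?s2 (D \<triangle> arr s a ` {lo..<j})"
      by (rule holds_set_cong[of _ _ _ "{rX}" "{}"]) (simp_all add: unchanged_def)
    moreover have "reg ?s2 rX \<le> n"
    proof -
      have "arr s a j \<in> arr s a ` {lo..<hi}" using j by simp
      then show ?thesis using le by auto
    qed
    ultimately have "wp toggle (\<lambda>t s'. t \<le> 7 \<and> holds_set n s' ((D \<triangle> arr s a ` {lo..<j}) \<triangle> {reg ?s2 rX}) \<and>
      reg s' rL = Suc (reg ?s2 rL) \<and> unchanged {rS, rL, rY} {PAR, TMP} ?s2 s') ?s2"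
      by (rule wp_toggle)
    then obtain t3 s3 where e3: "exec toggle ?s2 t3 s3" and r3: "t3 \<le> 7 \<and>
      holds_set n s3 ((D \<triangle> arr s a ` {lo..<j}) \<triangle> {reg ?s2 rX}) \<and>
      reg s3 rL = Suc (reg ?s2 rL) \<and> unchanged {rS, rL, rY} {PAR, TMP} ?s2 s3"
      by (rule wpE)
    have "arr s a j \<notin> arr s a ` {lo..<j}"
    proof
      assume "arr s a j \<in> arr s a ` {lo..<j}"
      then obtain x where "x \<in> {lo..<j}" "arr s a j = arr s a x" by (rule imageE)
      then show False using inj_onD[OF inj, of j x] j by simp
    qed
    then have "(D \<triangle> arr s a ` {lo..<j}) \<triangle> {arr s a j} = D \<triangle> insert (arr s a j) (arr s a ` {lo..<j})"
      by (rule sdiff_insert)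
    also have "insert (arr s a j) (arr s a ` {lo..<j}) = arr s a ` {lo..<Suc j}"
      using j by (simp add: atLeastLessThanSuc)
    finally have D: "holds_set n s3 (D \<triangle> arr s a ` {lo..<Suc j})" using r3 by simp
    have u: "unchanged {rS, rL, rI, rX, rY} {PAR, TMP} s s3" "reg s3 rI = j"
      using r3 I by (simp_all add: unchanged_def)
    have "holds_set n (s3\<lparr>reg := (reg s3)(rI := Suc j)\<rparr>) (D \<triangle> arr s a ` {lo..<Suc j})"
      by (rule holds_set_cong[OF D, of "{rI}" "{}"]) (simp_all add: unchanged_def)
    moreover have "reg s3 rL = reg s rL + (Suc j - lo)" using r3 I j by simp
    moreover have "unchanged {rS, rL, rI, rX, rY} {PAR, TMP} s (s3\<lparr>reg := (reg s3)(rI := Suc j)\<rparr>)"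
      using u(1) by (simp add: unchanged_def)
    ultimately have "wp (Incr rI) (\<lambda>t' s'. 1 + (t3 + t') \<le> 9 \<and> ?I (Suc j) s') s3"
      using r3 u(2) by simp
    then show "wp (seqs [Load rX a rI, toggle, Incr rI]) (\<lambda>t s'. t \<le> 9 \<and> ?I (Suc j) s') s1"
      unfolding seqs.simps
      by (intro wp_SeqI[OF e2] wp_SeqI[OF e3])
  qed (use assms in auto)
  then show ?thesis by (rule wp_mono) auto
qed

text \<open>Resetting the parity of an element when it is written suppresses its later repetitions
  in the list. It also leaves the parities all zero, so that the next vertex starts from the empty
  set without a pass over all \<open>n\<close> entries.\<close>

definition emit :: "nat \<Rightarrow> program" where
  "emit a = seqs [Const rI 0,
     While_less rI rL (seqs [Load rX TMP rI, Load rY PAR rX, Const rS 0,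
       If_less rS rY (seqs [Store PAR rX rS, Store a rO rX, Incr rO]) Skip, Incr rI]),
     Const rL 0]"

lemma wp_emit:
  assumes acc: "holds_set n s D" and a: "a \<notin> {PAR, TMP}"
  shows "wp (emit a) (\<lambda>t s'. t \<le> 3 + 10 * reg s rL \<and> holds_set n s' {} \<and> reg s' rL = 0 \<and>
    reg s rO \<le> reg s' rO \<and> bij_betw (arr s' a) {reg s rO..<reg s' rO} D \<and>
    (\<forall>p<reg s rO. arr s' a p = arr s a p) \<and>
    unchanged {rS, rL, rI, rX, rY, rO} {PAR, a} s s') s"
proof -
  let ?l = "reg s rL" and ?o = "reg s rO"
  define P where "P j = arr s TMP ` {..<j}" for j
  let ?I = "\<lambda>j s'. (\<forall>x\<le>n. arr s' PAR x = of_bool (x \<in> D - P j)) \<and> reg s' rI = j \<and>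
    ?o \<le> reg s' rO \<and> bij_betw (arr s' a) {?o..<reg s' rO} (D \<inter> P j) \<and>
    (\<forall>p<?o. arr s' a p = arr s a p) \<and> unchanged {rS, rI, rX, rY, rO} {PAR, a} s s'"
  let ?s1 = "s\<lparr>reg := (reg s)(rI := 0)\<rparr>"
  let ?b = "seqs [Load rX TMP rI, Load rY PAR rX, Const rS 0,
       If_less rS rY (seqs [Store PAR rX rS, Store a rO rX, Incr rO]) Skip, Incr rI]"
  have "wp (While_less rI rL ?b) (\<lambda>t s'. t \<le> 1 + Suc 8 * (?l - 0) \<and> ?I ?l s') ?s1"
  proof (rule wp_while_const[where I = ?I and lo = 0 and hi = ?l])
    show "?I 0 ?s1" using acc by (simp add: holds_set_def P_def unchanged_def bij_betw_def)
  next
    fix j s' assume "?I j s'"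
    then show "reg s' rI < reg s' rL \<longleftrightarrow> j < ?l" by (simp add: unchanged_def)
  next
    fix j s1 assume I: "?I j s1" and j: "j < ?l"
    let ?x = "arr s TMP j"
    have x: "?x \<le> n" using acc j by (auto simp: holds_set_def)
    have T: "arr s1 TMP = arr s TMP" using I a by (simp add: unchanged_def)
    have P: "P (Suc j) = insert ?x (P j)" by (simp add: P_def lessThan_Suc)
    have o: "?o \<le> reg s1 rO" using I by simp
    have par: "arr s1 PAR ?x = of_bool (?x \<in> D - P j)" using I x by simp
    have a': "a \<noteq> PAR" "a \<noteq> TMP" using a by auto
    show "wp ?b (\<lambda>t s'. t \<le> 8 \<and> ?I (Suc j) s') s1"
    proof (cases "?x \<in> D - P j")
      case True
      have "bij_betw ((arr s1 a)(reg s1 rO := ?x)) {?o..<Suc (reg s1 rO)} (D \<inter> P (Suc j))"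
      proof -
        have eq: "{?o..<Suc (reg s1 rO)} = insert (reg s1 rO) {?o..<reg s1 rO}" using o by auto
        have "bij_betw ((arr s1 a)(reg s1 rO := ?x)) {?o..<reg s1 rO} (D \<inter> P j)"
          using I by (subst bij_betw_cong[where g = "arr s1 a"]) auto
        then have "bij_betw ((arr s1 a)(reg s1 rO := ?x)) (insert (reg s1 rO) {?o..<reg s1 rO})
            (insert ?x (D \<inter> P j))"
          using True notIn_Un_bij_betw[of "reg s1 rO" "{?o..<reg s1 rO}"
            "(arr s1 a)(reg s1 rO := ?x)" "D \<inter> P j"] by simp
        moreover have "insert ?x (D \<inter> P j) = D \<inter> P (Suc j)" using True P by auto
        ultimately show ?thesis unfolding eq by simp
      qed
      then show ?thesis using I True par a' o x
        by (auto simp: T P unchanged_def)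
    next
      case False
      then have "D \<inter> P (Suc j) = D \<inter> P j" "D - P (Suc j) = D - P j" using P by auto
      then show ?thesis using I False par by (auto simp: T unchanged_def)
    qed
  qed auto
  then obtain t2 s2 where e2: "exec (While_less rI rL ?b) ?s1 t2 s2" "t2 \<le> 1 + 9 * ?l" "?I ?l s2"
    by (auto elim!: wpE)
  have D: "D - P ?l = {}" "D \<inter> P ?l = D" using acc by (auto simp: holds_set_def P_def)
  have "exec (Const rI 0) s 1 ?s1" by (rule exec.Const)
  then show ?thesis
    unfolding emit_def seqs.simps using e2 unfolding D
    by (intro wp_SeqI[OF \<open>exec (Const rI 0) s 1 ?s1\<close>] wp_SeqI[OF e2(1)[unfolded seqs.simps]])
      (auto simp: holds_set_def unchanged_def)
qed

definition mark_segment :: "nat \<Rightarrow> nat \<Rightarrow> program" where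
  "mark_segment a d = While_less rI rH (seqs [Load rX a rI, Store d rX rOne, Incr rI])"

lemma wp_mark_segment:
  assumes "reg s rI = lo" "reg s rH = hi" "lo \<le> hi" "a \<noteq> d"
  shows "wp (mark_segment a d) (\<lambda>t s'. t \<le> 1 + 4 * (hi - lo) \<and>
    (\<forall>x. arr s' d x = (if x \<in> arr s a ` {lo..<hi} then reg s rOne else arr s d x)) \<and>
    unchanged {rI, rX} {d} s s') s"
proof -
  let ?I = "\<lambda>j s'. (\<forall>x. arr s' d x = (if x \<in> arr s a ` {lo..<j} then reg s rOne else arr s d x)) \<and>
    reg s' rI = j \<and> unchanged {rI, rX} {d} s s'"
  have "wp (mark_segment a d) (\<lambda>t s'. t \<le> 1 + Suc 3 * (hi - lo) \<and> ?I hi s') s"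
    unfolding mark_segment_def
  proof (rule wp_while_const[where I = ?I and lo = lo and hi = hi])
    show "?I lo s" using assms by (simp add: unchanged_refl)
  next
    fix j s' assume "?I j s'"
    then show "reg s' rI < reg s' rH \<longleftrightarrow> j < hi" using assms(2) by (simp add: unchanged_def)
  next
    fix j s1 assume I: "?I j s1" and j: "lo \<le> j" "j < hi"
    have "arr s1 a = arr s a" using I assms(4) by (simp add: unchanged_def)
    moreover have "{lo..<Suc j} = insert j {lo..<j}" using j by auto
    ultimately show "wp (seqs [Load rX a rI, Store d rX rOne, Incr rI]) (\<lambda>t s'. t \<le> 3 \<and> ?I (Suc j) s') s1"
      using I by (auto simp: unchanged_def)
  qed (use assms in auto)
  then show ?thesis by (rule wp_mono) auto
qed

text \<open>Needed because the memory beyond the input is arbitrary. The lists \<open>TMP\<close>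
  and \<open>BL\<close> are read only below their recorded lengths.\<close>

definition clear :: program where
  "clear = seqs [Const rI 0, Copy rH 0, Incr rH, Const rS 0,
     While_less rI rH (seqs [Store PAR rI rS, Store INB rI rS, Store MK rI rS, Incr rI]),
     Const rL 0, Const rO 0, Const rOne 1]"

lemma wp_clear:
  assumes "reg s 0 = n"
  shows "wp clear (\<lambda>t s'. t \<le> 20 + 5 * n \<and> holds_set n s' {} \<and> reg s' rL = 0 \<and> reg s' rO = 0 \<and>
    reg s' rOne = 1 \<and> (\<forall>x\<le>n. arr s' INB x = 0 \<and> arr s' MK x = 0) \<and>
    unchanged {rI, rH, rS, rL, rO, rOne} {PAR, INB, MK} s s') s"
proof -
  let ?s1 = "s\<lparr>reg := (reg s)(rI := 0, rH := Suc n, rS := 0)\<rparr>"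
  let ?I = "\<lambda>j s'. (\<forall>x<j. arr s' PAR x = 0 \<and> arr s' INB x = 0 \<and> arr s' MK x = 0) \<and>
    reg s' rI = j \<and> unchanged {rI} {PAR, INB, MK} ?s1 s'"
  let ?b = "seqs [Store PAR rI rS, Store INB rI rS, Store MK rI rS, Incr rI]"
  have "wp (While_less rI rH ?b) (\<lambda>t s'. t \<le> 1 + Suc 4 * (Suc n - 0) \<and> ?I (Suc n) s') ?s1"
  proof (rule wp_while_const[where I = ?I and lo = 0 and hi = "Suc n"])
    show "?I 0 ?s1" by (simp add: unchanged_refl)
  next
    fix j s1 assume I: "?I j s1"
    then show "wp ?b (\<lambda>t s'. t \<le> 4 \<and> ?I (Suc j) s') s1"
      by (auto simp: unchanged_def less_Suc_eq)
  qed (auto simp: unchanged_def)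
  then have "wp (While_less rI rH ?b) (\<lambda>t s'. 4 + (t + 3) \<le> 20 + 5 * n \<and> ?I (Suc n) s') ?s1"
    by (rule wp_mono) auto
  then show ?thesis unfolding clear_def using assms
    by (simp add: fun_upd_twist) (erule wp_mono, auto simp: holds_set_def unchanged_def less_Suc_eq_le)
qed

section \<open>The program\<close>

lemma stores_stateD:
  assumes "stores_state N cl i s n E u" "v \<in> {1..n}"
  shows "arr s (3 * i) v \<le> arr s (3 * i) (Suc v)"
    "bij_betw (arr s (3 * i + 1)) {arr s (3 * i) v..<arr s (3 * i) (Suc v)} (nbhd E v)"
    "arr s (3 * i + 2) v < N" "cl (arr s (3 * i + 2) v) = u v"
  using assms by (auto simp: stores_state_def Let_def)

lemma stores_state_cong:
  assumes "stores_state N cl i s n E u" "unchanged R A s s'" "{3 * i, 3 * i + 1, 3 * i + 2} \<inter> A = {}"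
  shows "stores_state N cl i s' n E u"
  using assms by (simp add: stores_state_def unchanged_def)

section \<open>Traversing stored neighbour lists and tracking Pauli operators\<close>

definition set_segment :: "nat \<Rightarrow> nat \<Rightarrow> program" where
  "set_segment i v = seqs [Load rI (3 * i) v, Copy rH v, Incr rH, Load rH (3 * i) rH]"

lemma wp_set_segment:
  assumes "v \<notin> {rI, rH}"
  shows "wp (set_segment i v) (\<lambda>t s'. t = 4 \<and> reg s' rI = arr s (3 * i) (reg s v) \<and>
    reg s' rH = arr s (3 * i) (Suc (reg s v)) \<and> unchanged {rI, rH} {} s s') s"
  using assms by (simp add: set_segment_def unchanged_def)

definition toggle_nbhd :: "nat \<Rightarrow> nat \<Rightarrow> program" where
  "toggle_nbhd i v = Seq (set_segment i v) (toggle_segment (3 * i + 1))"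

definition toggle_vertex :: "nat \<Rightarrow> program" where
  "toggle_vertex v = Seq (Copy rX v) toggle"

lemma nbhd_finite: "simple_graph n E \<Longrightarrow> finite (nbhd E v)"
  by (rule finite_subset[OF nbhd_le]) auto

lemma wp_toggle_nbhd:
  assumes st: "stores_state N cl i s n E u" and E: "simple_graph n E" and i: "i \<le> 4"
    and v: "reg s v \<in> {1..n}" "v \<notin> {rI, rH}" and D: "holds_set n s D"
  shows "wp (toggle_nbhd i v) (\<lambda>t s'. t \<le> 5 + 10 * card (nbhd E (reg s v)) \<and>
    holds_set n s' (D \<triangle> nbhd E (reg s v)) \<and> reg s' rL = reg s rL + card (nbhd E (reg s v)) \<and>
    unchanged {rS, rL, rI, rH, rX, rY} {PAR, TMP} s s') s"
proof -
  let ?lo = "arr s (3 * i) (reg s v)" and ?hi = "arr s (3 * i) (Suc (reg s v))" and ?a = "3 * i + 1"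
  obtain t1 s1 where e1: "exec (set_segment i v) s t1 s1" and r1: "t1 = 4 \<and> reg s1 rI = ?lo \<and>
    reg s1 rH = ?hi \<and> unchanged {rI, rH} {} s s1"
    by (rule wpE[OF wp_set_segment[OF v(2)]])
  have bij: "bij_betw (arr s ?a) {?lo..<?hi} (nbhd E (reg s v))" and le: "?lo \<le> ?hi"
    using stores_stateD[OF st v(1)] by simp_all
  then have card: "card (nbhd E (reg s v)) = ?hi - ?lo" using bij_betw_same_card[OF bij] by simp
  have same: "arr s1 ?a = arr s ?a" using r1 by (simp add: unchanged_def)
  have im: "arr s ?a ` {?lo..<?hi} = nbhd E (reg s v)" using bij by (simp add: bij_betw_def)
  have sub: "nbhd E (reg s v) \<subseteq> {..n}" using nbhd_le[OF E, of "reg s v"] by auto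
  have D1: "holds_set n s1 D" by (rule holds_set_cong[OF D, of "{rI, rH}" "{}"]) (use r1 in simp_all)
  have L: "reg s1 rL = reg s rL" using r1 by (simp add: unchanged_def)
  have a: "?a \<notin> {PAR, TMP}" using i by auto
  obtain t2 s2 where e2: "exec (toggle_segment ?a) s1 t2 s2" and r2: "t2 \<le> 1 + 10 * (?hi - ?lo) \<and>
      holds_set n s2 (D \<triangle> arr s1 ?a ` {?lo..<?hi}) \<and> reg s2 rL = reg s1 rL + (?hi - ?lo) \<and>
      unchanged {rS, rL, rI, rX, rY} {PAR, TMP} s1 s2"
    by (rule wpE[OF wp_toggle_segment[OF D1, of ?lo ?hi ?a]])
      (use r1 le bij sub a in \<open>auto simp only: same im bij_betw_def\<close>)
  have "unchanged {rS, rL, rI, rH, rX, rY} {PAR, TMP} s s2"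
    using r1 r2 by (auto simp: unchanged_def)
  moreover have "holds_set n s2 (D \<triangle> nbhd E (reg s v))" using r2 unfolding same im by blast
  ultimately show ?thesis unfolding toggle_nbhd_def
    using r1 r2 by (intro wp_SeqI[OF e1] wpI[OF e2]) (simp add: same im card L)
qed

lemma wp_toggle_vertex:
  assumes D: "holds_set n s D" and v: "reg s v \<le> n"
  shows "wp (toggle_vertex v) (\<lambda>t s'. t \<le> 8 \<and> holds_set n s' (D \<triangle> {reg s v}) \<and>
    reg s' rL = Suc (reg s rL) \<and> unchanged {rS, rL, rX, rY} {PAR, TMP} s s') s"
proof -
  let ?s1 = "s\<lparr>reg := (reg s)(rX := reg s v)\<rparr>"
  have D1: "holds_set n ?s1 D" by (rule holds_set_cong[OF D, of "{rX}" "{}"]) (simp_all add: unchanged_def)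
  have v1: "reg ?s1 rX \<le> n" using v by simp
  have e1: "exec (Copy rX v) s 1 ?s1" by (rule exec.Copy)
  obtain t2 s2 where e2: "exec toggle ?s1 t2 s2" and r2: "t2 \<le> 7 \<and> holds_set n s2 (D \<triangle> {reg ?s1 rX}) \<and>
      reg s2 rL = Suc (reg ?s1 rL) \<and> unchanged {rS, rL, rY} {PAR, TMP} ?s1 s2"
    by (rule wpE[OF wp_toggle[OF D1 v1]])
  show ?thesis unfolding toggle_vertex_def
    using r2 by (intro wp_SeqI[OF e1] wpI[OF e2]) (auto simp: unchanged_def)
qed

text \<open>Addition modulo 4 is a table, as the machine can only increment and decrement.\<close>

definition add_phase :: "nat \<Rightarrow> program" where
  "add_phase d = switch rK 4 (\<lambda>k. Const rK ((k + d) mod 4))"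

lemma wp_add_phase:
  assumes "reg s rK < 4"
  shows "wp (add_phase d) (\<lambda>t s'. t \<le> 9 \<and> reg s' rK = (reg s rK + d) mod 4 \<and>
    unchanged {rS, rK} {} s s') s"
  unfolding add_phase_def by (rule wp_switch) (use assms in \<open>auto simp: unchanged_def\<close>)

definition apply_X :: "nat \<Rightarrow> program" where
  "apply_X i = Seq (seqs [Load rY PAR rQ, Const rS 0, If_less rS rY (add_phase 2) Skip]) (toggle_nbhd i rQ)"

lemma wp_apply_X:
  assumes st: "stores_state N cl i s n E u" and E: "simple_graph n E" and i: "i \<le> 4"
    and q: "reg s rQ \<in> {1..n}" and D: "holds_set n s D" and k: "reg s rK < 4"
  shows "wp (apply_X i) (\<lambda>t s'. t \<le> 20 + 10 * n \<and> holds_set n s' (D \<triangle> nbhd E (reg s rQ)) \<and>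
    reg s' rK = (reg s rK + (if reg s rQ \<in> D then 2 else 0)) mod 4 \<and> reg s' rL \<le> reg s rL + n \<and>
    unchanged {rS, rK, rL, rI, rH, rX, rY} {PAR, TMP} s s') s"
proof -
  let ?p = "seqs [Load rY PAR rQ, Const rS 0, If_less rS rY (add_phase 2) Skip]"
  let ?q = "reg s rQ"
  have par: "arr s PAR ?q = of_bool (?q \<in> D)" using D q by (simp add: holds_set_def)
  have "wp ?p (\<lambda>t s'. t \<le> 13 \<and> reg s' rK = (reg s rK + (if ?q \<in> D then 2 else 0)) mod 4 \<and>
    unchanged {rS, rK, rY} {} s s') s"
  proof (cases "?q \<in> D")
    case True
    let ?s = "s\<lparr>reg := (reg s)(rY := 1, rS := 0)\<rparr>"
    have "wp (add_phase 2) (\<lambda>t s'. t \<le> 9 \<and> reg s' rK = (reg ?s rK + 2) mod 4 \<and>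
      unchanged {rS, rK} {} ?s s') ?s"
      by (rule wp_add_phase) (use k in simp)
    then have "wp (add_phase 2) (\<lambda>t s'. Suc (Suc (Suc t)) \<le> 13 \<and> reg s' rK = (reg s rK + 2) mod 4 \<and>
      unchanged {rS, rK, rY} {} s s') ?s"
      by (rule wp_mono) (auto simp: unchanged_def)
    then show ?thesis using True par by simp
  next
    case False
    then show ?thesis using par k by (simp add: unchanged_def)
  qed
  then obtain t1 s1 where e1: "exec ?p s t1 s1" and r1: "t1 \<le> 13 \<and>
    reg s1 rK = (reg s rK + (if ?q \<in> D then 2 else 0)) mod 4 \<and> unchanged {rS, rK, rY} {} s s1"
    by (rule wpE)
  then have u1: "unchanged {rS, rK, rY} {} s s1" by blast
  have q1: "reg s1 rQ = ?q" using u1 by (simp add: unchanged_def)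
  obtain t2 s2 where e2: "exec (toggle_nbhd i rQ) s1 t2 s2" and r2: "t2 \<le> 5 + 10 * card (nbhd E (reg s1 rQ)) \<and>
    holds_set n s2 (D \<triangle> nbhd E (reg s1 rQ)) \<and> reg s2 rL = reg s1 rL + card (nbhd E (reg s1 rQ)) \<and>
    unchanged {rS, rL, rI, rH, rX, rY} {PAR, TMP} s1 s2"
    by (rule wpE[OF wp_toggle_nbhd[OF stores_state_cong[OF st u1] E i, of rQ D]])
      (use q q1 holds_set_cong[OF D u1] in auto)
  have card: "card (nbhd E ?q) \<le> n"
    using card_mono[OF _ nbhd_le[OF E, of ?q]] by simp
  show ?thesis unfolding apply_X_def
    using r1 r2 card by (intro wp_SeqI[OF e1] wpI[OF e2]) (auto simp: unchanged_def q1)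
qed

text \<open>Conjugation by the stored Clifford operation is evaluated when the program is written,
  with one branch for each of the \<open>N\<close> numbers. At run time only sets and the exponent
  of \<open>\<i>\<close> are updated.\<close>

definition apply_pauli :: "nat \<Rightarrow> (nat \<Rightarrow> complex mat) \<Rightarrow> nat \<Rightarrow> bool \<times> nat \<Rightarrow> program" where
  "apply_pauli N cl i p = seqs [Copy rQ (snd p), Load rC (3 * i + 2) rQ,
     switch rC N (\<lambda>c. case conj_pauli (fst p) (cl c) of (t, b, a) \<Rightarrow>
       seqs [add_phase t, if a then apply_X i else Skip, if b then toggle_vertex rQ else Skip])]"

lemma wp_apply_pauli:
  fixes x :: bool
  assumes st: "stores_state N cl i s n E u" and E: "simple_graph n E" and i: "i \<le> 4"
    and r: "reg s r \<in> {1..n}" and B: "holds_set n s B" and k: "reg s rK < 4"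
  defines "kB \<equiv> track (nbhd E) u (x, reg s r) (reg s rK, B)"
  shows "wp (apply_pauli N cl i (x, r)) (\<lambda>t s'. t \<le> 50 + 2 * N + 10 * n \<and> holds_set n s' (snd kB) \<and>
    reg s' rK = fst kB \<and> reg s' rL \<le> reg s rL + n + 1 \<and>
    unchanged {rS, rK, rL, rI, rH, rX, rY, rC, rQ} {PAR, TMP} s s') s"
proof -
  let ?q = "reg s r"
  let ?c = "arr s (3 * i + 2) ?q"
  obtain t b a where tba: "conj_pauli x (u ?q) = (t, b, a)" by (metis prod_cases3)
  have c: "?c < N" "cl ?c = u ?q" using stores_stateD[OF st r] by simp_all
  let ?s2 = "s\<lparr>reg := (reg s)(rQ := ?q, rC := ?c)\<rparr>"
  let ?body = "seqs [add_phase t, if a then apply_X i else Skip, if b then toggle_vertex rQ else Skip]"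
  let ?U = "{rS, rK, rL, rI, rH, rX, rY, rC, rQ}"
  have body: "wp ?body (\<lambda>t s'. t \<le> 40 + 10 * n \<and> holds_set n s' (snd kB) \<and>
    reg s' rK = fst kB \<and> reg s' rL \<le> reg s rL + n + 1 \<and> unchanged ?U {PAR, TMP} s s') s3"
    if s3: "unchanged {rS, rQ, rC} {} s s3" "reg s3 rQ = ?q" for s3
  proof -
    have k3: "reg s3 rK = reg s rK" using s3 by (simp add: unchanged_def)
    have "reg s3 rK < 4" using k k3 by simp
    obtain t4 s4 where e4: "exec (add_phase t) s3 t4 s4" and r4: "t4 \<le> 9 \<and>
      reg s4 rK = (reg s3 rK + t) mod 4 \<and> unchanged {rS, rK} {} s3 s4"
      by (rule wpE[OF wp_add_phase[OF \<open>reg s3 rK < 4\<close>]])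
    have u4: "unchanged {rS, rK, rQ, rC} {} s s4" "reg s4 rQ = ?q" using r4 s3 by (auto simp: unchanged_def)
    have B4: "holds_set n s4 B" by (rule holds_set_cong[OF B u4(1)]) simp_all
    define D where "D = B \<triangle> (if a then nbhd E ?q else {})"
    have k4: "reg s4 rK < 4" using r4 by simp
    have "wp (if a then apply_X i else Skip) (\<lambda>t' s'. t' \<le> 20 + 10 * n \<and> holds_set n s' D \<and>
      reg s' rK = (reg s4 rK + (if a \<and> ?q \<in> B then 2 else 0)) mod 4 \<and> reg s' rL \<le> reg s4 rL + n \<and>
      unchanged {rS, rK, rL, rI, rH, rX, rY} {PAR, TMP} s4 s') s4"
    proof (cases a)
      case True
      show ?thesis using wp_apply_X[OF stores_state_cong[OF st u4(1)] E i _ B4 k4] r u4(2) True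
        by (simp add: D_def)
    next
      case False
      then show ?thesis using k4 B4 by (simp add: D_def unchanged_refl)
    qed
    then obtain t5 s5 where e5: "exec (if a then apply_X i else Skip) s4 t5 s5" and r5: "t5 \<le> 20 + 10 * n \<and>
      holds_set n s5 D \<and> reg s5 rK = (reg s4 rK + (if a \<and> ?q \<in> B then 2 else 0)) mod 4 \<and>
      reg s5 rL \<le> reg s4 rL + n \<and> unchanged {rS, rK, rL, rI, rH, rX, rY} {PAR, TMP} s4 s5"
      by (rule wpE)
    have q5: "reg s5 rQ = ?q" using r5 u4(2) by (simp add: unchanged_def)
    have "wp (if b then toggle_vertex rQ else Skip) (\<lambda>t' s'. t' \<le> 8 \<and>
      holds_set n s' (D \<triangle> (if b then {?q} else {})) \<and> reg s' rL \<le> Suc (reg s5 rL) \<and>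
      unchanged {rS, rL, rX, rY} {PAR, TMP} s5 s') s5"
    proof (cases b)
      case True
      have "wp (toggle_vertex rQ) (\<lambda>t s'. t \<le> 8 \<and> holds_set n s' (D \<triangle> {reg s5 rQ}) \<and>
        reg s' rL = Suc (reg s5 rL) \<and> unchanged {rS, rL, rX, rY} {PAR, TMP} s5 s') s5"
        by (rule wp_toggle_vertex) (use r5 r q5 in auto)
      then show ?thesis using True q5 by (simp, elim wp_mono) auto
    next
      case False
      then show ?thesis using r5 by (simp add: unchanged_refl)
    qed
    then obtain t6 s6 where e6: "exec (if b then toggle_vertex rQ else Skip) s5 t6 s6" and r6: "t6 \<le> 8 \<and>
      holds_set n s6 (D \<triangle> (if b then {?q} else {})) \<and> reg s6 rL \<le> Suc (reg s5 rL) \<and>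
      unchanged {rS, rL, rX, rY} {PAR, TMP} s5 s6"
      by (rule wpE)
    have K: "reg s6 rK = fst kB"
    proof -
      have "reg s6 rK = ((reg s rK + t) mod 4 + (if a \<and> ?q \<in> B then 2 else 0)) mod 4"
        using r4 r5 r6 k3 by (simp add: unchanged_def)
      then show ?thesis by (simp add: kB_def track_def tba mod_add_left_eq)
    qed
    have S: "D \<triangle> (if b then {?q} else {}) = snd kB"
      by (simp only: kB_def track_def tba D_def prod.case snd_conv)
    have L: "reg s6 rL \<le> reg s rL + n + 1"
      using r4 r5 r6 s3 by (simp add: unchanged_def)
    have u6: "unchanged ?U {PAR, TMP} s s6"
      using u4(1) r5 r6 by (auto simp: unchanged_def)
    show ?thesis unfolding seqs.simps
      using r4 r5 r6 u6 K L by (intro wp_SeqI[OF e4] wp_SeqI[OF e5] wpI[OF e6]) (auto simp: S[symmetric])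
  qed
  let ?f = "\<lambda>c. case conj_pauli x (cl c) of (t, b, a) \<Rightarrow>
       seqs [add_phase t, if a then apply_X i else Skip, if b then toggle_vertex rQ else Skip]"
  have "wp (switch rC N ?f) (\<lambda>t s'. 2 + t \<le> 50 + 2 * N + 10 * n \<and> holds_set n s' (snd kB) \<and>
    reg s' rK = fst kB \<and> reg s' rL \<le> reg s rL + n + 1 \<and> unchanged ?U {PAR, TMP} s s') ?s2"
  proof (rule wp_switch)
    fix z
    have "wp ?body (\<lambda>t s'. t \<le> 40 + 10 * n \<and> holds_set n s' (snd kB) \<and>
      reg s' rK = fst kB \<and> reg s' rL \<le> reg s rL + n + 1 \<and> unchanged ?U {PAR, TMP} s s')
      (?s2\<lparr>reg := (reg ?s2)(rS := z)\<rparr>)"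
      by (rule body) (auto simp: unchanged_def)
    moreover have "?f (reg ?s2 rC) = ?body"
    proof -
      have "reg ?s2 rC = ?c" by simp
      then show ?thesis by (simp only: c(2) tba prod.case)
    qed
    ultimately show "wp (?f (reg ?s2 rC)) (\<lambda>t s'. \<forall>c\<le>2 * N. 2 + (c + t) \<le> 50 + 2 * N + 10 * n \<and>
      holds_set n s' (snd kB) \<and> reg s' rK = fst kB \<and> reg s' rL \<le> reg s rL + n + 1 \<and>
      unchanged ?U {PAR, TMP} s s') (?s2\<lparr>reg := (reg ?s2)(rS := z)\<rparr>)"
      by (simp only:) (erule wp_mono, auto)
  qed (use c in auto)
  then show ?thesis unfolding apply_pauli_def by simp
qed

fun apply_paulis :: "nat \<Rightarrow> (nat \<Rightarrow> complex mat) \<Rightarrow> nat \<Rightarrow> (bool \<times> nat) list \<Rightarrow> program" where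
  "apply_paulis N cl i [] = Skip"
| "apply_paulis N cl i (p # ps) = Seq (apply_pauli N cl i p) (apply_paulis N cl i ps)"

lemma wp_apply_paulis:
  assumes "stores_state N cl i s n E u" and E: "simple_graph n E" and i: "i \<le> 4"
    and "\<And>p. p \<in> set ps \<Longrightarrow> snd p \<le> 3 \<and> reg s (snd p) \<in> {1..n}" and "holds_set n s B" and "reg s rK < 4"
    and kB: "kB = fold (track (nbhd E) u) (map (map_prod id (reg s)) ps) (reg s rK, B)"
  shows "wp (apply_paulis N cl i ps) (\<lambda>t s'. t \<le> 1 + length ps * (50 + 2 * N + 10 * n) \<and>
    holds_set n s' (snd kB) \<and> reg s' rK = fst kB \<and> reg s' rL \<le> reg s rL + length ps * (n + 1) \<and>
    unchanged {rS, rK, rL, rI, rH, rX, rY, rC, rQ} {PAR, TMP} s s') s"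
  using assms(1,4-)
proof (induction ps arbitrary: s B kB)
  case Nil
  then show ?case by (simp add: unchanged_refl)
next
  case (Cons p ps)
  obtain x r where p: "p = (x, r)" by fastforce
  let ?kB = "track (nbhd E) u (x, reg s r) (reg s rK, B)"
  let ?U = "{rS, rK, rL, rI, rH, rX, rY, rC, rQ}"
  have r: "r \<le> 3" "reg s r \<in> {1..n}" using Cons.prems(2)[of p] by (simp_all add: p)
  obtain t1 s1 where e1: "exec (apply_pauli N cl i (x, r)) s t1 s1" and r1: "t1 \<le> 50 + 2 * N + 10 * n \<and>
    holds_set n s1 (snd ?kB) \<and> reg s1 rK = fst ?kB \<and> reg s1 rL \<le> reg s rL + n + 1 \<and>
    unchanged ?U {PAR, TMP} s s1"
    by (rule wpE[OF wp_apply_pauli[OF Cons.prems(1) E i r(2) Cons.prems(3,4), of x]])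
  have u1: "unchanged ?U {PAR, TMP} s s1" using r1 by blast
  have same: "reg s1 q = reg s q" if "q \<le> 3" for q
    using unchangedD(1)[OF u1, of q] that by auto
  have "wp (apply_paulis N cl i ps) (\<lambda>t s'. t \<le> 1 + length ps * (50 + 2 * N + 10 * n) \<and>
    holds_set n s' (snd kB) \<and> reg s' rK = fst kB \<and> reg s' rL \<le> reg s1 rL + length ps * (n + 1) \<and>
    unchanged ?U {PAR, TMP} s1 s') s1"
  proof (rule Cons.IH)
    show "stores_state N cl i s1 n E u"
      by (rule stores_state_cong[OF Cons.prems(1) u1]) (use i in auto)
    show "snd p \<le> 3 \<and> reg s1 (snd p) \<in> {1..n}" if "p \<in> set ps" for p
      using Cons.prems(2)[of p] that same by simp
    show "holds_set n s1 (snd ?kB)" using r1 by blast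
    show "reg s1 rK < 4" using r1 by (simp add: track_def split: prod.split)
    have m: "map (map_prod id (reg s1)) ps = map (map_prod id (reg s)) ps"
    proof (intro map_cong refl)
      fix p assume "p \<in> set ps"
      then have "reg s1 (snd p) = reg s (snd p)" using Cons.prems(2)[of p] same by simp
      then show "map_prod id (reg s1) p = map_prod id (reg s) p" by (cases p) simp
    qed
    show "kB = fold (track (nbhd E) u) (map (map_prod id (reg s1)) ps) (reg s1 rK, snd ?kB)"
    proof -
      have "reg s1 rK = fst ?kB" using r1 by blast
      then show ?thesis unfolding Cons.prems(5) p m by simp
    qed
  qed
  then obtain t2 s2 where e2: "exec (apply_paulis N cl i ps) s1 t2 s2" and
    r2: "t2 \<le> 1 + length ps * (50 + 2 * N + 10 * n) \<and>
    holds_set n s2 (snd kB) \<and> reg s2 rK = fst kB \<and> reg s2 rL \<le> reg s1 rL + length ps * (n + 1) \<and>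
    unchanged ?U {PAR, TMP} s1 s2"
    by (rule wpE)
  have "unchanged ?U {PAR, TMP} s s2" using u1 r2 by (auto simp: unchanged_def)
  then show ?case unfolding apply_paulis.simps p
    using r1 r2 by (intro wp_SeqI[OF e1] wpI[OF e2]) simp
qed

text \<open>\<open>B\<close> is needed both as a list, to toggle all its elements in time
  \<open>|B|\<close>, and as an indicator, to test membership in constant time. The array of
  parities cannot keep the latter, because it is reused for each new neighbour list.\<close>

definition list_support :: program where
  "list_support = Seq (emit BL) (Seq (seqs [Copy rB rO, Const rI 0, Copy rH rB]) (mark_segment BL INB))"

lemma wp_list_support:
  assumes B: "holds_set n s B" and "reg s rO = 0" and "reg s rOne = 1" and I: "\<And>x. x \<le> n \<Longrightarrow> arr s INB x = 0"
  shows "wp list_support (\<lambda>t s'. t \<le> 10 + 10 * reg s rL + 4 * card B \<and> holds_set n s' {} \<and> reg s' rL = 0 \<and>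
    reg s' rB = card B \<and> bij_betw (arr s' BL) {0..<card B} B \<and> (\<forall>x\<le>n. arr s' INB x = of_bool (x \<in> B)) \<and>
    unchanged {rS, rL, rI, rH, rX, rY, rO, rB} {PAR, BL, INB} s s') s"
proof -
  have BL: "BL \<notin> {PAR, TMP}" by simp
  obtain t1 s1 where e1: "exec (emit BL) s t1 s1" and r1: "t1 \<le> 3 + 10 * reg s rL \<and> holds_set n s1 {} \<and>
    reg s1 rL = 0 \<and> reg s rO \<le> reg s1 rO \<and> bij_betw (arr s1 BL) {reg s rO..<reg s1 rO} B \<and>
    (\<forall>p<reg s rO. arr s1 BL p = arr s BL p) \<and> unchanged {rS, rL, rI, rX, rY, rO} {PAR, BL} s s1"
    by (rule wpE[OF wp_emit[OF B BL]])
  have c: "reg s1 rO = card B" using r1 bij_betw_same_card assms(2) by fastforce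
  have bij: "bij_betw (arr s1 BL) {0..<card B} B" using r1 assms(2) unfolding c by simp
  let ?s2 = "s1\<lparr>reg := (reg s1)(rB := card B, rI := 0, rH := card B)\<rparr>"
  have "wp (seqs [Copy rB rO, Const rI 0, Copy rH rB]) (\<lambda>t s'. t = 3 \<and> s' = ?s2) s1"
    using c by simp
  then obtain t2 s2 where "exec (seqs [Copy rB rO, Const rI 0, Copy rH rB]) s1 t2 s2" "t2 = 3 \<and> s2 = ?s2"
    by (rule wpE)
  then have e2: "exec (seqs [Copy rB rO, Const rI 0, Copy rH rB]) s1 3 ?s2" by blast
  have D2: "holds_set n ?s2 {}"
    by (rule holds_set_cong[of _ s1 _ "{rB, rI, rH}" "{}"]) (use r1 in \<open>auto simp: unchanged_def\<close>)
  obtain t3 s3 where e3: "exec (mark_segment BL INB) ?s2 t3 s3" and r3: "t3 \<le> 1 + 4 * (card B - 0) \<and>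
    (\<forall>x. arr s3 INB x = (if x \<in> arr ?s2 BL ` {0..<card B} then reg ?s2 rOne else arr ?s2 INB x)) \<and>
    unchanged {rI, rX} {INB} ?s2 s3"
    by (rule wpE[OF wp_mark_segment[of ?s2 0 "card B" BL INB]]) simp_all
  have u3: "unchanged {rI, rX} {INB} ?s2 s3" using r3 by blast
  have D3: "holds_set n s3 {}" by (rule holds_set_cong[OF D2 u3]) simp_all
  have im: "arr s1 BL ` {0..<card B} = B" using bij by (simp add: bij_betw_def)
  have one: "reg s1 rOne = 1" using r1 assms(3) by (simp add: unchanged_def)
  have z: "arr s1 INB x = 0" if "x \<le> n" for x using r1 I[OF that] by (simp add: unchanged_def)
  have inb: "\<forall>x\<le>n. arr s3 INB x = of_bool (x \<in> B)"
    using r3 by (simp add: im one z)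
  have BL3: "arr s3 BL = arr s1 BL" using r3 by (simp add: unchanged_def)
  have u: "unchanged {rS, rL, rI, rH, rX, rY, rO, rB} {PAR, BL, INB} s s3"
    using r1 r3 by (auto simp: unchanged_def)
  have rg: "reg s3 rL = 0" "reg s3 rB = card B" using r1 r3 by (simp_all add: unchanged_def)
  show ?thesis unfolding list_support_def
    using r1 r3 D3 inb bij u rg
    by (intro wp_SeqI[OF e1] wp_SeqI[OF e2] wpI[OF e3]) (simp add: BL3)
qed

subsection \<open>Choice of the pivot\<close>

abbreviation deg :: "nat set set \<Rightarrow> nat \<Rightarrow> nat" where
  "deg E v \<equiv> card (nbhd E v)"

lemma deg_le: "simple_graph n E \<Longrightarrow> deg E v \<le> n"
  using card_mono[OF _ nbhd_le[of n E v]] by simp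

text \<open>Without subtraction a degree is found by walking through the neighbour list. Over all of
  \<open>B\<close> this costs time proportional to \<open>|B|\<close> plus the sum of the
  degrees.\<close>

definition count_loop :: program where
  "count_loop = While_less rI rH (Seq (Incr rG) (Incr rI))"

lemma wp_count_loop:
  assumes "reg s rI = lo" "reg s rH = hi" "lo \<le> hi" "reg s rG = 0"
  shows "wp count_loop (\<lambda>t s'. t \<le> 1 + 3 * (hi - lo) \<and> reg s' rG = hi - lo \<and> unchanged {rI, rG} {} s s') s"
proof -
  let ?I = "\<lambda>j s'. reg s' rG = j - lo \<and> reg s' rI = j \<and> unchanged {rI, rG} {} s s'"
  have "wp count_loop (\<lambda>t s'. t \<le> 1 + Suc 2 * (hi - lo) \<and> ?I hi s') s"
    unfolding count_loop_def
    by (rule wp_while_const[where I = ?I and lo = lo and hi = hi])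
      (use assms in \<open>auto simp: unchanged_def\<close>)
  then show ?thesis by (rule wp_mono) auto
qed

definition min_loop :: "nat \<Rightarrow> program" where
  "min_loop i = While_less rQ rB (seqs [Load rX BL rQ, set_segment i rX, Const rG 0, count_loop,
     If_less rG rD (Seq (Copy rD rG) (Copy rW rX)) Skip, Incr rQ])"

text \<open>\<open>rD\<close> always bounds the degree of the current candidate from above and those
  of the vertices already seen from below; at the end both bounds together say that the candidate
  has minimal degree.\<close>

lemma wp_min_loop:
  assumes st: "stores_state N cl i s n E u" and B: "B \<subseteq> {1..n}"
    and rB: "reg s rB = card B" and bij: "bij_betw (arr s BL) {0..<card B} B"
    and init: "reg s rQ = 0" "reg s rW \<in> B" "deg E (reg s rW) \<le> reg s rD"
  shows "wp (min_loop i) (\<lambda>t s'. t \<le> 1 + (\<Sum>x\<in>B. 13 + 3 * deg E x) \<and> reg s' rW \<in> B \<and>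
    deg E (reg s' rW) \<le> reg s' rD \<and> (\<forall>x\<in>B. reg s' rD \<le> deg E x) \<and>
    unchanged {rI, rH, rX, rG, rD, rW, rQ} {} s s') s"
proof -
  let ?x = "arr s BL"
  let ?I = "\<lambda>j s'. reg s' rQ = j \<and> reg s' rW \<in> B \<and> deg E (reg s' rW) \<le> reg s' rD \<and>
    (\<forall>l<j. reg s' rD \<le> deg E (?x l)) \<and> unchanged {rI, rH, rX, rG, rD, rW, rQ} {} s s'"
  let ?b = "seqs [Load rX BL rQ, set_segment i rX, Const rG 0, count_loop,
     If_less rG rD (Seq (Copy rD rG) (Copy rW rX)) Skip, Incr rQ]"
  have "wp (min_loop i) (\<lambda>t s'. t \<le> 1 + (\<Sum>j = 0..<card B. Suc (12 + 3 * deg E (?x j))) \<and> ?I (card B) s') s"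
    unfolding min_loop_def
  proof (rule wp_while[where I = ?I and lo = 0 and hi = "card B"])
    show "?I 0 s" using init by (simp add: unchanged_refl)
  next
    fix j s' assume "?I j s'"
    then show "reg s' rQ < reg s' rB \<longleftrightarrow> j < card B" using rB by (simp add: unchanged_def)
  next
    fix j s1 assume I: "?I j s1" and j: "j < card B"
    have xB: "?x j \<in> B" using bij j by (auto simp: bij_betw_def)
    then have x: "?x j \<in> {1..n}" using B by blast
    let ?lo = "arr s (3 * i) (?x j)" and ?hi = "arr s (3 * i) (Suc (?x j))"
    have le: "?lo \<le> ?hi" and deg: "?hi - ?lo = deg E (?x j)"
      using stores_stateD(1)[OF st x] bij_betw_same_card[OF stores_stateD(2)[OF st x]] by simp_all
    have same: "arr s1 = arr s" using I by (auto simp: unchanged_def)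
    let ?s2 = "s1\<lparr>reg := (reg s1)(rX := ?x j)\<rparr>"
    have e2: "exec (Load rX BL rQ) s1 1 ?s2" using exec.Load[of rX BL rQ s1] I same by simp
    have "rX \<notin> {rI, rH}" by simp
    from wp_set_segment[OF this] obtain t3 s3 where e3: "exec (set_segment i rX) ?s2 t3 s3"
      and r3: "t3 = 4 \<and> reg s3 rI = arr ?s2 (3 * i) (reg ?s2 rX) \<and>
        reg s3 rH = arr ?s2 (3 * i) (Suc (reg ?s2 rX)) \<and> unchanged {rI, rH} {} ?s2 s3"
      by (rule wpE)
    let ?s4 = "s3\<lparr>reg := (reg s3)(rG := 0)\<rparr>"
    have e4: "exec (Const rG 0) s3 1 ?s4" by (rule exec.Const)
    have r4: "reg ?s4 rI = ?lo" "reg ?s4 rH = ?hi" "reg ?s4 rG = 0" using r3 same by simp_all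
    obtain t5 s5 where e5: "exec count_loop ?s4 t5 s5" and r5: "t5 \<le> 1 + 3 * (?hi - ?lo) \<and>
      reg s5 rG = ?hi - ?lo \<and> unchanged {rI, rG} {} ?s4 s5"
      by (rule wpE[OF wp_count_loop[OF r4(1,2) le r4(3)]])
    have u5: "unchanged {rX, rI, rH, rG} {} s1 s5" using r3 r5 by (auto simp: unchanged_def)
    then have v5: "reg s5 rD = reg s1 rD" "reg s5 rW = reg s1 rW" "reg s5 rQ = j"
      using I by (simp_all add: unchanged_def)
    have x5: "reg s5 rX = ?x j" using r3 r5 by (simp add: unchanged_def)
    have g5: "reg s5 rG = deg E (?x j)" using r5 deg by simp
    have U: "unchanged {rI, rH, rX, rG, rD, rW, rQ} {} s s5"
      using I u5 by (auto simp: unchanged_def)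
    have "wp (seqs [If_less rG rD (Seq (Copy rD rG) (Copy rW rX)) Skip, Incr rQ])
      (\<lambda>t s'. t \<le> 4 \<and> ?I (Suc j) s') s5"
      using I U xB by (auto simp: v5 x5 g5 unchanged_def less_Suc_eq)
    then have "wp (seqs [If_less rG rD (Seq (Copy rD rG) (Copy rW rX)) Skip, Incr rQ])
      (\<lambda>t s'. 1 + (t3 + (1 + (t5 + t))) \<le> 12 + 3 * deg E (?x j) \<and> ?I (Suc j) s') s5"
      by (rule wp_mono) (use r3 r5 deg in auto)
    then show "wp ?b (\<lambda>t s'. t \<le> 12 + 3 * deg E (?x j) \<and> ?I (Suc j) s') s1"
      unfolding seqs.simps
      by (intro wp_SeqI[OF e2] wp_SeqI[OF e3] wp_SeqI[OF e4] wp_SeqI[OF e5])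
  qed simp
  then show ?thesis
  proof (rule wp_mono)
    fix t s'
    assume *: "t \<le> 1 + (\<Sum>j = 0..<card B. Suc (12 + 3 * deg E (?x j))) \<and> ?I (card B) s'"
    have "(\<Sum>j = 0..<card B. Suc (12 + 3 * deg E (?x j))) = (\<Sum>x\<in>B. 13 + 3 * deg E x)"
      using sum.reindex_bij_betw[OF bij, of "\<lambda>x. 13 + 3 * deg E x"] by simp
    moreover have "\<forall>x\<in>B. reg s' rD \<le> deg E x"
    proof
      fix x assume "x \<in> B"
      then have "x \<in> ?x ` {0..<card B}" by (simp only: bij_betw_imp_surj_on[OF bij])
      then obtain l where "l < card B" "x = ?x l" by auto
      then show "reg s' rD \<le> deg E x" using * by simp
    qed
    ultimately show "t \<le> 1 + (\<Sum>x\<in>B. 13 + 3 * deg E x) \<and> reg s' rW \<in> B \<and>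
      deg E (reg s' rW) \<le> reg s' rD \<and> (\<forall>x\<in>B. reg s' rD \<le> deg E x) \<and>
      unchanged {rI, rH, rX, rG, rD, rW, rQ} {} s s'" using * by simp
  qed
qed

text \<open>\<open>rG\<close> becomes the minimal degree plus 2, so the guard says that
  \<open>B\<close> has at most as many elements as the closed neighbourhood of the pivot. Only then
  does the parity of \<open>k\<close> matter.\<close>

definition decide :: program where
  "decide = seqs [Const rP 0, Copy rG rD, Incr rG, Incr rG,
     If_less rB rG (switch rK 4 (\<lambda>k. if odd k then Skip else Const rP 1)) (Const rP 1)]"

lemma wp_decide:
  assumes "reg s rK < 4"
  shows "wp decide (\<lambda>t s'. t \<le> 20 \<and>
    reg s' rP = of_bool (even (reg s rK) \<or> reg s rD + 2 \<le> reg s rB) \<and> unchanged {rS, rP, rG} {} s s') s"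
proof (cases "reg s rB < Suc (Suc (reg s rD))")
  case True
  let ?s = "s\<lparr>reg := (reg s)(rP := 0, rG := Suc (Suc (reg s rD)))\<rparr>"
  have "wp (switch rK 4 (\<lambda>k. if odd k then Skip else Const rP 1)) (\<lambda>t s'. Suc (Suc (Suc (Suc (Suc t)))) \<le> 20 \<and>
    reg s' rP = of_bool (even (reg s rK) \<or> reg s rD + 2 \<le> reg s rB) \<and> unchanged {rS, rP, rG} {} s s') ?s"
    by (rule wp_switch) (use assms True in \<open>auto simp: unchanged_def\<close>)
  then show ?thesis using True by (simp add: decide_def)
next
  case False
  then show ?thesis by (simp add: decide_def unchanged_def)
qed

definition mark_pivot :: "nat \<Rightarrow> program" where
  "mark_pivot i = seqs [Const rS 0, If_less rS rP
     (seqs [set_segment i rW, mark_segment (3 * i + 1) MK, Const rS 2, Store MK rW rS]) Skip]"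

lemma wp_mark_pivot:
  assumes st: "stores_state N cl i s n E u" and i: "i \<le> 4" and w: "reg s rW \<in> {1..n}"
    and one: "reg s rOne = 1" and z: "\<And>x. x \<le> n \<Longrightarrow> arr s MK x = 0" and P: "reg s rP = of_bool pivot"
  shows "wp (mark_pivot i) (\<lambda>t s'. t \<le> 10 + 4 * deg E (reg s rW) \<and>
    (\<forall>x\<le>n. arr s' MK x = mark pivot E (reg s rW) x) \<and> unchanged {rS, rI, rH, rX} {MK} s s') s"
proof (cases pivot)
  case False
  then show ?thesis using P z by (simp add: mark_pivot_def unchanged_def mark_def)
next
  case True
  let ?w = "reg s rW" and ?a = "3 * i + 1"
  let ?lo = "arr s (3 * i) ?w" and ?hi = "arr s (3 * i) (Suc ?w)"
  let ?s1 = "s\<lparr>reg := (reg s)(rS := 0)\<rparr>"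
  have bij: "bij_betw (arr s ?a) {?lo..<?hi} (nbhd E ?w)" and le: "?lo \<le> ?hi"
    using stores_stateD[OF st w] by simp_all
  then have card: "?hi - ?lo = deg E ?w" using bij_betw_same_card[OF bij] by simp
  have "rW \<notin> {rI, rH}" by simp
  from wp_set_segment[OF this, of i ?s1] obtain t2 s2 where e2: "exec (set_segment i rW) ?s1 t2 s2"
    and r2: "t2 = 4 \<and> reg s2 rI = arr ?s1 (3 * i) (reg ?s1 rW) \<and>
      reg s2 rH = arr ?s1 (3 * i) (Suc (reg ?s1 rW)) \<and> unchanged {rI, rH} {} ?s1 s2"
    by (rule wpE)
  have r2': "reg s2 rI = ?lo" "reg s2 rH = ?hi" using r2 by simp_all
  have a: "?a \<noteq> MK" using i by presburger
  obtain t3 s3 where e3: "exec (mark_segment ?a MK) s2 t3 s3" and r3: "t3 \<le> 1 + 4 * (?hi - ?lo) \<and>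
    (\<forall>x. arr s3 MK x = (if x \<in> arr s2 ?a ` {?lo..<?hi} then reg s2 rOne else arr s2 MK x)) \<and>
    unchanged {rI, rX} {MK} s2 s3"
    by (rule wpE[OF wp_mark_segment[OF r2' le a]])
  have s2: "arr s2 = arr s" "reg s2 rOne = 1" using r2 one by (auto simp: unchanged_def)
  have im: "arr s ?a ` {?lo..<?hi} = nbhd E ?w" using bij by (simp add: bij_betw_def)
  have m3: "arr s3 MK x = (if x \<in> nbhd E ?w then 1 else arr s MK x)" for x
    using r3 unfolding s2 im by blast
  have w3: "reg s3 rW = ?w" using r2 r3 by (simp add: unchanged_def)
  have u3: "unchanged {rS, rI, rH, rX} {MK} s s3" using r2 r3 by (auto simp: unchanged_def)
  have "wp (seqs [Const rS 2, Store MK rW rS]) (\<lambda>t s'. t \<le> 2 \<and>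
    (\<forall>x\<le>n. arr s' MK x = mark pivot E ?w x) \<and> unchanged {rS, rI, rH, rX} {MK} s s') s3"
    using u3 True z by (auto simp: m3 w3 mark_def unchanged_def)
  then have "wp (seqs [Const rS 2, Store MK rW rS]) (\<lambda>t s'. 2 + (t2 + (t3 + t)) \<le> 10 + 4 * deg E ?w \<and>
    (\<forall>x\<le>n. arr s' MK x = mark pivot E ?w x) \<and> unchanged {rS, rI, rH, rX} {MK} s s') s3"
    by (rule wp_mono) (use r2 r3 card in auto)
  then have "wp (seqs [set_segment i rW, mark_segment ?a MK, Const rS 2, Store MK rW rS])
    (\<lambda>t s'. 2 + t \<le> 10 + 4 * deg E ?w \<and>
    (\<forall>x\<le>n. arr s' MK x = mark pivot E ?w x) \<and> unchanged {rS, rI, rH, rX} {MK} s s') ?s1"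
    unfolding seqs.simps by (intro wp_SeqI[OF e2] wp_SeqI[OF e3])
  then show ?thesis using P True by (simp add: mark_pivot_def)
qed

definition choose_pivot :: "nat \<Rightarrow> program" where
  "choose_pivot i = seqs [Const rP 0, Const rS 0, If_less rS rB
     (seqs [seqs [Load rW BL rS, Copy rD 0, Const rQ 0], min_loop i, decide, mark_pivot i]) Skip]"

text \<open>The choice of a vertex of minimal degree in \<open>B\<close> bounds the number of toggled pairs by the
  number of edges and vertices.\<close>
definition small_toggle :: "nat set set \<Rightarrow> nat set \<Rightarrow> nat \<Rightarrow> bool \<Rightarrow> nat \<Rightarrow> bool" where
  "small_toggle E B k pivot w \<longleftrightarrow> (let S = (\<Sum>x\<in>B. Suc (deg E x)) in
     if pivot then card B * Suc (deg E w) \<le> S \<and> (odd k \<longrightarrow> Suc (deg E w) * Suc (deg E w) \<le> S)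
     else card B * card B \<le> S)"

lemma wp_choose_pivot:
  assumes st: "stores_state N cl i s n E u" and E: "simple_graph n E" and i: "i \<le> 4" and n: "reg s 0 = n"
    and B: "B \<subseteq> {1..n}" and rB: "reg s rB = card B" and bij: "bij_betw (arr s BL) {0..<card B} B"
    and one: "reg s rOne = 1" and z: "\<And>x. x \<le> n \<Longrightarrow> arr s MK x = 0" and k: "reg s rK < 4"
  shows "wp (choose_pivot i) (\<lambda>t s'. t \<le> 60 + 20 * (\<Sum>x\<in>B. Suc (deg E x)) \<and>
    (\<exists>pivot. reg s' rP = of_bool pivot \<and> (if pivot then reg s' rW \<in> B else B = {} \<or> odd (reg s rK)) \<and>
      (\<forall>x\<le>n. arr s' MK x = mark pivot E (reg s' rW) x) \<and> small_toggle E B (reg s rK) pivot (reg s' rW)) \<and>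
    unchanged {rS, rI, rH, rX, rG, rD, rW, rQ, rP} {MK} s s') s"
proof (cases "B = {}")
  case True
  then show ?thesis using rB z
    by (auto simp: choose_pivot_def unchanged_def mark_def small_toggle_def intro!: exI[of _ False])
next
  case False
  have fB: "finite B" using B by (rule finite_subset) simp
  then have pos: "0 < card B" using False by (simp add: card_gt_0_iff)
  let ?s0 = "s\<lparr>reg := (reg s)(rP := 0, rS := 0)\<rparr>"
  \<comment> \<open>The search starts from the first element of \<open>B\<close>, with
    \<open>n\<close> as a bound that no degree exceeds.\<close>
  let ?s1 = "s\<lparr>reg := (reg s)(rP := 0, rS := 0, rW := arr s BL 0, rD := n, rQ := 0)\<rparr>"
  have e1: "exec (seqs [Load rW BL rS, Copy rD 0, Const rQ 0]) ?s0 3 ?s1"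
  proof -
    have "wp (seqs [Load rW BL rS, Copy rD 0, Const rQ 0]) (\<lambda>t s'. t = 3 \<and> s' = ?s1) ?s0"
      using n by simp
    then show ?thesis by (auto simp only: wp_def)
  qed
  have u1: "unchanged {rP, rS, rW, rD, rQ} {} s ?s1" by (simp add: unchanged_def)
  have st1: "stores_state N cl i ?s1 n E u" by (rule stores_state_cong[OF st u1]) simp
  have w1: "reg ?s1 rW \<in> B" using bij pos by (auto simp: bij_betw_def)
  obtain t2 s2 where e2: "exec (min_loop i) ?s1 t2 s2" and r2: "t2 \<le> 1 + (\<Sum>x\<in>B. 13 + 3 * deg E x) \<and>
    reg s2 rW \<in> B \<and> deg E (reg s2 rW) \<le> reg s2 rD \<and> (\<forall>x\<in>B. reg s2 rD \<le> deg E x) \<and>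
    unchanged {rI, rH, rX, rG, rD, rW, rQ} {} ?s1 s2"
    by (rule wpE[OF wp_min_loop[OF st1 B]]) (use rB bij w1 deg_le[OF E] in auto)
  have k2: "reg s2 rK = reg s rK" "reg s2 rB = card B" using r2 rB by (simp_all add: unchanged_def)
  have "reg s2 rK < 4" using k k2 by simp
  define pivot where "pivot \<longleftrightarrow> even (reg s rK) \<or> reg s2 rD + 2 \<le> card B"
  obtain t3 s3 where e3: "exec decide s2 t3 s3" and r3: "t3 \<le> 20 \<and>
    reg s3 rP = of_bool (even (reg s2 rK) \<or> reg s2 rD + 2 \<le> reg s2 rB) \<and> unchanged {rS, rP, rG} {} s2 s3"
    by (rule wpE[OF wp_decide[OF \<open>reg s2 rK < 4\<close>]])
  have P3: "reg s3 rP = of_bool pivot" using r3 by (simp add: k2 pivot_def)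
  let ?U = "{rS, rI, rH, rX, rG, rD, rW, rQ, rP}"
  have u3: "unchanged ?U {} s s3" using u1 r2 r3 by (auto simp: unchanged_def)
  have st3: "stores_state N cl i s3 n E u" by (rule stores_state_cong[OF st u3]) simp
  have w3: "reg s3 rW = reg s2 rW" using r3 by (simp add: unchanged_def)
  have w3n: "reg s3 rW \<in> {1..n}" using r2 w3 B by auto
  have one3: "reg s3 rOne = 1" using u3 one by (simp add: unchanged_def)
  have z3: "\<And>x. x \<le> n \<Longrightarrow> arr s3 MK x = 0" using u3 z by (simp add: unchanged_def)
  obtain t4 s4 where e4: "exec (mark_pivot i) s3 t4 s4" and r4: "t4 \<le> 10 + 4 * deg E (reg s3 rW) \<and>
    (\<forall>x\<le>n. arr s4 MK x = mark pivot E (reg s3 rW) x) \<and> unchanged {rS, rI, rH, rX} {MK} s3 s4"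
    by (rule wpE[OF wp_mark_pivot[OF st3 i w3n one3 z3 P3]])
  have w4: "reg s4 rW = reg s2 rW" "reg s4 rP = of_bool pivot" using r4 w3 P3 by (simp_all add: unchanged_def)
  let ?w = "reg s2 rW" and ?d = "reg s2 rD" and ?S = "\<Sum>x\<in>B. Suc (deg E x)"
  have wB: "?w \<in> B" and dw: "deg E ?w \<le> ?d" and dx: "\<And>x. x \<in> B \<Longrightarrow> ?d \<le> deg E x" using r2 by auto
  have S1: "card B * Suc ?d \<le> ?S"
    using sum_mono[of B "\<lambda>_. Suc ?d" "\<lambda>x. Suc (deg E x)"] dx by simp
  have Sw: "deg E ?w \<le> ?S"
    using member_le_sum[OF wB, of "\<lambda>x. Suc (deg E x)"] fB by simp
  \<comment> \<open>With \<open>M\<close> the closed neighbourhood, minimality gives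
    \<open>|B| |M| \<le> ?S\<close>. An odd \<open>k\<close> uses the pivot only if
    \<open>|M| < |B|\<close>, and the alternative is used only if \<open>|B| \<le> |M|\<close>; in
    either case the square in question is at most \<open>|B| |M|\<close>.\<close>
  have small: "small_toggle E B (reg s rK) pivot ?w"
  proof -
    have 1: "card B * Suc (deg E ?w) \<le> ?S"
      using S1 dw by (meson Suc_le_mono le_trans mult_le_mono2)
    have 2: "Suc (deg E ?w) * Suc (deg E ?w) \<le> ?S" if "?d + 2 \<le> card B"
      using mult_le_mono[of "Suc (deg E ?w)" "card B" "Suc (deg E ?w)" "Suc ?d"] that dw S1 by linarith
    have 3: "card B * card B \<le> ?S" if "\<not> ?d + 2 \<le> card B"
      using mult_le_mono2[of "card B" "Suc ?d" "card B"] that S1 by linarith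
    show ?thesis unfolding small_toggle_def Let_def using 1 2 3 by (auto simp: pivot_def)
  qed
  have T: "(\<Sum>x\<in>B. 13 + 3 * deg E x) \<le> 13 * ?S"
    unfolding sum_distrib_left by (rule sum_mono) simp
  have U: "unchanged ?U {MK} s s4" using u3 r4 by (auto simp: unchanged_def)
  have "wp (seqs [seqs [Load rW BL rS, Copy rD 0, Const rQ 0], min_loop i, decide, mark_pivot i])
    (\<lambda>t s'. Suc (Suc (Suc t)) \<le> 60 + 20 * ?S \<and>
    (\<exists>pivot. reg s' rP = of_bool pivot \<and> (if pivot then reg s' rW \<in> B else B = {} \<or> odd (reg s rK)) \<and>
      (\<forall>x\<le>n. arr s' MK x = mark pivot E (reg s' rW) x) \<and> small_toggle E B (reg s rK) pivot (reg s' rW)) \<and>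
    unchanged ?U {MK} s s') ?s0"
    unfolding seqs.simps
  proof (intro wp_SeqI[OF e1[unfolded seqs.simps]] wp_SeqI[OF e2] wp_SeqI[OF e3] wpI[OF e4] conjI exI[of _ pivot])
    show "Suc (Suc (Suc (3 + (t2 + (t3 + t4))))) \<le> 60 + 20 * ?S"
      using r2 r3 r4 T Sw w3 by simp
    show "if pivot then reg s4 rW \<in> B else B = {} \<or> odd (reg s rK)"
      using wB by (simp add: w4 pivot_def)
    show "\<forall>x\<le>n. arr s4 MK x = mark pivot E (reg s4 rW) x" using r4 w3 w4 by simp
    show "small_toggle E B (reg s rK) pivot (reg s4 rW)" using small w4 by simp
  qed (use w4 U in auto)
  then show ?thesis using pos rB by (simp add: choose_pivot_def)
qed

subsection \<open>Output of the new graph\<close>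

definition number :: "nat \<Rightarrow> (nat \<Rightarrow> complex mat) \<Rightarrow> complex mat \<Rightarrow> nat" where
  "number N cl A = (SOME c. c < N \<and> cl c = A)"

lemma number:
  assumes "clifford_numbering N cl" "A \<in> local_clifford"
  shows "number N cl A < N" "cl (number N cl A) = A"
proof -
  have "\<exists>c. c < N \<and> cl c = A" using assms unfolding clifford_numbering_def by (metis imageE lessThan_iff)
  from someI_ex[OF this] show "number N cl A < N" "cl (number N cl A) = A"
    by (simp_all add: number_def)
qed

definition toggle_additions :: "nat \<Rightarrow> bool \<Rightarrow> nat \<Rightarrow> bool \<Rightarrow> nat \<Rightarrow> program" where
  "toggle_additions i pivot k b m = seqs [
     if add_closed_nbhd pivot k b m then Seq (toggle_nbhd i rW) (toggle_vertex rW) else Skip,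
     if add_support pivot b m then Seq (seqs [Const rI 0, Copy rH rB]) (toggle_segment BL) else Skip]"

text \<open>Counts the toggles at \<open>v\<close> without regard to cancellation, so it bounds the
  work at \<open>v\<close> as well as the growth of its degree.\<close>

definition additions :: "nat set set \<Rightarrow> nat set \<Rightarrow> nat \<Rightarrow> bool \<Rightarrow> nat \<Rightarrow> nat \<Rightarrow> nat" where
  "additions E B k pivot w v =
     (if add_closed_nbhd pivot k (v \<in> B) (mark pivot E w v) then Suc (deg E w) else 0) +
     (if add_support pivot (v \<in> B) (mark pivot E w v) then card B else 0)"

lemma wp_toggle_additions:
  assumes st: "stores_state N cl i s n E u" and E: "simple_graph n E" and i: "i \<le> 4"
    and B: "B \<subseteq> {1..n}" and rB: "reg s rB = card B" and bij: "bij_betw (arr s BL) {0..<card B} B"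
    and w: "pivot \<Longrightarrow> reg s rW \<in> {1..n}" and D: "holds_set n s D"
    and b: "b \<longleftrightarrow> v \<in> B" and m: "m = mark pivot E (reg s rW) v"
  shows "wp (toggle_additions i pivot k b m) (\<lambda>t s'. t \<le> 20 + 10 * additions E B k pivot (reg s rW) v \<and>
    holds_set n s' ((D \<triangle> (if add_closed_nbhd pivot k b m then insert (reg s rW) (nbhd E (reg s rW)) else {}))
      \<triangle> (if add_support pivot b m then B else {})) \<and>
    reg s' rL = reg s rL + additions E B k pivot (reg s rW) v \<and>
    unchanged {rS, rL, rI, rH, rX, rY} {PAR, TMP} s s') s"
proof -
  let ?w = "reg s rW"
  let ?A = "if add_closed_nbhd pivot k b m then insert ?w (nbhd E ?w) else {}"
  let ?c = "if add_closed_nbhd pivot k b m then Suc (deg E ?w) else 0"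
  let ?c' = "if add_support pivot b m then card B else 0"
  let ?U = "{rS, rL, rI, rH, rX, rY}"
  let ?p1 = "if add_closed_nbhd pivot k b m then Seq (toggle_nbhd i rW) (toggle_vertex rW) else Skip"
  let ?p2 = "if add_support pivot b m then Seq (seqs [Const rI 0, Copy rH rB]) (toggle_segment BL) else Skip"
  have "wp ?p1 (\<lambda>t s'. t \<le> 13 + 10 * ?c \<and> holds_set n s' (D \<triangle> ?A) \<and> reg s' rL = reg s rL + ?c \<and>
    unchanged ?U {PAR, TMP} s s') s"
  proof (cases "add_closed_nbhd pivot k b m")
    case True
    then have "pivot" by (simp add: add_closed_nbhd_def)
    then have wn: "?w \<in> {1..n}" using w by simp
    have "rW \<notin> {rI, rH}" by simp
    from wp_toggle_nbhd[OF st E i wn this D]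
    obtain t1 s1 where e1: "exec (toggle_nbhd i rW) s t1 s1" and r1: "t1 \<le> 5 + 10 * deg E ?w \<and>
      holds_set n s1 (D \<triangle> nbhd E ?w) \<and> reg s1 rL = reg s rL + deg E ?w \<and> unchanged ?U {PAR, TMP} s s1"
      by (rule wpE)
    have w1: "reg s1 rW = ?w" using r1 by (simp add: unchanged_def)
    have D1: "holds_set n s1 (D \<triangle> nbhd E ?w)" and w1n: "reg s1 rW \<le> n" using r1 w1 wn by simp_all
    obtain t2 s2 where e2: "exec (toggle_vertex rW) s1 t2 s2" and r2: "t2 \<le> 8 \<and>
      holds_set n s2 ((D \<triangle> nbhd E ?w) \<triangle> {reg s1 rW}) \<and> reg s2 rL = Suc (reg s1 rL) \<and>
      unchanged {rS, rL, rX, rY} {PAR, TMP} s1 s2"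
      by (rule wpE[OF wp_toggle_vertex[OF D1 w1n]])
    have "holds_set n s2 (D \<triangle> insert ?w (nbhd E ?w))"
      using r2 unfolding w1 sdiff_insert[OF nbhd_irrefl[OF E]] by blast
    moreover have "unchanged ?U {PAR, TMP} s s2" using r1 r2 by (auto simp: unchanged_def)
    moreover have "t1 + t2 \<le> 13 + 10 * Suc (deg E ?w)" "reg s2 rL = reg s rL + Suc (deg E ?w)"
      using r1 r2 by simp_all
    ultimately have "wp (Seq (toggle_nbhd i rW) (toggle_vertex rW)) (\<lambda>t s'. t \<le> 13 + 10 * Suc (deg E ?w) \<and>
      holds_set n s' (D \<triangle> insert ?w (nbhd E ?w)) \<and> reg s' rL = reg s rL + Suc (deg E ?w) \<and>
      unchanged ?U {PAR, TMP} s s') s"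
      by (intro wp_SeqI[OF e1] wpI[OF e2]) simp
    then show ?thesis using True by (simp only: if_True)
  next
    case False
    then show ?thesis using D by (simp add: unchanged_refl)
  qed
  then obtain t1 s1 where e1: "exec ?p1 s t1 s1" and r1: "t1 \<le> 13 + 10 * ?c \<and> holds_set n s1 (D \<triangle> ?A) \<and>
    reg s1 rL = reg s rL + ?c \<and> unchanged ?U {PAR, TMP} s s1"
    by (rule wpE)
  have "wp ?p2 (\<lambda>t s'. t \<le> 5 + 10 * ?c' \<and> holds_set n s' ((D \<triangle> ?A) \<triangle> (if add_support pivot b m then B else {})) \<and>
    reg s' rL = reg s1 rL + ?c' \<and> unchanged ?U {PAR, TMP} s1 s') s1"
  proof (cases "add_support pivot b m")
    case True
    let ?s2 = "s1\<lparr>reg := (reg s1)(rI := 0, rH := card B)\<rparr>"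
    have rB1: "reg s1 rB = card B" and BL1: "arr s1 BL = arr s BL" using r1 rB by (simp_all add: unchanged_def)
    have "wp (seqs [Const rI 0, Copy rH rB]) (\<lambda>t s'. t = 2 \<and> s' = ?s2) s1" using rB1 by simp
    then have e2: "exec (seqs [Const rI 0, Copy rH rB]) s1 2 ?s2" by (auto simp only: wp_def)
    have D2: "holds_set n ?s2 (D \<triangle> ?A)"
      by (rule holds_set_cong[of _ s1 _ "{rI, rH}" "{}"]) (use r1 in \<open>auto simp: unchanged_def\<close>)
    have im: "arr ?s2 BL ` {0..<card B} = B" and inj: "inj_on (arr ?s2 BL) {0..<card B}"
      using bij BL1 by (simp_all add: bij_betw_def)
    have sub: "arr ?s2 BL ` {0..<card B} \<subseteq> {..n}" unfolding im using B by auto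
    have BL: "BL \<notin> {PAR, TMP}" by simp
    obtain t3 s3 where e3: "exec (toggle_segment BL) ?s2 t3 s3" and r3: "t3 \<le> 1 + 10 * (card B - 0) \<and>
      holds_set n s3 ((D \<triangle> ?A) \<triangle> arr ?s2 BL ` {0..<card B}) \<and> reg s3 rL = reg ?s2 rL + (card B - 0) \<and>
      unchanged {rS, rL, rI, rX, rY} {PAR, TMP} ?s2 s3"
      by (rule wpE[OF wp_toggle_segment[OF D2 _ _ _ inj sub BL]]) simp_all
    have "holds_set n s3 ((D \<triangle> ?A) \<triangle> B)" using r3 unfolding im by blast
    moreover have "unchanged ?U {PAR, TMP} s1 s3" using r3 by (auto simp: unchanged_def)
    moreover have "2 + t3 \<le> 5 + 10 * card B" "reg s3 rL = reg s1 rL + card B" using r3 by simp_all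
    ultimately have "wp (Seq (seqs [Const rI 0, Copy rH rB]) (toggle_segment BL)) (\<lambda>t s'. t \<le> 5 + 10 * card B \<and>
      holds_set n s' ((D \<triangle> ?A) \<triangle> B) \<and> reg s' rL = reg s1 rL + card B \<and> unchanged ?U {PAR, TMP} s1 s') s1"
      by (intro wp_SeqI[OF e2] wpI[OF e3]) simp
    then show ?thesis using True by (simp only: if_True)
  next
    case False
    then show ?thesis using r1 by (simp add: unchanged_refl)
  qed
  then obtain t2 s2 where e2: "exec ?p2 s1 t2 s2" and r2: "t2 \<le> 5 + 10 * ?c' \<and>
    holds_set n s2 ((D \<triangle> ?A) \<triangle> (if add_support pivot b m then B else {})) \<and>
    reg s2 rL = reg s1 rL + ?c' \<and> unchanged ?U {PAR, TMP} s1 s2"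
    by (rule wpE)
  have a: "additions E B k pivot ?w v = ?c + ?c'"
    unfolding additions_def b m by simp
  have "unchanged ?U {PAR, TMP} s s2" using r1 r2 by (auto simp: unchanged_def)
  moreover have "t1 + t2 \<le> 20 + 10 * (?c + ?c')"
    using add_mono[OF conjunct1[OF r1] conjunct1[OF r2]] by (simp only: distrib_left)
  moreover have "reg s2 rL = reg s rL + (?c + ?c')"
  proof -
    have "reg s1 rL = reg s rL + ?c" "reg s2 rL = reg s1 rL + ?c'" using r1 r2 by blast+
    then show ?thesis by (simp only: add.assoc)
  qed
  ultimately show ?thesis unfolding toggle_additions_def a seqs.simps
    using r2 by (intro wp_SeqI[OF e1] wpI[OF e2[unfolded seqs.simps]]) blast
qed

definition update_clifford :: "nat \<Rightarrow> (nat \<Rightarrow> complex mat) \<Rightarrow> nat \<Rightarrow> nat \<Rightarrow> nat \<Rightarrow> (complex mat \<Rightarrow> complex mat) \<Rightarrow> program" where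
  "update_clifford N cl i j v f = seqs [Load rC (3 * i + 2) v,
     switch rC N (\<lambda>c. Const rC (number N cl (f (cl c)))), Store (3 * j + 2) v rC]"

lemma wp_update_clifford:
  assumes cl: "clifford_numbering N cl" and st: "arr s (3 * i + 2) (reg s v) < N"
    and f: "f (cl (arr s (3 * i + 2) (reg s v))) \<in> local_clifford" and v: "v \<notin> {rS, rC}"
  shows "wp (update_clifford N cl i j v f) (\<lambda>t s'. t \<le> 3 + 2 * N \<and> (\<exists>c<N. cl c = f (cl (arr s (3 * i + 2) (reg s v))) \<and>
    arr s' (3 * j + 2) = (arr s (3 * j + 2))(reg s v := c)) \<and> unchanged {rS, rC} {3 * j + 2} s s') s"
proof -
  let ?c = "arr s (3 * i + 2) (reg s v)"
  let ?d = "number N cl (f (cl ?c))"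
  let ?s1 = "s\<lparr>reg := (reg s)(rC := ?c)\<rparr>"
  have e1: "exec (Load rC (3 * i + 2) v) s 1 ?s1" by (rule exec.Load)
  have "wp (switch rC N (\<lambda>c. Const rC (number N cl (f (cl c))))) (\<lambda>t s'. t \<le> 1 + 2 * N \<and> reg s' rC = ?d \<and>
      unchanged {rS, rC} {} s s') ?s1"
    by (rule wp_switch) (use st in \<open>auto simp: unchanged_def\<close>)
  then obtain t2 s2 where e2: "exec (switch rC N (\<lambda>c. Const rC (number N cl (f (cl c))))) ?s1 t2 s2"
    and r2: "t2 \<le> 1 + 2 * N \<and> reg s2 rC = ?d \<and> unchanged {rS, rC} {} s s2"
    by (rule wpE)
  have s2: "reg s2 v = reg s v" "arr s2 = arr s" using r2 v by (auto simp: unchanged_def)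
  have "wp (Store (3 * j + 2) v rC) (\<lambda>t s'. 1 + (t2 + t) \<le> 3 + 2 * N \<and> (\<exists>c<N. cl c = f (cl ?c) \<and>
    arr s' (3 * j + 2) = (arr s (3 * j + 2))(reg s v := c)) \<and> unchanged {rS, rC} {3 * j + 2} s s') s2"
    using r2 number[OF cl f] by (auto simp: s2 unchanged_def intro!: exI[of _ ?d])
  then show ?thesis unfolding update_clifford_def seqs.simps
    by (intro wp_SeqI[OF e1] wp_SeqI[OF e2])
qed

text \<open>The nested case distinctions turn register contents into parameters of the program text,
  so that products of matrices are looked up. Storing 0 among the parities removes \<open>v\<close>
  from its own new neighbourhood.\<close>

definition build_vertex :: "nat \<Rightarrow> (nat \<Rightarrow> complex mat) \<Rightarrow> nat \<Rightarrow> nat \<Rightarrow> program" where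
  "build_vertex N cl i j = seqs [toggle_nbhd i rV, seqs [Load rInB INB rV, Load rMark MK rV],
     switch rP 2 (\<lambda>p. switch rK 4 (\<lambda>k. switch rInB 2 (\<lambda>b. switch rMark 3 (\<lambda>m.
       Seq (toggle_additions i (p = 1) k (b = 1) m)
         (update_clifford N cl i j rV (\<lambda>A. A * correction (p = 1) k (b = 1) m)))))),
     seqs [Const rS 0, Store PAR rV rS],
     emit (3 * j + 1), seqs [Incr rV, Store (3 * j) rV rO]]"

abbreviation build_regs :: "nat set" where
  "build_regs \<equiv> {rS, rL, rI, rH, rX, rY, rC, rInB, rMark, rO, rV}"

lemma wp_build_vertex:
  assumes cl: "clifford_numbering N cl" and st: "stores_state N cl i s n E u" and E: "simple_graph n E"
    and u: "\<And>v. v \<in> {1..n} \<Longrightarrow> u v \<in> local_clifford"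
    and ij: "i \<le> 4" "j \<le> 4" "i \<noteq> j"
    and B: "B \<subseteq> {1..n}" and rB: "reg s rB = card B" and bij: "bij_betw (arr s BL) {0..<card B} B"
    and w: "pivot \<Longrightarrow> reg s rW \<in> {1..n}" and D: "holds_set n s {}" and L: "reg s rL = 0"
    and v: "reg s rV \<in> {1..n}" and P: "reg s rP = of_bool pivot" and k: "reg s rK < 4"
    and inb: "\<And>x. x \<le> n \<Longrightarrow> arr s INB x = of_bool (x \<in> B)"
    and mk: "\<And>x. x \<le> n \<Longrightarrow> arr s MK x = mark pivot E (reg s rW) x"
  defines "cost \<equiv> deg E (reg s rV) + additions E B (reg s rK) pivot (reg s rW) (reg s rV)"
  shows "wp (build_vertex N cl i j) (\<lambda>t s'. t \<le> 70 + 2 * N + 20 * cost \<and>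
    holds_set n s' {} \<and> reg s' rL = 0 \<and> reg s' rV = Suc (reg s rV) \<and>
    reg s rO \<le> reg s' rO \<and>
    bij_betw (arr s' (3 * j + 1)) {reg s rO..<reg s' rO} (new_nbhd pivot (reg s rK) E B (reg s rW) (reg s rV)) \<and>
    (\<forall>p<reg s rO. arr s' (3 * j + 1) p = arr s (3 * j + 1) p) \<and>
    arr s' (3 * j) = (arr s (3 * j))(Suc (reg s rV) := reg s' rO) \<and>
    (\<exists>c<N. cl c = u (reg s rV) * correction pivot (reg s rK) (reg s rV \<in> B) (mark pivot E (reg s rW) (reg s rV)) \<and>
      arr s' (3 * j + 2) = (arr s (3 * j + 2))(reg s rV := c)) \<and>
    unchanged build_regs {PAR, TMP, 3 * j, 3 * j + 1, 3 * j + 2} s s') s"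
proof -
  let ?v = "reg s rV" and ?w = "reg s rW" and ?k = "reg s rK"
  let ?b = "?v \<in> B" and ?m = "mark pivot E ?w ?v"
  let ?add = "additions E B ?k pivot ?w ?v"
  let ?J = "{3 * j, 3 * j + 1, 3 * j + 2}"
  let ?A = "if add_closed_nbhd pivot ?k ?b ?m then insert ?w (nbhd E ?w) else {}"
  let ?S = "if add_support pivot ?b ?m then B else {}"
  have "rV \<notin> {rI, rH}" by simp
  from wp_toggle_nbhd[OF st E ij(1) v this D]
  obtain t1 s1 where e1: "exec (toggle_nbhd i rV) s t1 s1" and r1': "t1 \<le> 5 + 10 * deg E ?v \<and>
    holds_set n s1 ({} \<triangle> nbhd E ?v) \<and> reg s1 rL = reg s rL + deg E ?v \<and>
    unchanged {rS, rL, rI, rH, rX, rY} {PAR, TMP} s s1"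
    by (rule wpE)
  have r1: "t1 \<le> 5 + 10 * deg E ?v" "holds_set n s1 (nbhd E ?v)" "reg s1 rL = deg E ?v"
    "unchanged {rS, rL, rI, rH, rX, rY} {PAR, TMP} s s1"
    using r1' L by simp_all
  let ?s2 = "s1\<lparr>reg := (reg s1)(rInB := of_bool ?b, rMark := ?m)\<rparr>"
  have vn: "?v \<le> n" using v by simp
  have s1: "reg s1 rV = ?v" "arr s1 INB = arr s INB" "arr s1 MK = arr s MK"
    using r1(4) by (simp_all add: unchanged_def)
  have "wp (seqs [Load rInB INB rV, Load rMark MK rV]) (\<lambda>t s'. t = 2 \<and> s' = ?s2) s1"
    using inb[OF vn] mk[OF vn] by (simp add: s1)
  then have e2: "exec (seqs [Load rInB INB rV, Load rMark MK rV]) s1 2 ?s2" by (auto simp only: wp_def)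
  let ?U = "{rS, rL, rI, rH, rX, rY, rC, rInB, rMark}"
  let ?body = "\<lambda>p k b m. Seq (toggle_additions i p k b m)
         (update_clifford N cl i j rV (\<lambda>A. A * correction p k b m))"
  define R where "R s' \<longleftrightarrow> holds_set n s' ((nbhd E ?v \<triangle> ?A) \<triangle> ?S) \<and>
    reg s' rL = deg E ?v + ?add \<and>
    (\<exists>c<N. cl c = u ?v * correction pivot ?k ?b ?m \<and> arr s' (3 * j + 2) = (arr s (3 * j + 2))(?v := c)) \<and>
    unchanged ?U {PAR, TMP, 3 * j + 2} s s'" for s' :: memory
  let ?T = "23 + 2 * N + 10 * ?add"
  have body: "wp (?body pivot ?k ?b ?m) (\<lambda>t s'. t \<le> ?T \<and> R s') s3" if u3: "unchanged {rS, rInB, rMark} {} s1 s3" for s3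
  proof -
    have us: "unchanged ?U {PAR, TMP} s s3" using r1(4) u3 by (auto simp: unchanged_def)
    have st3: "stores_state N cl i s3 n E u"
      by (rule stores_state_cong[OF st us]) (use ij in auto)
    have eq: "reg s3 rB = reg s rB" "reg s3 rW = ?w" "reg s3 rV = ?v" "reg s3 rL = deg E ?v"
      "arr s3 BL = arr s BL"
      using us u3 r1(3) by (simp_all add: unchanged_def)
    have h3: "holds_set n s3 (nbhd E ?v)"
      by (rule holds_set_cong[OF r1(2) u3]) simp_all
    have rB3: "reg s3 rB = card B" and bij3: "bij_betw (arr s3 BL) {0..<card B} B"
      and m3: "?m = mark pivot E (reg s3 rW) ?v"
      using rB bij by (simp_all add: eq)
    have w3: "reg s3 rW \<in> {1..n}" if pivot using w[OF that] by (simp only: eq)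
    obtain t4 s4 where e4: "exec (toggle_additions i pivot ?k ?b ?m) s3 t4 s4" and r4': "t4 \<le> 20 + 10 * additions E B ?k pivot (reg s3 rW) ?v \<and>
      holds_set n s4 ((nbhd E ?v \<triangle> (if add_closed_nbhd pivot ?k ?b ?m then insert (reg s3 rW) (nbhd E (reg s3 rW)) else {}))
        \<triangle> (if add_support pivot ?b ?m then B else {})) \<and>
      reg s4 rL = reg s3 rL + additions E B ?k pivot (reg s3 rW) ?v \<and>
      unchanged {rS, rL, rI, rH, rX, rY} {PAR, TMP} s3 s4"
      by (rule wpE[OF wp_toggle_additions[OF st3 E ij(1) B rB3 bij3 w3 h3 refl m3]])
    note r4 = r4'[unfolded eq]
    have u4: "unchanged ?U {PAR, TMP} s s4" using us r4 by (auto simp: unchanged_def)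
    have v4: "reg s4 rV = ?v" "arr s4 (3 * i + 2) = arr s (3 * i + 2)" "arr s4 (3 * j + 2) = arr s (3 * j + 2)"
      using u4 ij by (auto simp: unchanged_def)
    have num: "arr s (3 * i + 2) ?v < N" "cl (arr s (3 * i + 2) ?v) = u ?v"
      using stores_stateD[OF st v] by simp_all
    have lc: "u ?v * correction pivot ?k ?b ?m \<in> local_clifford"
      using u[OF v] by (intro mult_local_clifford correction_local_clifford)
    have "wp (update_clifford N cl i j rV (\<lambda>A. A * correction pivot ?k ?b ?m)) (\<lambda>t s'. t \<le> 3 + 2 * N \<and>
      (\<exists>c<N. cl c = cl (arr s4 (3 * i + 2) (reg s4 rV)) * correction pivot ?k ?b ?m \<and>
      arr s' (3 * j + 2) = (arr s4 (3 * j + 2))(reg s4 rV := c)) \<and> unchanged {rS, rC} {3 * j + 2} s4 s') s4"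
      by (rule wp_update_clifford[OF cl]) (simp_all only: v4 num lc, simp)
    then obtain t5 s5 where e5: "exec (update_clifford N cl i j rV (\<lambda>A. A * correction pivot ?k ?b ?m)) s4 t5 s5"
      and r5: "t5 \<le> 3 + 2 * N \<and>
      (\<exists>c<N. cl c = cl (arr s4 (3 * i + 2) (reg s4 rV)) * correction pivot ?k ?b ?m \<and>
      arr s5 (3 * j + 2) = (arr s4 (3 * j + 2))(reg s4 rV := c)) \<and> unchanged {rS, rC} {3 * j + 2} s4 s5"
      by (rule wpE)
    have u5: "unchanged {rS, rC} {3 * j + 2} s4 s5" using r5 by blast
    have "holds_set n s5 ((nbhd E ?v \<triangle> ?A) \<triangle> ?S)"
      by (rule holds_set_cong[OF _ u5]) (use r4 ij in auto)
    moreover have "unchanged ?U {PAR, TMP, 3 * j + 2} s s5" using u4 u5 by (auto simp: unchanged_def)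
    moreover have "reg s5 rL = deg E ?v + ?add" using r4 u5 by (simp add: unchanged_def)
    moreover have "\<exists>c<N. cl c = u ?v * correction pivot ?k ?b ?m \<and>
        arr s5 (3 * j + 2) = (arr s (3 * j + 2))(?v := c)"
      using r5 unfolding v4 num by blast
    moreover have "t4 + t5 \<le> ?T" using r4 r5 by simp
    ultimately show ?thesis unfolding R_def by (intro wp_SeqI[OF e4] wpI[OF e5]) blast
  qed
  let ?sw4 = "\<lambda>p k b. switch rMark 3 (\<lambda>m. ?body (p = (1::nat)) k (b = (1::nat)) m)"
  let ?sw3 = "\<lambda>p k. switch rInB 2 (?sw4 p k)"
  let ?sw2 = "\<lambda>p. switch rK 4 (?sw3 p)"
  have m3: "?m < 3" by (simp add: mark_def)
  have regs: "reg s1 rP = of_bool pivot" "reg s1 rK = ?k"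
    using r1(4) P by (simp_all add: unchanged_def)
  \<comment> \<open>The 22 is \<open>4 + 8 + 4 + 6\<close>, the selection costs of the distinctions
    between 2, 4, 2 and 3 values.\<close>
  have "wp (switch rP 2 ?sw2) (\<lambda>t s'. t \<le> ?T + 22 \<and> R s') ?s2"
  proof (rule wp_switch)
    fix z
    let ?s3 = "?s2\<lparr>reg := (reg ?s2)(rS := z)\<rparr>"
    have 1: "wp (?sw2 (of_bool pivot)) (\<lambda>t s'. t \<le> ?T + 18 \<and> R s') ?s3"
    proof (rule wp_switch)
      fix z
      let ?s4 = "?s3\<lparr>reg := (reg ?s3)(rS := z)\<rparr>"
      have 2: "wp (?sw3 (of_bool pivot) ?k) (\<lambda>t s'. t \<le> ?T + 10 \<and> R s') ?s4"
      proof (rule wp_switch)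
        fix z
        let ?s5 = "?s4\<lparr>reg := (reg ?s4)(rS := z)\<rparr>"
        have 3: "wp (?sw4 (of_bool pivot) ?k (of_bool ?b)) (\<lambda>t s'. t \<le> ?T + 6 \<and> R s') ?s5"
        proof (rule wp_switch)
          fix z
          let ?s6 = "?s5\<lparr>reg := (reg ?s5)(rS := z)\<rparr>"
          have "wp (?body pivot ?k ?b ?m) (\<lambda>t s'. t \<le> ?T \<and> R s') ?s6"
            by (rule body) (simp add: unchanged_def)
          moreover have "(of_bool pivot = (1::nat)) = pivot" "(of_bool ?b = (1::nat)) = ?b" by simp_all
          moreover have "reg ?s5 rMark = ?m" by simp
          ultimately show "wp (?body (of_bool pivot = (1::nat)) ?k (of_bool ?b = (1::nat)) (reg ?s5 rMark))
              (\<lambda>t s'. \<forall>c\<le>2 * 3. c + t \<le> ?T + 6 \<and> R s') ?s6"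
            by (simp only:) (erule wp_mono, auto)
        qed (use m3 in simp_all)
        have "reg ?s4 rInB = of_bool ?b" by simp
        then show "wp (?sw4 (of_bool pivot) ?k (reg ?s4 rInB)) (\<lambda>t s'. \<forall>c\<le>2 * 2. c + t \<le> ?T + 10 \<and> R s') ?s5"
          using 3 by (simp only:) (erule wp_mono, auto)
      qed simp_all
      have "reg ?s3 rK = ?k" using regs by simp
      then show "wp (?sw3 (of_bool pivot) (reg ?s3 rK)) (\<lambda>t s'. \<forall>c\<le>2 * 4. c + t \<le> ?T + 18 \<and> R s') ?s4"
        using 2 by (simp only:) (erule wp_mono, auto)
    qed (use k regs in simp_all)
    have "reg ?s2 rP = of_bool pivot" using regs by simp
    then show "wp (?sw2 (reg ?s2 rP)) (\<lambda>t s'. \<forall>c\<le>2 * 2. c + t \<le> ?T + 22 \<and> R s') ?s3"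
      using 1 by (simp only:) (erule wp_mono, auto)
  qed (use regs in simp_all)
  then obtain t3 s3 where e3: "exec (switch rP 2 ?sw2) ?s2 t3 s3" and r3': "t3 \<le> ?T + 22 \<and> R s3"
    by (rule wpE)
  note r3 = conjunct2[OF r3', unfolded R_def]
  let ?D = "(nbhd E ?v \<triangle> ?A) \<triangle> ?S"
  have u3: "unchanged ?U {PAR, TMP, 3 * j + 2} s s3" using r3 by blast
  have v3: "reg s3 rV = ?v" "reg s3 rO = reg s rO" using u3 by (simp_all add: unchanged_def)
  let ?s4 = "s3\<lparr>reg := (reg s3)(rS := 0), arr := (arr s3)(PAR := (arr s3 PAR)(?v := 0))\<rparr>"
  have "wp (seqs [Const rS 0, Store PAR rV rS]) (\<lambda>t s'. t = 2 \<and> s' = ?s4) s3" by (simp add: v3)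
  then have e4: "exec (seqs [Const rS 0, Store PAR rV rS]) s3 2 ?s4" by (auto simp only: wp_def)
  have D3: "holds_set n s3 ?D" using r3 by blast
  have D4: "holds_set n ?s4 (?D - {?v})"
    using D3 unfolding holds_set_def by auto
  have a: "3 * j + 1 \<notin> {PAR, TMP}" using ij by auto
  obtain t5 s5 where e5: "exec (emit (3 * j + 1)) ?s4 t5 s5" and r5: "t5 \<le> 3 + 10 * reg ?s4 rL \<and>
    holds_set n s5 {} \<and> reg s5 rL = 0 \<and>
    reg ?s4 rO \<le> reg s5 rO \<and> bij_betw (arr s5 (3 * j + 1)) {reg ?s4 rO..<reg s5 rO} (?D - {?v}) \<and>
    (\<forall>p<reg ?s4 rO. arr s5 (3 * j + 1) p = arr ?s4 (3 * j + 1) p) \<and>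
    unchanged {rS, rL, rI, rX, rY, rO} {PAR, 3 * j + 1} ?s4 s5"
    by (rule wpE[OF wp_emit[OF D4 a]])
  have u5: "unchanged {rS, rL, rI, rX, rY, rO} {PAR, 3 * j + 1} ?s4 s5" using r5 by blast
  have o4: "reg ?s4 rO = reg s rO" "reg ?s4 rL = cost" using v3 r3 by (simp_all add: cost_def)
  have nn: "?D - {?v} = new_nbhd pivot ?k E B ?w ?v" by (simp only: new_nbhd_def)
  have v5: "reg s5 rV = ?v" using u5 v3 by (simp add: unchanged_def)
  have a4: "arr ?s4 (3 * j + 1) = arr s (3 * j + 1)"
    using u3 ij by (auto simp: unchanged_def)
  have a5: "arr s5 (3 * j) = arr s (3 * j)" "arr s5 (3 * j + 2) = arr s3 (3 * j + 2)"
    using u3 u5 ij by (auto simp: unchanged_def)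
  let ?s6 = "s5\<lparr>reg := (reg s5)(rV := Suc ?v), arr := (arr s5)(3 * j := (arr s5 (3 * j))(Suc ?v := reg s5 rO))\<rparr>"
  have "wp (seqs [Incr rV, Store (3 * j) rV rO]) (\<lambda>t s'. t = 2 \<and> s' = ?s6) s5" by (simp add: v5)
  then have e6: "exec (seqs [Incr rV, Store (3 * j) rV rO]) s5 2 ?s6" by (auto simp only: wp_def)
  have T: "t1 + (2 + (t3 + (2 + (t5 + 2)))) \<le> 70 + 2 * N + 20 * cost"
    using r1(1) r3' r5 o4(2) by (simp add: cost_def)
  have j: "3 * j \<notin> {PAR, TMP}" using ij by auto
  have H: "holds_set n ?s6 {}"
    by (rule holds_set_cong[of _ s5 _ "{rV}" "{3 * j}"]) (use r5 j in \<open>auto simp: unchanged_def\<close>)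
  have U6: "unchanged build_regs {PAR, TMP, 3 * j, 3 * j + 1, 3 * j + 2} s ?s6"
    using u3 u5 by (auto simp: unchanged_def)
  have c6: "\<exists>c<N. cl c = u ?v * correction pivot ?k ?b ?m \<and> arr ?s6 (3 * j + 2) = (arr s (3 * j + 2))(?v := c)"
    using r3 a5(2) by auto
  have b6: "bij_betw (arr ?s6 (3 * j + 1)) {reg s rO..<reg ?s6 rO} (new_nbhd pivot ?k E B ?w ?v)"
    using r5 unfolding nn o4 by simp
  have p6: "\<forall>p<reg s rO. arr ?s6 (3 * j + 1) p = arr s (3 * j + 1) p"
    using r5 unfolding o4 a4 by simp
  have o6: "reg s rO \<le> reg ?s6 rO" "arr ?s6 (3 * j) = (arr s (3 * j))(Suc ?v := reg ?s6 rO)"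
    "reg ?s6 rL = 0" "reg ?s6 rV = Suc ?v"
    using r5 a5(1) o4 by simp_all
  show ?thesis unfolding build_vertex_def seqs.simps
    by (intro wp_SeqI[OF e1] wp_SeqI[OF e2[unfolded seqs.simps]] wp_SeqI[OF e3] wp_SeqI[OF e4[unfolded seqs.simps]]
      wp_SeqI[OF e5] wpI[OF e6[unfolded seqs.simps]] conjI T H U6 c6 b6 p6 o6)
qed

definition build :: "nat \<Rightarrow> (nat \<Rightarrow> complex mat) \<Rightarrow> nat \<Rightarrow> nat \<Rightarrow> program" where
  "build N cl i j = Seq (seqs [Const rO 0, Const rV 1, Store (3 * j) rV rO, Copy rE 0, Incr rE])
     (While_less rV rE (build_vertex N cl i j))"

lemma wp_build:
  assumes cl: "clifford_numbering N cl" and st: "stores_state N cl i s n E u" and E: "simple_graph n E"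
    and u: "\<And>v. v \<in> {1..n} \<Longrightarrow> u v \<in> local_clifford"
    and ij: "i \<le> 4" "j \<le> 4" "i \<noteq> j"
    and B: "B \<subseteq> {1..n}" and rB: "reg s rB = card B" and bij: "bij_betw (arr s BL) {0..<card B} B"
    and w: "pivot \<Longrightarrow> reg s rW \<in> {1..n}" and D: "holds_set n s {}" and L: "reg s rL = 0"
    and n: "reg s 0 = n" and P: "reg s rP = of_bool pivot" and k: "reg s rK < 4"
    and inb: "\<And>x. x \<le> n \<Longrightarrow> arr s INB x = of_bool (x \<in> B)"
    and mk: "\<And>x. x \<le> n \<Longrightarrow> arr s MK x = mark pivot E (reg s rW) x"
    and E': "\<And>v. v \<in> {1..n} \<Longrightarrow> nbhd E' v = new_nbhd pivot (reg s rK) E B (reg s rW) v"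
  shows "wp (build N cl i j) (\<lambda>t s'.
    t \<le> 6 + (\<Sum>v = 1..n. 71 + 2 * N + 20 * (deg E v + additions E B (reg s rK) pivot (reg s rW) v)) \<and>
    stores_state N cl j s' n E'
      (\<lambda>v. u v * correction pivot (reg s rK) (v \<in> B) (mark pivot E (reg s rW) v)) \<and>
    unchanged (insert rE build_regs) {PAR, TMP, 3 * j, 3 * j + 1, 3 * j + 2} s s') s"
proof -
  let ?k = "reg s rK" and ?w = "reg s rW"
  let ?N = "new_nbhd pivot ?k E B ?w"
  let ?u = "\<lambda>v. u v * correction pivot ?k (v \<in> B) (mark pivot E ?w v)"
  let ?J = "{PAR, TMP, 3 * j, 3 * j + 1, 3 * j + 2}"
  let ?s1 = "s\<lparr>reg := (reg s)(rO := 0, rV := 1, rE := Suc n), arr := (arr s)(3 * j := (arr s (3 * j))(1 := 0))\<rparr>"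
  let ?init = "seqs [Const rO 0, Const rV 1, Store (3 * j) rV rO, Copy rE 0, Incr rE]"
  have "wp ?init (\<lambda>t s'. t = 5 \<and> s' = ?s1) s" using n by (simp add: fun_upd_twist)
  then have e1: "exec ?init s 5 ?s1" by (auto simp only: wp_def)
  define finished where "finished s' v \<longleftrightarrow> arr s' (3 * j) v \<le> arr s' (3 * j) (Suc v) \<and>
    bij_betw (arr s' (3 * j + 1)) {arr s' (3 * j) v..<arr s' (3 * j) (Suc v)} (?N v) \<and>
    arr s' (3 * j + 2) v < N \<and> cl (arr s' (3 * j + 2) v) = ?u v" for s' :: memory and v
  \<comment> \<open>All offsets written so far are at most the output position \<open>rO\<close>,
    and a later vertex writes only from there on. Hence finished lists stay intact.\<close>
  let ?I = "\<lambda>a s'. unchanged build_regs ?J ?s1 s' \<and> reg s' rV = a \<and> holds_set n s' {} \<and> reg s' rL = 0 \<and>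
    arr s' (3 * j) 1 = 0 \<and> arr s' (3 * j) a = reg s' rO \<and>
    (\<forall>v\<in>{1..a}. arr s' (3 * j) v \<le> reg s' rO) \<and> (\<forall>v\<in>{1..<a}. finished s' v)"
  let ?cost = "\<lambda>v. 70 + 2 * N + 20 * (deg E v + additions E B ?k pivot ?w v)"
  have "wp (While_less rV rE (build_vertex N cl i j))
    (\<lambda>t s'. t \<le> 1 + (\<Sum>v = 1..<Suc n. Suc (?cost v)) \<and> ?I (Suc n) s') ?s1"
  proof (rule wp_while[where I = ?I and lo = 1 and hi = "Suc n"])
    have "3 * j \<notin> {PAR, TMP}" using ij by auto
    then have "holds_set n ?s1 {}"
      by (intro holds_set_cong[OF D, of "{rO, rV, rE}" "{3 * j}"]) (auto simp: unchanged_def)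
    then show "?I 1 ?s1" using L by (simp add: unchanged_refl)
  next
    fix a s' assume "?I a s'"
    then show "reg s' rV < reg s' rE \<longleftrightarrow> a < Suc n" by (simp add: unchanged_def)
  next
    fix a s2 assume I: "?I a s2" and a: "1 \<le> a" "a < Suc n"
    have us: "unchanged (insert rE build_regs) ?J s s2" using I by (auto simp: unchanged_def)
    have ij': "{3 * i, 3 * i + 1, 3 * i + 2} \<inter> ?J = {}" using ij by auto
    have st2: "stores_state N cl i s2 n E u" by (rule stores_state_cong[OF st us ij'])
    have BJ: "BL \<notin> ?J" "INB \<notin> ?J" "MK \<notin> ?J" using ij by auto
    have eq: "reg s2 rB = reg s rB" "reg s2 rW = ?w" "reg s2 rK = ?k" "reg s2 rP = reg s rP" "reg s2 rV = a"
      "arr s2 BL = arr s BL" "arr s2 INB = arr s INB" "arr s2 MK = arr s MK"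
      using I unchangedD(1)[OF us] unchangedD(2)[OF us] BJ by auto
    have D2: "holds_set n s2 {}" and L2: "reg s2 rL = 0" using I by blast+
    have "wp (build_vertex N cl i j) (\<lambda>t s'. t \<le> 70 + 2 * N + 20 * (deg E (reg s2 rV) +
        additions E B (reg s2 rK) pivot (reg s2 rW) (reg s2 rV)) \<and>
      holds_set n s' {} \<and> reg s' rL = 0 \<and> reg s' rV = Suc (reg s2 rV) \<and>
      reg s2 rO \<le> reg s' rO \<and>
      bij_betw (arr s' (3 * j + 1)) {reg s2 rO..<reg s' rO} (new_nbhd pivot (reg s2 rK) E B (reg s2 rW) (reg s2 rV)) \<and>
      (\<forall>p<reg s2 rO. arr s' (3 * j + 1) p = arr s2 (3 * j + 1) p) \<and>
      arr s' (3 * j) = (arr s2 (3 * j))(Suc (reg s2 rV) := reg s' rO) \<and>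
      (\<exists>c<N. cl c = u (reg s2 rV) * correction pivot (reg s2 rK) (reg s2 rV \<in> B) (mark pivot E (reg s2 rW) (reg s2 rV)) \<and>
        arr s' (3 * j + 2) = (arr s2 (3 * j + 2))(reg s2 rV := c)) \<and>
      unchanged build_regs {PAR, TMP, 3 * j, 3 * j + 1, 3 * j + 2} s2 s') s2"
      by (rule wp_build_vertex[OF cl st2 E u ij B _ _ _ D2 L2])
        (use rB bij w a P k inb mk in \<open>simp_all only: eq, simp_all\<close>)
    then show "wp (build_vertex N cl i j) (\<lambda>t s'. t \<le> ?cost a \<and> ?I (Suc a) s') s2"
    proof (rule wp_mono)
      fix t s'
      let ?o = "reg s2 rO"
      assume "t \<le> 70 + 2 * N + 20 * (deg E (reg s2 rV) +
        additions E B (reg s2 rK) pivot (reg s2 rW) (reg s2 rV)) \<and>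
      holds_set n s' {} \<and> reg s' rL = 0 \<and> reg s' rV = Suc (reg s2 rV) \<and>
      reg s2 rO \<le> reg s' rO \<and>
      bij_betw (arr s' (3 * j + 1)) {reg s2 rO..<reg s' rO} (new_nbhd pivot (reg s2 rK) E B (reg s2 rW) (reg s2 rV)) \<and>
      (\<forall>p<reg s2 rO. arr s' (3 * j + 1) p = arr s2 (3 * j + 1) p) \<and>
      arr s' (3 * j) = (arr s2 (3 * j))(Suc (reg s2 rV) := reg s' rO) \<and>
      (\<exists>c<N. cl c = u (reg s2 rV) * correction pivot (reg s2 rK) (reg s2 rV \<in> B) (mark pivot E (reg s2 rW) (reg s2 rV)) \<and>
        arr s' (3 * j + 2) = (arr s2 (3 * j + 2))(reg s2 rV := c)) \<and>
      unchanged build_regs {PAR, TMP, 3 * j, 3 * j + 1, 3 * j + 2} s2 s'"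
      note r = this[unfolded eq]
      obtain c where c: "c < N" "cl c = ?u a" "arr s' (3 * j + 2) = (arr s2 (3 * j + 2))(a := c)" using r by blast
      have off: "arr s' (3 * j) = (arr s2 (3 * j))(Suc a := reg s' rO)" and o: "?o \<le> reg s' rO"
        and bijN: "bij_betw (arr s' (3 * j + 1)) {?o..<reg s' rO} (?N a)"
        and adj: "\<And>p. p < ?o \<Longrightarrow> arr s' (3 * j + 1) p = arr s2 (3 * j + 1) p"
        using r by blast+
      have I': "arr s2 (3 * j) a = ?o" "arr s2 (3 * j) 1 = 0"
        "\<And>v. v \<in> {1..a} \<Longrightarrow> arr s2 (3 * j) v \<le> ?o" "\<And>v. v \<in> {1..<a} \<Longrightarrow> finished s2 v"
        using I by blast+
      have "finished s' v" if v: "v \<in> {1..<Suc a}" for v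
      proof (cases "v = a")
        case True
        then show ?thesis using bijN o c I'(1) by (simp add: finished_def off)
      next
        case False
        then have v: "v \<in> {1..<a}" using v by auto
        have "arr s2 (3 * j) (Suc v) \<le> ?o" using v by (intro I'(3)) auto
        then have "bij_betw (arr s' (3 * j + 1)) {arr s2 (3 * j) v..<arr s2 (3 * j) (Suc v)} (?N v)"
          using I'(4)[OF v] adj by (subst bij_betw_cong[where g = "arr s2 (3 * j + 1)"]) (auto simp: finished_def)
        moreover have "arr s' (3 * j + 2) v = arr s2 (3 * j + 2) v" unfolding c(3) using False by simp
        ultimately show ?thesis using I'(4)[OF v] v by (simp add: finished_def off)
      qed
      moreover have "arr s' (3 * j) v \<le> reg s' rO" if "v \<in> {1..Suc a}" for v
        using I'(3)[of v] o that by (cases "v = Suc a") (auto simp: off)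
      moreover have "unchanged build_regs ?J ?s1 s'"
        using I r by (auto simp: unchanged_def)
      ultimately show "t \<le> ?cost a \<and> ?I (Suc a) s'"
        using r I'(2) a by (simp add: off)
    qed
  qed simp
  then obtain t2 s2 where e2: "exec (While_less rV rE (build_vertex N cl i j)) ?s1 t2 s2"
    and r2: "t2 \<le> 1 + (\<Sum>v = 1..<Suc n. Suc (?cost v)) \<and> ?I (Suc n) s2"
    by (rule wpE)
  have "stores_state N cl j s2 n E' ?u"
    unfolding stores_state_def Let_def
  proof (intro conjI ballI)
    show "arr s2 (3 * j) 1 = 0" using r2 by blast
    fix v assume v: "v \<in> {1..n}"
    then have "finished s2 v" using r2 by auto
    then show "arr s2 (3 * j) v \<le> arr s2 (3 * j) (v + 1)"
      "bij_betw (arr s2 (3 * j + 1)) {arr s2 (3 * j) v..<arr s2 (3 * j) (v + 1)} (nbhd E' v)"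
      "arr s2 (3 * j + 2) v < N" "cl (arr s2 (3 * j + 2) v) = ?u v"
      unfolding E'[OF v] by (simp_all add: finished_def)
  qed
  moreover have "unchanged (insert rE build_regs) ?J s s2" using r2 by (auto simp: unchanged_def)
  moreover have "{1..<Suc n} = {1..n}" by auto
  then have "5 + t2 \<le> 6 + (\<Sum>v = 1..n. 71 + 2 * N + 20 * (deg E v + additions E B ?k pivot ?w v))"
    using r2 by (simp add: add.assoc)
  ultimately show ?thesis unfolding build_def by (intro wp_SeqI[OF e1] wpI[OF e2]) blast
qed

subsection \<open>One projection\<close>

definition degree_sum :: "nat \<Rightarrow> nat set set \<Rightarrow> nat" where
  "degree_sum n E = (\<Sum>v = 1..n. deg E v)"

lemma sum_if_le:
  fixes c :: nat
  assumes "finite A" "finite Y" "\<And>v. v \<in> A \<Longrightarrow> P v \<Longrightarrow> v \<in> Y"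
  shows "(\<Sum>v\<in>A. if P v then c else 0) \<le> card Y * c"
proof -
  have "(\<Sum>v\<in>A. if P v then c else 0) = card {v \<in> A. P v} * c"
    using assms(1) by (simp add: sum.If_cases Collect_conj_eq Int_commute)
  also have "\<dots> \<le> card Y * c"
    using assms by (intro mult_le_mono1 card_mono) auto
  finally show ?thesis .
qed

text \<open>With a pivot, only vertices of \<open>B\<close>, or of \<open>M\<close> if
  \<open>k\<close> is odd, receive \<open>M\<close>, and only vertices of \<open>M\<close> receive
  \<open>B\<close>: at most \<open>|B| |M| + |M|^2 + |M| |B|\<close> additions, where the square
  occurs for odd \<open>k\<close> only. Without a pivot there are at most \<open>|B|^2\<close>. By
  \<open>small_toggle\<close> each of these products is at most the sum on the right.\<close>

lemma sum_additions:
  assumes E: "simple_graph n E" and B: "B \<subseteq> {1..n}" and small: "small_toggle E B k pivot w"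
  shows "(\<Sum>v = 1..n. additions E B k pivot w v) \<le> 3 * (\<Sum>x\<in>B. Suc (deg E x))"
proof -
  let ?S = "\<Sum>x\<in>B. Suc (deg E x)"
  let ?M = "insert w (nbhd E w)"
  have fB: "finite B" using B by (rule finite_subset) simp
  have fM: "finite ?M" using nbhd_finite[OF E] by simp
  have cM: "card ?M = Suc (deg E w)" using nbhd_finite[OF E] nbhd_irrefl[OF E] by simp
  have s: "(\<Sum>v = 1..n. additions E B k pivot w v) =
    (\<Sum>v = 1..n. if add_closed_nbhd pivot k (v \<in> B) (mark pivot E w v) then Suc (deg E w) else 0) +
    (\<Sum>v = 1..n. if add_support pivot (v \<in> B) (mark pivot E w v) then card B else 0)"
    unfolding additions_def by (rule sum.distrib)
  show ?thesis
  proof (cases pivot)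
    case True
    let ?Y = "B \<union> (if odd k then ?M else {})"
    have mk: "0 < mark pivot E w v \<longleftrightarrow> v \<in> ?M" for v using True by (simp add: mark_def)
    have sm: "card B * Suc (deg E w) \<le> ?S" "odd k \<Longrightarrow> Suc (deg E w) * Suc (deg E w) \<le> ?S"
      using small True by (simp_all add: small_toggle_def Let_def)
    have "(\<Sum>v = 1..n. if add_closed_nbhd pivot k (v \<in> B) (mark pivot E w v) then Suc (deg E w) else 0)
        \<le> card ?Y * Suc (deg E w)"
      using fB fM by (intro sum_if_le) (auto simp: add_closed_nbhd_def mk)
    also have "\<dots> \<le> (card B + (if odd k then Suc (deg E w) else 0)) * Suc (deg E w)"
      using card_Un_le[of B ?M] cM by (intro mult_le_mono1) auto
    also have "\<dots> \<le> 2 * ?S"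
    proof -
      have "(b + (if odd k then e else 0)) * e \<le> 2 * S" if "b * e \<le> S" "odd k \<Longrightarrow> e * e \<le> S" for b e S :: nat
        using that by (cases "odd k") (simp_all add: add_mult_distrib)
      from this[OF sm] show ?thesis .
    qed
    finally have 1: "(\<Sum>v = 1..n. if add_closed_nbhd pivot k (v \<in> B) (mark pivot E w v) then Suc (deg E w) else 0)
      \<le> 2 * ?S" .
    have "(\<Sum>v = 1..n. if add_support pivot (v \<in> B) (mark pivot E w v) then card B else 0) \<le> card ?M * card B"
      using fM True by (intro sum_if_le) (auto simp: add_support_def mark_def split: if_splits)
    also have "\<dots> \<le> ?S" using sm(1) unfolding cM by (simp only: mult.commute)
    finally show ?thesis unfolding s using 1 by linarith
  next
    case False
    have "(\<Sum>v = 1..n. if add_support pivot (v \<in> B) (mark pivot E w v) then card B else 0) \<le> card B * card B"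
      using fB False by (intro sum_if_le) (auto simp: add_support_def)
    also have "\<dots> \<le> ?S" using small False by (simp add: small_toggle_def Let_def)
    finally show ?thesis unfolding s using False by (simp add: add_closed_nbhd_def)
  qed
qed

lemma sum_support_le:
  assumes B: "B \<subseteq> {1..n}"
  shows "(\<Sum>x\<in>B. Suc (deg E x)) \<le> degree_sum n E + n"
proof -
  have "(\<Sum>x\<in>B. Suc (deg E x)) \<le> (\<Sum>x = 1..n. Suc (deg E x))"
    using B by (intro sum_mono2) auto
  also have "\<dots> = degree_sum n E + n"
    unfolding degree_sum_def by (simp add: sum_Suc)
  finally show ?thesis .
qed

lemma card_sdiff_le: "finite A \<Longrightarrow> finite B \<Longrightarrow> card (A \<triangle> B) \<le> card A + card B"
  by (rule order_trans[OF card_mono[of "A \<union> B"] card_Un_le]) auto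

lemma card_new_nbhd_le:
  assumes E: "simple_graph n E" and B: "B \<subseteq> {1..n}"
  shows "card (new_nbhd pivot k E B w v) \<le> deg E v + additions E B k pivot w v"
proof -
  let ?A = "if add_closed_nbhd pivot k (v \<in> B) (mark pivot E w v) then insert w (nbhd E w) else {}"
  let ?C = "if add_support pivot (v \<in> B) (mark pivot E w v) then B else {}"
  have fB: "finite B" using B by (rule finite_subset) simp
  have f: "finite (nbhd E v)" "finite ?A" "finite ?C" using nbhd_finite[OF E] fB by simp_all
  have "card (new_nbhd pivot k E B w v) \<le> card ((nbhd E v \<triangle> ?A) \<triangle> ?C)"
    unfolding new_nbhd_def using f by (intro card_mono) auto
  also have "\<dots> \<le> card (nbhd E v) + card ?A + card ?C"
    using card_sdiff_le[OF f(1,2)] card_sdiff_le[OF finite_sdiff[OF f(1,2)] f(3)] by linarith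
  also have "\<dots> = deg E v + additions E B k pivot w v"
    unfolding additions_def using nbhd_finite[OF E] nbhd_irrefl[OF E, of w] by simp
  finally show ?thesis .
qed

section \<open>The program for one factor\<close>

definition stage_program :: "nat \<Rightarrow> (nat \<Rightarrow> complex mat) \<Rightarrow> nat \<Rightarrow> nat \<Rightarrow> nat \<times> (bool \<times> nat) list \<Rightarrow> program" where
  "stage_program N cl i j st = seqs [clear, Const rK (fst st), apply_paulis N cl i (snd st),
     list_support, choose_pivot i, build N cl i j]"

text \<open>Chosen with room to spare: it dominates, separately, the coefficients of 1,
  \<open>n\<close> and \<open>d\<close> in the summed bounds of the six parts of a stage.\<close>

definition stage_time :: "nat \<Rightarrow> nat \<times> (bool \<times> nat) list \<Rightarrow> nat" where
  "stage_time N st = 200 + 100 * length (snd st) + 2 * N * Suc (length (snd st))"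

text \<open>The scalar absorbs all normalisations and may be 0. As \<open>d\<close> is only a bound
  for the degree sum, the stages can be chained although the actual graphs are unknown.\<close>

definition holds_state ::
  "nat \<Rightarrow> (nat \<Rightarrow> complex mat) \<Rightarrow> nat \<Rightarrow> memory \<Rightarrow> nat \<Rightarrow> nat \<Rightarrow> (nat set \<Rightarrow> complex) \<Rightarrow> bool" where
  "holds_state N cl j s n d \<psi> \<longleftrightarrow> (\<exists>E u c. simple_graph n E \<and> (\<forall>v\<in>{1..n}. u v \<in> local_clifford) \<and>
     stores_state N cl j s n E u \<and> degree_sum n E \<le> d \<and>
     (\<forall>X\<subseteq>{1..n}. \<psi> X = c * tensor_amp n u (graph_sign E) X))"

lemma wp_stage_program:
  assumes cl: "clifford_numbering N cl" and h: "holds_state N cl i s n d \<psi>"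
    and ij: "i \<le> 4" "j \<le> 4" "i \<noteq> j" and n: "reg s 0 = n" and \<sigma>: "fst st < 4"
    and ps: "\<And>p. p \<in> set (snd st) \<Longrightarrow> snd p \<le> 3 \<and> reg s (snd p) \<in> {1..n}"
  shows "wp (stage_program N cl i j st) (\<lambda>t s'. t \<le> stage_time N st * (n + 1 + d) \<and>
    holds_state N cl j s' n (4 * d + 3 * n)
      (stage (fst st) (map (map_prod id (reg s)) (snd st)) \<psi>) \<and>
    unchanged {rS..rE} ({3 * j, 3 * j + 1, 3 * j + 2} \<union> {PAR..MK}) s s') s"
proof -
  from h obtain E u c where E: "simple_graph n E" and u: "\<And>v. v \<in> {1..n} \<Longrightarrow> u v \<in> local_clifford"
    and st: "stores_state N cl i s n E u" and d: "degree_sum n E \<le> d"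
    and c: "\<And>X. X \<subseteq> {1..n} \<Longrightarrow> \<psi> X = c * tensor_amp n u (graph_sign E) X"
    unfolding holds_state_def by blast
  let ?ps = "snd st" and ?\<sigma> = "fst st" and ?l = "length (snd st)"
  let ?qs = "map (map_prod id (reg s)) ?ps"
  have qs: "snd p \<in> {1..n}" if "p \<in> set ?qs" for p using that ps by auto
  obtain t1 s1 where e1: "exec clear s t1 s1" and r1: "t1 \<le> 20 + 5 * n \<and> holds_set n s1 {} \<and> reg s1 rL = 0 \<and>
    reg s1 rO = 0 \<and> reg s1 rOne = 1 \<and> (\<forall>x\<le>n. arr s1 INB x = 0 \<and> arr s1 MK x = 0) \<and>
    unchanged {rI, rH, rS, rL, rO, rOne} {PAR, INB, MK} s s1"
    by (rule wpE[OF wp_clear[OF n]])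
  let ?s2 = "s1\<lparr>reg := (reg s1)(rK := ?\<sigma>)\<rparr>"
  have e2: "exec (Const rK ?\<sigma>) s1 1 ?s2" by (rule exec.Const)
  have u2: "unchanged {rI, rH, rS, rL, rO, rOne, rK} {PAR, INB, MK} s ?s2"
    using r1 by (simp add: unchanged_def)
  have sep: "{3 * i, 3 * i + 1, 3 * i + 2} \<inter> {PAR..MK} = {}" using ij by auto
  have st2: "stores_state N cl i ?s2 n E u"
    by (rule stores_state_cong[OF st u2]) (use ij in auto)
  have q2: "reg ?s2 r = reg s r" if "r \<le> 3" for r
    using unchangedD(1)[OF u2, of r] that by auto
  have ps2: "snd p \<le> 3 \<and> reg ?s2 (snd p) \<in> {1..n}" if "p \<in> set ?ps" for p
    using ps[OF that] q2 by simp
  have m2: "map (map_prod id (reg ?s2)) ?ps = ?qs"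
  proof (intro map_cong refl)
    fix p assume "p \<in> set ?ps"
    then have "reg ?s2 (snd p) = reg s (snd p)" using ps q2 by blast
    then show "map_prod id (reg ?s2) p = map_prod id (reg s) p" by (cases p) simp
  qed
  have h2: "holds_set n ?s2 {}"
    by (rule holds_set_cong[of _ s1 _ "{rK}" "{}"]) (use r1 in \<open>auto simp: unchanged_def\<close>)
  obtain k B where kB: "fold (track (nbhd E) u) ?qs (?\<sigma>, {}) = (k, B)" by fastforce
  have kB2: "(k, B) = fold (track (nbhd E) u) (map (map_prod id (reg ?s2)) ?ps) (reg ?s2 rK, {})"
    unfolding m2 using kB by simp
  have \<sigma>2: "reg ?s2 rK < 4" using \<sigma> by simp
  obtain t3 s3 where e3: "exec (apply_paulis N cl i ?ps) ?s2 t3 s3" and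
    r3: "t3 \<le> 1 + ?l * (50 + 2 * N + 10 * n) \<and> holds_set n s3 (snd (k, B)) \<and> reg s3 rK = fst (k, B) \<and>
      reg s3 rL \<le> reg ?s2 rL + ?l * (n + 1) \<and>
      unchanged {rS, rK, rL, rI, rH, rX, rY, rC, rQ} {PAR, TMP} ?s2 s3"
    by (rule wpE[OF wp_apply_paulis[OF st2 E ij(1) ps2 h2 \<sigma>2 kB2]])
  have B: "B \<subseteq> {1..n}" and k: "k < 4"
    using fold_track_le[of ?qs n "nbhd E" "(?\<sigma>, {})" u] qs nbhd_le[OF E] \<sigma> unfolding kB by auto
  have cB: "card B \<le> n" using card_mono[OF _ B] by simp
  have h3: "holds_set n s3 B" "reg s3 rK = k" using r3 by simp_all
  have g3: "reg s3 rO = 0" "reg s3 rOne = 1" "reg s3 rL \<le> ?l * (n + 1)"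
    "\<And>x. x \<le> n \<Longrightarrow> arr s3 INB x = 0" "\<And>x. x \<le> n \<Longrightarrow> arr s3 MK x = 0"
    using r3 r1 by (simp_all add: unchanged_def)
  obtain t4 s4 where e4: "exec list_support s3 t4 s4" and r4: "t4 \<le> 10 + 10 * reg s3 rL + 4 * card B \<and>
    holds_set n s4 {} \<and> reg s4 rL = 0 \<and>
    reg s4 rB = card B \<and> bij_betw (arr s4 BL) {0..<card B} B \<and> (\<forall>x\<le>n. arr s4 INB x = of_bool (x \<in> B)) \<and>
    unchanged {rS, rL, rI, rH, rX, rY, rO, rB} {PAR, BL, INB} s3 s4"
    by (rule wpE[OF wp_list_support[OF h3(1) g3(1,2,4)]])
  have u4: "unchanged {rS..rE} {PAR..MK} s s4"
    using u2 r3 r4 by (auto simp: unchanged_def)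
  have st4: "stores_state N cl i s4 n E u" by (rule stores_state_cong[OF st u4 sep])
  have n4: "reg s4 0 = n" using u4 n by (simp add: unchanged_def)
  have b4: "reg s4 rB = card B" "bij_betw (arr s4 BL) {0..<card B} B" using r4 by blast+
  have k4: "reg s4 rK = k" "reg s4 rOne = 1" using r4 h3 g3 by (simp_all add: unchanged_def)
  have z4: "\<And>x. x \<le> n \<Longrightarrow> arr s4 MK x = 0" using r4 g3 by (simp add: unchanged_def)
  have k4': "reg s4 rK < 4" using k4 k by simp
  obtain t5 s5 where e5: "exec (choose_pivot i) s4 t5 s5" and r5: "t5 \<le> 60 + 20 * (\<Sum>x\<in>B. Suc (deg E x)) \<and>
    (\<exists>pivot. reg s5 rP = of_bool pivot \<and> (if pivot then reg s5 rW \<in> B else B = {} \<or> odd (reg s4 rK)) \<and>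
      (\<forall>x\<le>n. arr s5 MK x = mark pivot E (reg s5 rW) x) \<and> small_toggle E B (reg s4 rK) pivot (reg s5 rW)) \<and>
    unchanged {rS, rI, rH, rX, rG, rD, rW, rQ, rP} {MK} s4 s5"
    by (rule wpE[OF wp_choose_pivot[OF st4 E ij(1) n4 B b4 k4(2) z4 k4']])
  then obtain pivot where p5: "reg s5 rP = of_bool pivot" "if pivot then reg s5 rW \<in> B else B = {} \<or> odd k"
    "\<And>x. x \<le> n \<Longrightarrow> arr s5 MK x = mark pivot E (reg s5 rW) x" "small_toggle E B k pivot (reg s5 rW)"
    unfolding k4 by blast
  let ?w = "reg s5 rW"
  have u5': "unchanged {rS, rI, rH, rX, rG, rD, rW, rQ, rP} {MK} s4 s5" using r5 by blast
  have u5: "unchanged {rS..rE} {PAR..MK} s s5" using u4 u5' by (auto simp: unchanged_def)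
  have st5: "stores_state N cl i s5 n E u" by (rule stores_state_cong[OF st u5 sep])
  have g5: "reg s5 rB = card B" "bij_betw (arr s5 BL) {0..<card B} B" "reg s5 rL = 0" "reg s5 0 = n"
    "reg s5 rK = k" "\<And>x. x \<le> n \<Longrightarrow> arr s5 INB x = of_bool (x \<in> B)"
    using r4 u5' n4 k4 by (simp_all add: unchanged_def)
  have h5: "holds_set n s5 {}" by (rule holds_set_cong[OF _ u5']) (use r4 in auto)
  have w5: "?w \<in> {1..n}" if pivot using p5(2) that B by auto
  obtain E' c' where E': "simple_graph n E'"
    and nb: "\<And>v. v \<in> {1..n} \<Longrightarrow> nbhd E' v = new_nbhd pivot k E B ?w v"
    and c': "\<And>X. X \<subseteq> {1..n} \<Longrightarrow> stage ?\<sigma> ?qs (tensor_amp n u (graph_sign E)) X =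
       c' * tensor_amp n (\<lambda>v. u v * correction pivot k (v \<in> B) (mark pivot E ?w v)) (graph_sign E') X"
    using stage_reduction[OF E u qs \<sigma> kB p5(2)] by blast
  have k5: "reg s5 rK < 4" using g5 k by simp
  have nb5: "nbhd E' v = new_nbhd pivot (reg s5 rK) E B ?w v" if "v \<in> {1..n}" for v
    using nb[OF that] g5 by simp
  obtain t6 s6 where e6: "exec (build N cl i j) s5 t6 s6" and r6: "
    t6 \<le> 6 + (\<Sum>v = 1..n. 71 + 2 * N + 20 * (deg E v + additions E B (reg s5 rK) pivot ?w v)) \<and>
    stores_state N cl j s6 n E' (\<lambda>v. u v * correction pivot (reg s5 rK) (v \<in> B) (mark pivot E ?w v)) \<and>
    unchanged (insert rE build_regs) {PAR, TMP, 3 * j, 3 * j + 1, 3 * j + 2} s5 s6"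
    by (rule wpE[OF wp_build[OF cl st5 E u ij B g5(1,2) w5 h5 g5(3,4) p5(1) k5 g5(6) p5(3) nb5]])
  let ?S = "\<Sum>x\<in>B. Suc (deg E x)"
  have S: "?S \<le> d + n" using sum_support_le[OF B, of E] d by linarith
  have add: "(\<Sum>v = 1..n. additions E B k pivot ?w v) \<le> 3 * ?S"
    by (rule sum_additions[OF E B p5(4)])
  have T6: "t6 \<le> 6 + n * (71 + 2 * N) + 20 * (d + 3 * ?S)"
  proof -
    have "(\<Sum>v = 1..n. 71 + 2 * N + 20 * (deg E v + additions E B k pivot ?w v))
      = n * (71 + 2 * N) + 20 * (degree_sum n E + (\<Sum>v = 1..n. additions E B k pivot ?w v))"
      by (simp add: sum.distrib degree_sum_def flip: sum_distrib_left)
    then have "t6 \<le> 6 + (n * (71 + 2 * N) + 20 * (degree_sum n E + (\<Sum>v = 1..n. additions E B k pivot ?w v)))"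
      using conjunct1[OF r6] unfolding g5 by simp
    moreover have "20 * (degree_sum n E + (\<Sum>v = 1..n. additions E B k pivot ?w v)) \<le> 20 * (d + 3 * ?S)"
      by (intro mult_le_mono2 add_mono d add)
    ultimately show ?thesis by linarith
  qed
  \<comment> \<open>The additions amount to at most \<open>3 * (d + n)\<close>, which is where
    \<open>4 * d + 3 * n\<close> comes from.\<close>
  have "degree_sum n E' \<le> (\<Sum>v = 1..n. deg E v + additions E B k pivot ?w v)"
    unfolding degree_sum_def
  proof (rule sum_mono)
    fix v assume "v \<in> {1..n}"
    then show "deg E' v \<le> deg E v + additions E B k pivot ?w v"
      using card_new_nbhd_le[OF E B, of pivot k ?w v] nb by simp
  qed
  also have "\<dots> = degree_sum n E + (\<Sum>v = 1..n. additions E B k pivot ?w v)"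
    by (simp add: sum.distrib degree_sum_def)
  also have "\<dots> \<le> 4 * d + 3 * n" using d add S by linarith
  finally have d': "degree_sum n E' \<le> 4 * d + 3 * n" .
  have amp: "stage ?\<sigma> ?qs \<psi> X = (c * c') *
      tensor_amp n (\<lambda>v. u v * correction pivot k (v \<in> B) (mark pivot E ?w v)) (graph_sign E') X"
    if X: "X \<subseteq> {1..n}" for X
  proof -
    have "stage ?\<sigma> ?qs \<psi> X = stage ?\<sigma> ?qs (\<lambda>X. c * tensor_amp n u (graph_sign E) X) X"
      by (rule stage_cong[OF c qs X])
    then show ?thesis unfolding stage_smult c'[OF X] by simp
  qed
  have lc: "u v * correction pivot k (v \<in> B) (mark pivot E ?w v) \<in> local_clifford" if "v \<in> {1..n}" for v
    using u[OF that] by (intro mult_local_clifford correction_local_clifford)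
  have "holds_state N cl j s6 n (4 * d + 3 * n) (stage ?\<sigma> ?qs \<psi>)"
    unfolding holds_state_def
  proof (rule exI[of _ E'], rule exI[of _ "\<lambda>v. u v * correction pivot k (v \<in> B) (mark pivot E ?w v)"],
      rule exI[of _ "c * c'"], intro conjI ballI allI impI)
    show "stores_state N cl j s6 n E' (\<lambda>v. u v * correction pivot k (v \<in> B) (mark pivot E ?w v))"
      using r6 unfolding g5 by blast
  qed (use E' lc d' amp in simp_all)
  moreover have "unchanged {rS..rE} ({3 * j, 3 * j + 1, 3 * j + 2} \<union> {PAR..MK}) s s6"
    using u5 r6 by (auto simp: unchanged_def)
  moreover have "t1 + (1 + (t3 + (t4 + (t5 + t6)))) \<le> stage_time N st * (n + 1 + d)"
  proof -
    have "t1 + (1 + (t3 + (t4 + (t5 + t6)))) \<le> (20 + 5 * n) + (1 + ((1 + ?l * (50 + 2 * N + 10 * n)) +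
      ((10 + 10 * (?l * (n + 1)) + 4 * n) + ((60 + 20 * (d + n)) + (6 + n * (71 + 2 * N) + 20 * (d + 3 * (d + n)))))))"
    proof (intro add_mono order_refl)
      have "10 * reg s3 rL \<le> 10 * (?l * (n + 1))" by (rule mult_le_mono2[OF g3(3)])
      then show "t4 \<le> 10 + 10 * (?l * (n + 1)) + 4 * n"
        by (rule order_trans[OF conjunct1[OF r4], OF add_mono[OF add_mono[OF order_refl]]]) (use cB in simp)
      have "20 * ?S \<le> 20 * (d + n)" by (rule mult_le_mono2[OF S])
      then show "t5 \<le> 60 + 20 * (d + n)" by (rule order_trans[OF conjunct1[OF r5] add_left_mono])
      have "20 * (d + 3 * ?S) \<le> 20 * (d + 3 * (d + n))" by (intro mult_le_mono2 add_left_mono S)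
      then show "t6 \<le> 6 + n * (71 + 2 * N) + 20 * (d + 3 * (d + n))"
        by (rule order_trans[OF T6 add_left_mono])
    qed (use r1 r3 in blast)+
    also have "\<dots> \<le> stage_time N st * (n + 1 + d)"
      unfolding stage_time_def by (simp add: algebra_simps)
    finally show ?thesis .
  qed
  ultimately show ?thesis unfolding stage_program_def seqs.simps
    by (intro wp_SeqI[OF e1] wp_SeqI[OF e2] wp_SeqI[OF e3] wp_SeqI[OF e4] wp_SeqI[OF e5] wpI[OF e6]) blast
qed

section \<open>The simulation of a gate\<close>

lemma holds_state_cong:
  assumes "holds_state N cl i s n d \<psi>" "unchanged R A s s'" "{3 * i, 3 * i + 1, 3 * i + 2} \<inter> A = {}"
  shows "holds_state N cl i s' n d \<psi>"
proof -
  from assms(1) obtain E u c where "simple_graph n E" "\<forall>v\<in>{1..n}. u v \<in> local_clifford"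
    "stores_state N cl i s n E u" "degree_sum n E \<le> d"
    "\<forall>X\<subseteq>{1..n}. \<psi> X = c * tensor_amp n u (graph_sign E) X"
    unfolding holds_state_def by blast
  then show ?thesis
    unfolding holds_state_def by (metis stores_state_cong[OF _ assms(2,3)])
qed

text \<open>The first summand goes from slot 0 to slot 1, the second one through slots 3 and 4 to
  slot 2. Slot 0 is never written, so it can be read twice, and the arrays of slots 0 to 4 end just
  below \<open>PAR\<close>. Register \<open>m\<close> holds the last qubit acted on, the target of
  \<open>g\<close>.\<close>

definition gate_program ::
  "nat \<Rightarrow> (nat \<Rightarrow> complex mat) \<Rightarrow> nat \<Rightarrow> (nat \<Rightarrow> nat \<times> (bool \<times> nat) list) \<Rightarrow> complex mat \<Rightarrow> program" where
  "gate_program N cl m sts g = seqs [stage_program N cl 0 1 (sts 0), stage_program N cl 0 3 (sts 1),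
     stage_program N cl 3 4 (sts 2), stage_program N cl 4 2 (sts 3), update_clifford N cl 2 2 m ((*) g)]"

text \<open>The factors 4 and 16 account for the growth of the degree sum: \<open>n + 1 + d\<close>
  is at most multiplied by 4 when \<open>d\<close> is replaced by \<open>4 * d + 3 * n\<close>, and
  the last stage sees this growth twice.\<close>

definition gate_time :: "nat \<Rightarrow> (nat \<Rightarrow> nat \<times> (bool \<times> nat) list) \<Rightarrow> nat" where
  "gate_time N sts = stage_time N (sts 0) + stage_time N (sts 1) + 4 * stage_time N (sts 2) +
     16 * stage_time N (sts 3) + 3 + 2 * N"

lemma map_regs_at_qubits:
  assumes "\<And>i. i < m \<Longrightarrow> reg s (i + 1) = qs ! i" "valid_stage m st"
  shows "map (map_prod id (reg s)) (snd st) = at_qubits qs (snd st)"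
  unfolding at_qubits_def
proof (intro map_cong refl)
  fix p assume "p \<in> set (snd st)"
  then have "1 \<le> snd p" "snd p \<le> m" using assms(2) by (auto simp: valid_stage_def)
  then have "reg s (snd p) = qs ! (snd p - 1)" using assms(1)[of "snd p - 1"] by simp
  then show "map_prod id (reg s) p = map_prod id (\<lambda>r. qs ! (r - 1)) p" by (cases p) simp
qed

lemma wp_stage_qubits:
  assumes cl: "clifford_numbering N cl" and h: "holds_state N cl i s n d \<psi>"
    and ij: "i \<le> 4" "j \<le> 4" "i \<noteq> j" and n: "reg s 0 = n" and m: "m \<le> 3" "length qs = m"
    and st: "valid_stage m st" and qs: "set qs \<subseteq> {1..n}" and regs: "\<And>i. i < m \<Longrightarrow> reg s (i + 1) = qs ! i"
  shows "wp (stage_program N cl i j st) (\<lambda>t s'. t \<le> stage_time N st * (n + 1 + d) \<and>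
    holds_state N cl j s' n (4 * d + 3 * n) (run_stage qs st \<psi>) \<and>
    unchanged {rS..rE} ({3 * j, 3 * j + 1, 3 * j + 2} \<union> {PAR..MK}) s s') s"
proof -
  have eq: "at_qubits qs (snd st) = map (map_prod id (reg s)) (snd st)"
    by (rule map_regs_at_qubits[OF _ st, symmetric]) (rule regs)
  show ?thesis unfolding run_stage_def eq
  proof (rule wp_stage_program[OF cl h ij n])
    show "fst st < 4" using st by (simp add: valid_stage_def)
    fix p assume "p \<in> set (snd st)"
    then have p: "1 \<le> snd p" "snd p \<le> m" using st by (auto simp: valid_stage_def)
    have "reg s (snd p) = qs ! (snd p - 1)" using regs[of "snd p - 1"] p by simp
    moreover have "qs ! (snd p - 1) \<in> set qs" using p m by (intro nth_mem) simp
    ultimately have "reg s (snd p) \<in> {1..n}" using qs by (simp only: subsetD)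
    then show "snd p \<le> 3 \<and> reg s (snd p) \<in> {1..n}" using p m by simp
  qed
qed

lemma gate_amp_tensor_amp:
  assumes "X \<subseteq> {1..n}" "q \<in> {1..n}"
  shows "gate_amp [q] g \<psi> X = tensor_amp n (on_qubit g q) \<psi> X"
  using tensor_amp_on_qubit[OF assms] by (simp add: gate_amp_single)

text \<open>In contrast to the corrections of a stage, \<open>g\<close> acts after the stored
  operations and so multiplies from the left; the graph stays as it is.\<close>

lemma wp_update_holds_state:
  assumes cl: "clifford_numbering N cl" and h: "holds_state N cl j s n d \<psi>" and g: "g \<in> local_clifford"
    and q: "reg s r \<in> {1..n}" and r: "r \<notin> {rS, rC}"
  shows "wp (update_clifford N cl j j r ((*) g)) (\<lambda>t s'. t \<le> 3 + 2 * N \<and>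
    holds_state N cl j s' n d (gate_amp [reg s r] g \<psi>) \<and> unchanged {rS, rC} {3 * j + 2} s s') s"
proof -
  let ?q = "reg s r"
  from h obtain E u c where E: "simple_graph n E" and u: "\<And>v. v \<in> {1..n} \<Longrightarrow> u v \<in> local_clifford"
    and st: "stores_state N cl j s n E u" and d: "degree_sum n E \<le> d"
    and c: "\<And>X. X \<subseteq> {1..n} \<Longrightarrow> \<psi> X = c * tensor_amp n u (graph_sign E) X"
    unfolding holds_state_def by blast
  have num: "arr s (3 * j + 2) ?q < N" "cl (arr s (3 * j + 2) ?q) = u ?q"
    using stores_stateD[OF st q] by simp_all
  have lc: "g * cl (arr s (3 * j + 2) ?q) \<in> local_clifford"
    unfolding num by (intro mult_local_clifford g u q)
  let ?u = "u(?q := g * u ?q)"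
  have u': "?u v \<in> local_clifford" if "v \<in> {1..n}" for v
    using u[OF that] u[OF q] g mult_local_clifford by simp
  have amp: "gate_amp [?q] g \<psi> X = c * tensor_amp n ?u (graph_sign E) X" if X: "X \<subseteq> {1..n}" for X
  proof -
    have "gate_amp [?q] g \<psi> X = tensor_amp n (on_qubit g ?q) \<psi> X"
      by (rule gate_amp_tensor_amp[OF X q])
    also have "\<dots> = tensor_amp n (on_qubit g ?q) (\<lambda>X. c * tensor_amp n u (graph_sign E) X) X"
      by (rule tensor_amp_cong[OF refl c])
    also have "\<dots> = c * tensor_amp n (on_qubit g ?q) (tensor_amp n u (graph_sign E)) X"
      by (rule tensor_amp_smult)
    also have "tensor_amp n (on_qubit g ?q) (tensor_amp n u (graph_sign E)) X
        = tensor_amp n (\<lambda>v. on_qubit g ?q v * u v) (graph_sign E) X"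
      using local_clifford_carrier[OF g] local_clifford_carrier[OF u]
      by (intro tensor_amp_mult) (auto simp: on_qubit_def)
    also have "\<dots> = tensor_amp n ?u (graph_sign E) X"
    proof (rule tensor_amp_cong)
      fix v assume "v \<in> {1..n}"
      from left_mult_one_mat[OF local_clifford_carrier[OF u[OF this]]]
      show "on_qubit g ?q v * u v = ?u v" by (simp add: on_qubit_def)
    qed simp
    finally show ?thesis .
  qed
  show ?thesis
  proof (rule wp_mono[OF wp_update_clifford[where f = "(*) g", OF cl num(1) lc r]])
    fix t s'
    assume r': "t \<le> 3 + 2 * N \<and> (\<exists>c<N. cl c = g * cl (arr s (3 * j + 2) ?q) \<and>
      arr s' (3 * j + 2) = (arr s (3 * j + 2))(?q := c)) \<and> unchanged {rS, rC} {3 * j + 2} s s'"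
    then obtain c' where c': "c' < N" "cl c' = g * u ?q" "arr s' (3 * j + 2) = (arr s (3 * j + 2))(?q := c')"
      unfolding num by blast
    have "arr s' (3 * j) = arr s (3 * j)" "arr s' (3 * j + 1) = arr s (3 * j + 1)"
      using r' by (simp_all add: unchanged_def)
    then have "stores_state N cl j s' n E ?u"
      using st c'(1,2) unfolding stores_state_def Let_def c'(3) by simp
    then have "holds_state N cl j s' n d (gate_amp [?q] g \<psi>)"
      unfolding holds_state_def
      by (intro exI[of _ E] exI[of _ ?u] exI[of _ c] conjI ballI allI impI E u' d amp)
    then show "t \<le> 3 + 2 * N \<and> holds_state N cl j s' n d (gate_amp [?q] g \<psi>) \<and>
      unchanged {rS, rC} {3 * j + 2} s s'" using r' by blast
  qed
qed

lemma wp_gate_program: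
  assumes cl: "clifford_numbering N cl" and h: "holds_state N cl 0 s n d \<psi>" and g: "g \<in> local_clifford"
    and n: "reg s 0 = n" and m: "m \<in> {1..3}" "length qs = m" and sts: "\<And>i. valid_stage m (sts i)"
    and qs: "set qs \<subseteq> {1..n}" and regs: "\<And>i. i < m \<Longrightarrow> reg s (i + 1) = qs ! i"
  shows "wp (gate_program N cl m sts g) (\<lambda>t s'. t \<le> gate_time N sts * (n + 1 + d) \<and>
    (\<exists>d. holds_state N cl 1 s' n d (run_stage qs (sts 0) \<psi>)) \<and>
    (\<exists>d. holds_state N cl 2 s' n d (gate_amp [qs ! (m - 1)] g
      (run_stage qs (sts 3) (run_stage qs (sts 2) (run_stage qs (sts 1) \<psi>)))))) s"
proof -
  have m3: "m \<le> 3" using m by simp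
  let ?J = "\<lambda>j::nat. {3 * j, 3 * j + 1, 3 * j + 2} \<union> {PAR..MK}"
  have low: "reg s2 r = reg s1 r" if "unchanged {rS..rE} A s1 s2" "r \<le> 3" for s1 s2 A r
    using unchangedD(1)[OF that(1), of r] that(2) by auto
  have lows: "reg s2 0 = n \<and> (\<forall>i<m. reg s2 (i + 1) = qs ! i)"
    if "unchanged {rS..rE} A s1 s2" "reg s1 0 = n \<and> (\<forall>i<m. reg s1 (i + 1) = qs ! i)" for s1 s2 A
    using low[OF that(1)] that(2) m3 by simp
  have ij: "(0::nat) \<le> 4" "(1::nat) \<le> 4" "(0::nat) \<noteq> 1" by simp_all
  obtain t1 s1 where e1: "exec (stage_program N cl 0 1 (sts 0)) s t1 s1" and
    r1: "t1 \<le> stage_time N (sts 0) * (n + 1 + d) \<and>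
      holds_state N cl 1 s1 n (4 * d + 3 * n) (run_stage qs (sts 0) \<psi>) \<and> unchanged {rS..rE} (?J 1) s s1"
    by (rule wpE[OF wp_stage_qubits[OF cl h ij n m3 m(2) sts qs regs]])
  have n1: "reg s1 0 = n \<and> (\<forall>i<m. reg s1 (i + 1) = qs ! i)"
    by (rule lows[OF conjunct2[OF conjunct2[OF r1]]]) (use n regs in simp)
  have h1: "holds_state N cl 0 s1 n d \<psi>"
    by (rule holds_state_cong[OF h conjunct2[OF conjunct2[OF r1]]]) auto
  have ij: "(0::nat) \<le> 4" "(3::nat) \<le> 4" "(0::nat) \<noteq> 3" by simp_all
  obtain t2 s2 where e2: "exec (stage_program N cl 0 3 (sts 1)) s1 t2 s2" and
    r2: "t2 \<le> stage_time N (sts 1) * (n + 1 + d) \<and>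
      holds_state N cl 3 s2 n (4 * d + 3 * n) (run_stage qs (sts 1) \<psi>) \<and> unchanged {rS..rE} (?J 3) s1 s2"
    by (rule wpE[OF wp_stage_qubits[OF cl h1 ij conjunct1[OF n1] m3 m(2) sts qs conjunct2[OF n1, rule_format]]])
  have n2: "reg s2 0 = n \<and> (\<forall>i<m. reg s2 (i + 1) = qs ! i)"
    by (rule lows[OF conjunct2[OF conjunct2[OF r2]] n1])
  have h2: "holds_state N cl 3 s2 n (4 * d + 3 * n) (run_stage qs (sts 1) \<psi>)" using r2 by blast
  have ij: "(3::nat) \<le> 4" "(4::nat) \<le> 4" "(3::nat) \<noteq> 4" by simp_all
  obtain t3 s3 where e3: "exec (stage_program N cl 3 4 (sts 2)) s2 t3 s3" and
    r3: "t3 \<le> stage_time N (sts 2) * (n + 1 + (4 * d + 3 * n)) \<and>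
      holds_state N cl 4 s3 n (4 * (4 * d + 3 * n) + 3 * n) (run_stage qs (sts 2) (run_stage qs (sts 1) \<psi>)) \<and>
      unchanged {rS..rE} (?J 4) s2 s3"
    by (rule wpE[OF wp_stage_qubits[OF cl h2 ij conjunct1[OF n2] m3 m(2) sts qs conjunct2[OF n2, rule_format]]])
  have n3: "reg s3 0 = n \<and> (\<forall>i<m. reg s3 (i + 1) = qs ! i)"
    by (rule lows[OF conjunct2[OF conjunct2[OF r3]] n2])
  have h3: "holds_state N cl 4 s3 n (4 * (4 * d + 3 * n) + 3 * n) (run_stage qs (sts 2) (run_stage qs (sts 1) \<psi>))"
    using r3 by blast
  have ij: "(4::nat) \<le> 4" "(2::nat) \<le> 4" "(4::nat) \<noteq> 2" by simp_all
  define d4 where "d4 = 4 * (4 * (4 * d + 3 * n) + 3 * n) + 3 * n"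
  obtain t4 s4 where e4: "exec (stage_program N cl 4 2 (sts 3)) s3 t4 s4" and
    r4: "t4 \<le> stage_time N (sts 3) * (n + 1 + (4 * (4 * d + 3 * n) + 3 * n)) \<and>
      holds_state N cl 2 s4 n d4 (run_stage qs (sts 3) (run_stage qs (sts 2) (run_stage qs (sts 1) \<psi>))) \<and>
      unchanged {rS..rE} (?J 2) s3 s4"
    unfolding d4_def by (rule wpE[OF wp_stage_qubits[OF cl h3 ij conjunct1[OF n3] m3 m(2) sts qs conjunct2[OF n3, rule_format]]])
  have n4: "reg s4 0 = n \<and> (\<forall>i<m. reg s4 (i + 1) = qs ! i)"
    by (rule lows[OF conjunct2[OF conjunct2[OF r4]] n3])
  have q4: "reg s4 m = qs ! (m - 1)" using n4[THEN conjunct2, THEN spec, of "m - 1"] m by simp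
  have qn: "reg s4 m \<in> {1..n}"   proof -
    have "qs ! (m - 1) \<in> set qs" using m by (intro nth_mem) auto
    then show ?thesis unfolding q4 using qs by blast
  qed
  have h4: "holds_state N cl 2 s4 n d4 (run_stage qs (sts 3) (run_stage qs (sts 2) (run_stage qs (sts 1) \<psi>)))"
    using r4 by blast
  have mr: "m \<notin> {rS, rC}" using m3 by auto
  obtain t5 s5 where e5: "exec (update_clifford N cl 2 2 m ((*) g)) s4 t5 s5" and
    r5: "t5 \<le> 3 + 2 * N \<and> holds_state N cl 2 s5 n d4 (gate_amp [reg s4 m] g
      (run_stage qs (sts 3) (run_stage qs (sts 2) (run_stage qs (sts 1) \<psi>)))) \<and>
      unchanged {rS, rC} {3 * 2 + 2} s4 s5"
    by (rule wpE[OF wp_update_holds_state[OF cl h4 g qn mr]])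
  note u = unchanged_trans[OF unchanged_trans[OF unchanged_trans[OF
    conjunct2[OF conjunct2[OF r2]] conjunct2[OF conjunct2[OF r3]]]
    conjunct2[OF conjunct2[OF r4]]] conjunct2[OF conjunct2[OF r5]]]
  have h5: "holds_state N cl 1 s5 n (4 * d + 3 * n) (run_stage qs (sts 0) \<psi>)"
    by (rule holds_state_cong[OF conjunct1[OF conjunct2[OF r1]] u]) auto
  have "t1 + (t2 + (t3 + (t4 + t5))) \<le> gate_time N sts * (n + 1 + d)"
  proof -
    have "t3 \<le> 4 * stage_time N (sts 2) * (n + 1 + d)"
      by (rule order_trans[OF conjunct1[OF r3]]) (simp add: algebra_simps)
    moreover have "t4 \<le> 16 * stage_time N (sts 3) * (n + 1 + d)"
      by (rule order_trans[OF conjunct1[OF r4]]) (simp add: algebra_simps)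
    moreover have "t5 \<le> (3 + 2 * N) * (n + 1 + d)"
      by (rule order_trans[OF conjunct1[OF r5]]) simp
    ultimately have "t1 + (t2 + (t3 + (t4 + t5))) \<le> stage_time N (sts 0) * (n + 1 + d) +
      (stage_time N (sts 1) * (n + 1 + d) + (4 * stage_time N (sts 2) * (n + 1 + d) +
      (16 * stage_time N (sts 3) * (n + 1 + d) + (3 + 2 * N) * (n + 1 + d))))"
      using conjunct1[OF r1] conjunct1[OF r2] by (intro add_mono)
    also have "\<dots> = gate_time N sts * (n + 1 + d)"
      unfolding gate_time_def by (simp only: add_mult_distrib add.assoc)
    finally show ?thesis .
  qed
  then show ?thesis unfolding gate_program_def seqs.simps
    by (intro wp_SeqI[OF e1] wp_SeqI[OF e2] wp_SeqI[OF e3] wp_SeqI[OF e4] wpI[OF e5] conjI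
      exI[of _ "4 * d + 3 * n"] exI[of _ d4] h5 conjunct1[OF conjunct2[OF r5[unfolded q4]]])
qed

text \<open>The number of vertices times the average degree is the degree sum, and the maximum with
  1 becomes the \<open>n\<close> that remains for sparse graphs.\<close>

lemma average_degree_sum:
  assumes "0 < n"
  shows "real n * max 1 (average_degree n E) = max (real n) (real (degree_sum n E))"
proof -
  have "average_degree n E = real (degree_sum n E) / real n"
    by (simp add: average_degree_def degree_sum_def)
  then show ?thesis using assms by (simp add: max_mult_distrib_left)
qed

text \<open>Returns from sign functions to vectors: the normalisation of the graph state is divided
  out of the scalar, which also takes up the coefficient \<open>a\<close> from the decomposition of
  the gate.\<close>

lemma holds_state_vec:
  assumes "holds_state N cl j s n d \<psi>"
  obtains E u c where "simple_graph n E" "\<forall>v\<in>{1..n}. u v \<in> local_clifford" "stores_state N cl j s n E u"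
    "state n (\<lambda>X. a * \<psi> X) = c \<cdot>\<^sub>v (tensor_op n u *\<^sub>v graph_state n E)"
proof -
  from assms obtain E u c where E: "simple_graph n E" and u: "\<forall>v\<in>{1..n}. u v \<in> local_clifford"
    and st: "stores_state N cl j s n E u"
    and c: "\<And>X. X \<subseteq> {1..n} \<Longrightarrow> \<psi> X = c * tensor_amp n u (graph_sign E) X"
    unfolding holds_state_def by blast
  let ?r = "complex_of_real (1 / sqrt 2) ^ n"
  have r: "?r \<noteq> 0" by simp
  have "(a * c / ?r) \<cdot>\<^sub>v (tensor_op n u *\<^sub>v graph_state n E)
      = state n (\<lambda>X. a * c / ?r * (?r * tensor_amp n u (graph_sign E) X))"
    unfolding graph_state_state[OF E] tensor_op_state tensor_amp_smult state_smult ..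
  also have "\<dots> = state n (\<lambda>X. a * \<psi> X)"
    using r by (intro state_cong) (simp add: c)
  finally show thesis by (intro that[OF E u st]) (rule sym)
qed

theorem theoremA:
  fixes C :: "complex mat" and N :: nat and cl :: "nat \<Rightarrow> complex mat"
  assumes "C \<in> gate_set" and "clifford_numbering N cl"
  shows "\<exists>(p :: program) (K :: real).
    \<forall>(n :: nat) (qs :: nat list) (E :: nat set set) (u :: nat \<Rightarrow> complex mat) (s :: memory).
      distinct qs \<and> set qs \<subseteq> {1..n} \<and> dim_row C = 2 ^ length qs \<and>
      simple_graph n E \<and> (\<forall>v\<in>{1..n}. u v \<in> local_clifford) \<and>
      input_memory N cl s n qs E u \<longrightarrow>
      (\<exists>(t :: nat) (s' :: memory) (E1 :: nat set set) (E2 :: nat set set)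
          (u1 :: nat \<Rightarrow> complex mat) (u2 :: nat \<Rightarrow> complex mat) (c1 :: complex) (c2 :: complex).
        exec p s t s' \<and>
        real t \<le> K * (real n * max 1 (average_degree n E)) \<and>
        simple_graph n E1 \<and> (\<forall>v\<in>{1..n}. u1 v \<in> local_clifford) \<and>
        stores_state N cl 1 s' n E1 u1 \<and>
        simple_graph n E2 \<and> (\<forall>v\<in>{1..n}. u2 v \<in> local_clifford) \<and>
        stores_state N cl 2 s' n E2 u2 \<and>
        on_qubits n qs C *\<^sub>v (tensor_op n u *\<^sub>v graph_state n E) =
          c1 \<cdot>\<^sub>v (tensor_op n u1 *\<^sub>v graph_state n E1) +
          c2 \<cdot>\<^sub>v (tensor_op n u2 *\<^sub>v graph_state n E2))"
proof -
  obtain m st0 st1 st2 st3 g a1 a2 where m: "m \<in> {1..3}" and dim: "dim_row C = 2 ^ m"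
    and v: "valid_stage m st0" "valid_stage m st1" "valid_stage m st2" "valid_stage m st3"
    and g: "g \<in> local_clifford"
    and C: "\<And>qs \<psi> X. distinct qs \<Longrightarrow> length qs = m \<Longrightarrow> gate_amp qs C \<psi> X = a1 * run_stage qs st0 \<psi> X +
      a2 * gate_amp [qs ! (m - 1)] g (run_stage qs st3 (run_stage qs st2 (run_stage qs st1 \<psi>))) X"
    by - (rule gate_decomposition[OF assms(1)], rule that)
  define sts where "sts i = (if i = 0 then st0 else if i = 1 then st1 else if i = 2 then st2 else st3)" for i :: nat
  have sts: "valid_stage m (sts i)" "sts 0 = st0" "sts 1 = st1" "sts 2 = st2" "sts 3 = st3" for i
    using v by (simp_all add: sts_def)
  let ?p = "gate_program N cl m sts g"
  let ?K = "3 * real (gate_time N sts)"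
  show ?thesis
  proof (rule exI[of _ ?p], rule exI[of _ ?K], intro allI impI, elim conjE)
    fix n qs E u s
    assume qs: "distinct qs" "set qs \<subseteq> {1..n}" "dim_row C = 2 ^ length qs"
      and E: "simple_graph n E" and u: "\<forall>v\<in>{1..n}. u v \<in> local_clifford"
      and input: "input_memory N cl s n qs E u"
    have len: "length qs = m" using qs(3) dim by simp
    \<comment> \<open>Every gate acts on at least one qubit, so \<open>n\<close> is positive and the
      average degree is a proper quotient.\<close>
    have "qs \<noteq> []" using len m by auto
    then have n: "0 < n" using qs(2) by (cases qs) auto
    let ?r = "complex_of_real (1 / sqrt 2) ^ n"
    let ?\<psi> = "tensor_amp n u (\<lambda>X. ?r * graph_sign E X)"
    let ?d = "degree_sum n E"
    have st: "stores_state N cl 0 s n E u" and reg0: "reg s 0 = n"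
      and regs: "\<And>i. i < m \<Longrightarrow> reg s (i + 1) = qs ! i"
      using input len by (simp_all add: input_memory_def)
    have "holds_state N cl 0 s n ?d ?\<psi>"
      unfolding holds_state_def
      by (rule exI[of _ E], rule exI[of _ u], rule exI[of _ ?r])
        (use E u st in \<open>simp add: tensor_amp_smult\<close>)
    then have "wp ?p (\<lambda>t s'. t \<le> gate_time N sts * (n + 1 + ?d) \<and>
      (\<exists>d. holds_state N cl 1 s' n d (run_stage qs (sts 0) ?\<psi>)) \<and>
      (\<exists>d. holds_state N cl 2 s' n d (gate_amp [qs ! (m - 1)] g
        (run_stage qs (sts 3) (run_stage qs (sts 2) (run_stage qs (sts 1) ?\<psi>)))))) s"
      by (rule wp_gate_program[OF assms(2) _ g reg0 m len _ qs(2)]) (rule sts(1), rule regs)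
    then obtain t s' d1 d2 where e: "exec ?p s t s'" and t: "t \<le> gate_time N sts * (n + 1 + ?d)"
      and h1: "holds_state N cl 1 s' n d1 (run_stage qs st0 ?\<psi>)"
      and h2: "holds_state N cl 2 s' n d2 (gate_amp [qs ! (m - 1)] g
        (run_stage qs st3 (run_stage qs st2 (run_stage qs st1 ?\<psi>))))"
      unfolding sts(2-) wp_def by blast
    have time: "real t \<le> ?K * (real n * max 1 (average_degree n E))"
    proof -
      have "real t \<le> real (gate_time N sts * (n + 1 + ?d))"
        using t by (simp only: of_nat_le_iff)
      also have "\<dots> = real (gate_time N sts) * real (n + 1 + ?d)" by (rule of_nat_mult)
      \<comment> \<open>Each of \<open>n\<close>, 1 and the degree sum is at most the maximum, since
        \<open>n\<close> is positive; this is the 3 in \<open>?K\<close>.\<close>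
      also have "real (n + 1 + ?d) \<le> 3 * max (real n) (real ?d)" using n by simp
      finally show ?thesis unfolding average_degree_sum[OF n] by (simp add: mult_left_mono)
    qed
    obtain E1 u1 c1 where s1: "simple_graph n E1" "\<forall>v\<in>{1..n}. u1 v \<in> local_clifford"
      "stores_state N cl 1 s' n E1 u1"
      and c1: "state n (\<lambda>X. a1 * run_stage qs st0 ?\<psi> X) = c1 \<cdot>\<^sub>v (tensor_op n u1 *\<^sub>v graph_state n E1)"
      by (rule holds_state_vec[OF h1])
    obtain E2 u2 c2 where s2: "simple_graph n E2" "\<forall>v\<in>{1..n}. u2 v \<in> local_clifford"
      "stores_state N cl 2 s' n E2 u2"
      and c2: "state n (\<lambda>X. a2 * gate_amp [qs ! (m - 1)] g
        (run_stage qs st3 (run_stage qs st2 (run_stage qs st1 ?\<psi>))) X)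
        = c2 \<cdot>\<^sub>v (tensor_op n u2 *\<^sub>v graph_state n E2)"
      by (rule holds_state_vec[OF h2])
    have "on_qubits n qs C *\<^sub>v (tensor_op n u *\<^sub>v graph_state n E) =
          c1 \<cdot>\<^sub>v (tensor_op n u1 *\<^sub>v graph_state n E1) + c2 \<cdot>\<^sub>v (tensor_op n u2 *\<^sub>v graph_state n E2)"
      unfolding graph_state_state[OF E] tensor_op_state on_qubits_state[OF qs(2)] C[OF qs(1) len]
        c1[symmetric] c2[symmetric] state_add ..
    with e time s1 s2 show "\<exists>t s' E1 E2 u1 u2 c1 c2. exec ?p s t s' \<and>
        real t \<le> ?K * (real n * max 1 (average_degree n E)) \<and>
        simple_graph n E1 \<and> (\<forall>v\<in>{1..n}. u1 v \<in> local_clifford) \<and>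
        stores_state N cl 1 s' n E1 u1 \<and>
        simple_graph n E2 \<and> (\<forall>v\<in>{1..n}. u2 v \<in> local_clifford) \<and>
        stores_state N cl 2 s' n E2 u2 \<and>
        on_qubits n qs C *\<^sub>v (tensor_op n u *\<^sub>v graph_state n E) =
          c1 \<cdot>\<^sub>v (tensor_op n u1 *\<^sub>v graph_state n E1) +
          c2 \<cdot>\<^sub>v (tensor_op n u2 *\<^sub>v graph_state n E2)"
      by blast
  qed
qed

end
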